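(* Let $h\in\mathbb{R}[x_1,\dots,x_m]$ be a hyperbolic polynomial with respect to a direction $e\in\mathbb{R}^m$. Let $\mu$ be a homogeneous strongly Rayleigh probability distribution on subsets of $[n]$ such that the marginal probability $\Pr_{S\sim\mu}[i\in S]$ of each element $i\in[n]$ is at most $\epsilon_1$. Let $v_1,\dots,v_n\in\Gamma_+^h$ be vectors with $\sum_{i=1}^n v_i=e$ such that for all $i\in[n]$, $\mathrm{rank}_h(v_i)\le 1$ and $\|v_i\|_h\le\epsilon_2$. Then $$\Pr_{S\sim\mu}\left[\Big\|\sum_{i\in S}v_i\Big\|_h\le 4(\epsilon_1+\epsilon_2)+2(\epsilon_1+\epsilon_2)^2\right]>0 .$$
   Context: $[n]=\{1,\dots,n\}$. A homogeneous polynomial $h\in\mathbb{R}[x_1,\dots,x_m]$ of degree $d$ is hyperbolic with respect to $e\in\mathbb{R}^m$ if $h(e)>0$ and for every $x\in\mathbb{R}^m$ the univariate polynomial $t\mapsto h(te-x)$ has only real roots. These $d$ roots, counted with multiplicity, are denoted $\lambda_1(x)\ge\cdots\ge\lambda_d(x)$. The closed hyperbolicity cone is $\Gamma_+^h=\{x\in\mathbb{R}^m:\lambda_d(x)\ge 0\}$. Further, $\mathrm{rank}_h(x)=|\{i\in[d]:\lambda_i(x)\ne 0\}|$ and $\|x\|_h=\max_{i\in[d]}|\lambda_i(x)|$, all taken with respect to $e$. A multivariate polynomial with real coefficients is real stable if it has no zero $(z_1,\dots,z_n)\in\mathbb{C}^n$ with $\mathrm{Im}(z_i)>0$ for all $i$.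 A probability distribution $\mu:2^{[n]}\to\mathbb{R}_{\ge 0}$ is strongly Rayleigh if its generating polynomial $g_\mu(z)=\sum_{S\subseteq[n]}\mu(S)\prod_{i\in S}z_i$ is real stable; it is homogeneous if $g_\mu$ is a homogeneous polynomial. *)

theory Defs
  imports
    "HOL-Probability.Probability"
    "HOL-Library.Poly_Mapping"
    "HOL-Computational_Algebra.Polynomial"
begin

text \<open>Real polynomials in variables of type \<open>'v\<close>: a monomial is its finitely supported
  exponent vector, a polynomial its finitely supported family of coefficients.\<close>

type_synonym 'v rmpoly = "('v \<Rightarrow>\<^sub>0 nat) \<Rightarrow>\<^sub>0 real"

text \<open>Substitution of \<open>x v\<close> for the variable \<open>v\<close>; the map \<open>c\<close> embeds the real coefficients
  into the target ring, which is \<open>\<real>\<close>, \<open>\<complex>\<close> or \<open>\<real>[t]\<close> below.\<close>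

definition mpsubst :: "(real \<Rightarrow> 'a::comm_semiring_1) \<Rightarrow> ('v \<Rightarrow> 'a) \<Rightarrow> 'v rmpoly \<Rightarrow> 'a" where
  "mpsubst c x p =
    (\<Sum>a \<in> Poly_Mapping.keys p. c (Poly_Mapping.lookup p a) *
       (\<Prod>v \<in> Poly_Mapping.keys a. x v ^ Poly_Mapping.lookup a v))"

definition homogeneous_of_degree :: "nat \<Rightarrow> 'v rmpoly \<Rightarrow> bool" where
  "homogeneous_of_degree d p \<longleftrightarrow>
    (\<forall>a \<in> Poly_Mapping.keys p. (\<Sum>v \<in> Poly_Mapping.keys a. Poly_Mapping.lookup a v) = d)"

text \<open>The univariate polynomial \<open>h(t e - x)\<close> in \<open>t\<close>.\<close>

definition hyp_charpoly :: "'m rmpoly \<Rightarrow> real ^ 'm \<Rightarrow> real ^ 'm \<Rightarrow> real poly" where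
  "hyp_charpoly h e x = mpsubst (\<lambda>r. [:r:]) (\<lambda>v. [:- (x $ v), e $ v:]) h"

lemma poly_hyp_charpoly:
  "poly (hyp_charpoly h e x) t = mpsubst (\<lambda>r. r) (($) (t *\<^sub>R e - x)) h"
  by (simp add: hyp_charpoly_def mpsubst_def poly_sum poly_prod)

definition hyperbolic :: "nat \<Rightarrow> 'm rmpoly \<Rightarrow> real ^ 'm \<Rightarrow> bool" where
  "hyperbolic d h e \<longleftrightarrow>
    homogeneous_of_degree d h \<and>
    mpsubst (\<lambda>r. r) (($) e) h > 0 \<and>
    (\<forall>x z. poly (map_poly complex_of_real (hyp_charpoly h e x)) z = 0 \<longrightarrow> z \<in> \<real>)"

text \<open>\<open>hyp_eigenvalue h e x i\<close> is the \<open>i\<close>-th largest root of \<open>h(t e - x)\<close>, counted with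
  multiplicity and indexed from 1. If \<open>h\<close> is hyperbolic of degree \<open>d\<close>, then this polynomial
  has degree \<open>d\<close> and leading coefficient \<open>h(e)\<close>, so the index ranges over \<open>{1..d}\<close>.\<close>

definition hyp_eigenvalue :: "'m rmpoly \<Rightarrow> real ^ 'm \<Rightarrow> real ^ 'm \<Rightarrow> nat \<Rightarrow> real" where
  "hyp_eigenvalue h e x i = rev (sorted_list_of_multiset (proots (hyp_charpoly h e x))) ! (i - 1)"

definition hyp_cone :: "nat \<Rightarrow> 'm rmpoly \<Rightarrow> real ^ 'm \<Rightarrow> (real ^ 'm) set" where
  "hyp_cone d h e = {x. hyp_eigenvalue h e x d \<ge> 0}"

definition hyp_rank :: "nat \<Rightarrow> 'm rmpoly \<Rightarrow> real ^ 'm \<Rightarrow> real ^ 'm \<Rightarrow> nat" where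
  "hyp_rank d h e x = card {i \<in> {1..d}. hyp_eigenvalue h e x i \<noteq> 0}"

definition hyp_norm :: "nat \<Rightarrow> 'm rmpoly \<Rightarrow> real ^ 'm \<Rightarrow> real ^ 'm \<Rightarrow> real" where
  "hyp_norm d h e x = Max ((\<lambda>i. \<bar>hyp_eigenvalue h e x i\<bar>) ` {1..d})"

text \<open>Real stability of a polynomial whose variables are indexed by \<open>V\<close>.\<close>

definition real_stable :: "'v set \<Rightarrow> 'v rmpoly \<Rightarrow> bool" where
  "real_stable V p \<longleftrightarrow> (\<forall>z. (\<forall>i \<in> V. Im (z i) > 0) \<longrightarrow> mpsubst complex_of_real z p \<noteq> 0)"

definition generating_poly :: "'v set \<Rightarrow> 'v set pmf \<Rightarrow> 'v rmpoly" where
  "generating_poly V \<mu> =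
    (\<Sum>S \<in> Pow V. Poly_Mapping.single (\<Sum>i\<in>S. Poly_Mapping.single i 1) (pmf \<mu> S))"

text \<open>Probability distributions on subsets of \<open>V\<close> are distributions on sets that are
  supported on \<open>Pow V\<close>.\<close>

definition strongly_rayleigh :: "'v set \<Rightarrow> 'v set pmf \<Rightarrow> bool" where
  "strongly_rayleigh V \<mu> \<longleftrightarrow> set_pmf \<mu> \<subseteq> Pow V \<and> real_stable V (generating_poly V \<mu>)"

definition homogeneous_distribution :: "'v set \<Rightarrow> 'v set pmf \<Rightarrow> bool" where
  "homogeneous_distribution V \<mu> \<longleftrightarrow> (\<exists>k. homogeneous_of_degree k (generating_poly V \<mu>))"

end

theory Submission
  imports
    Defs
    "HOL-Complex_Analysis.Complex_Analysis"
    "HOL-Computational_Algebra.Fundamental_Theorem_Algebra"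
begin

text \<open>
Substituting \<open>x = \<Sum>\<^sub>i z\<^sub>i v\<^sub>i\<close> turns \<open>h\<close> into a polynomial \<open>q\<close> in \<open>n\<close> variables. Because the \<open>v\<^sub>i\<close> lie
in the cone, add up to \<open>e\<close> and have rank at most one, \<open>q\<close> is real stable, homogeneous of degree
\<open>d\<close> and affine in every variable (\<open>q_stable_multiaffine\<close>), just like the generating polynomial
\<open>g\<close> of \<open>\<mu>\<close>. Up to the factor \<open>h(e)\<close>, the roots of \<open>q(t 1 - 1\<^sub>S)\<close> are the eigenvalues of
\<open>\<Sum>\<^bsub>i\<in>S\<^esub> v\<^sub>i\<close>, the logarithmic derivatives of \<open>q\<close> at the all-ones vector \<open>1\<close> are the norms of
the \<open>v\<^sub>i\<close>, and those of \<open>g\<close> are the marginals of \<open>\<mu>\<close>. The theorem thus becomes a statement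
about two stable multiaffine polynomials.

Since \<open>(1 - \<partial>\<^sup>2) (z r) = z r - 2 \<partial>r\<close> is \<open>z\<close> times the value of the affine \<open>r\<close> at \<open>z - 2/z\<close>, applying
\<open>\<Prod>\<^sub>i (1 - \<partial>\<^sub>i\<^sup>2)\<close> to \<open>g q\<close> and restricting to the diagonal \<open>z = x 1\<close> gives, up to a power
of \<open>x\<close>, the average over \<open>S\<close> of \<open>q(x\<^sup>2 1 - 2 \<cdot> 1\<^sub>S)\<close> (\<open>sub_pd2_genpoly_mult\<close>). The operators
\<open>1 - \<partial>\<^sub>i\<^sup>2 = (1 - \<partial>\<^sub>i) (1 + \<partial>\<^sub>i)\<close> preserve real stability, and this has two consequences.

First, the average is real-rooted in \<open>y = x\<^sup>2\<close>, and so is every average with respect to a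
reweighting of \<open>\<mu>\<close> by external fields. If all convex combinations of two polynomials with
positive leading coefficients are real-rooted, their largest roots cannot both exceed that of
their sum; deciding the elements \<open>1, \<dots>, n\<close> one after the other therefore leads to a set \<open>S\<close> of positive probability such that
\<open>q(y 1 - 2 \<cdot> 1\<^sub>S)\<close> has no root beyond the largest root of the average
(\<open>interlacing_selection\<close>).

Second, that largest root is controlled by a barrier (\<open>barrier_step\<close>): if \<open>\<partial>\<^sub>j p / p \<le> 1/w\<close> for all
\<open>j\<close> throughout the orthant above a point, then replacing \<open>p\<close> by \<open>p - \<partial>\<^sub>i\<^sup>2 p\<close> and moving the
\<open>i\<close>-th coordinate of the point up by any \<open>\<delta> \<ge> 2/w\<close> keeps these bounds for \<open>j \<noteq> i\<close>. With
\<open>\<epsilon> = \<epsilon>\<^sub>1 + \<epsilon>\<^sub>2\<close> the bounds hold for \<open>g q\<close> above \<open>t 1\<close> with \<open>w = t/\<epsilon>\<close>. The choice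
\<open>\<delta> = t = \<surd>(2\<epsilon>)\<close> moves the point to \<open>2 t 1\<close>, so the average is positive for
\<open>y \<ge> (2t)\<^sup>2 = 8 \<epsilon>\<close>. Halving \<open>y\<close> shows that the eigenvalues of \<open>\<Sum>\<^bsub>i\<in>S\<^esub> v\<^sub>i\<close> are at most \<open>4 \<epsilon>\<close>,
which is below the claimed bound.
\<close>

section \<open>Families of holomorphic functions without zeros\<close>

text \<open>Hurwitz's theorem for a family that depends continuously on a parameter.\<close>

lemma zero_free_limit:
  fixes f :: "'a::heine_borel \<Rightarrow> complex \<Rightarrow> complex"
  assumes U: "open U" "connected U"
    and cont: "continuous_on (T \<times> U) (\<lambda>(t, w). f t w)"
    and hol: "\<And>t. t \<in> T \<Longrightarrow> f t holomorphic_on U"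
    and X: "\<And>n::nat. X n \<in> T" "X \<longlonglongrightarrow> l" "l \<in> T"
    and nz: "\<And>n w. w \<in> U \<Longrightarrow> f (X n) w \<noteq> 0"
    and w0: "w0 \<in> U" "f l w0 \<noteq> 0"
    and w: "w \<in> U"
  shows "f l w \<noteq> 0"
proof (cases "f l constant_on U")
  case True
  then show ?thesis
    using w w0 by (metis constant_on_def)
next
  case False
  show ?thesis
  proof (rule Hurwitz_no_zeros[OF U _ _ _ False, of "\<lambda>n. f (X n)"])
    show "f (X n) holomorphic_on U" for n
      using hol X(1) by simp
    show "f l holomorphic_on U"
      using hol X(3) by simp
    show "uniform_limit K (\<lambda>n. f (X n)) (f l) sequentially" if K: "compact K" "K \<subseteq> U" for K
    proof (rule uniform_limitI)
      fix e :: real assume e: "e > 0"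
      let ?C = "insert l (range X) \<times> K"
      have "compact ?C"
        by (intro compact_Times compact_sequence_with_limit[OF X(2)] K(1))
      moreover have "continuous_on ?C (\<lambda>(t, w). f t w)"
        by (rule continuous_on_subset[OF cont]) (use X K in auto)
      ultimately have "uniformly_continuous_on ?C (\<lambda>(t, w). f t w)"
        by (simp add: compact_uniformly_continuous)
      then obtain \<delta> where \<delta>: "\<delta> > 0"
        and ud: "\<And>p q. p \<in> ?C \<Longrightarrow> q \<in> ?C \<Longrightarrow> dist q p < \<delta> \<Longrightarrow>
               dist ((\<lambda>(t, w). f t w) q) ((\<lambda>(t, w). f t w) p) < e"
        unfolding uniformly_continuous_on_def using e by meson
      have "\<forall>\<^sub>F n in sequentially. dist (X n) l < \<delta>"
        using X(2) \<delta> by (simp add: tendstoD)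
      then show "\<forall>\<^sub>F n in sequentially. \<forall>x\<in>K. dist (f (X n) x) (f l x) < e"
      proof eventually_elim
        case (elim n)
        show ?case
        proof
          fix x assume "x \<in> K"
          then show "dist (f (X n) x) (f l x) < e"
            using ud[of "(l, x)" "(X n, x)"] elim by (auto simp: dist_Pair_Pair)
        qed
      qed
    qed
  qed (use nz w in auto)
qed

text \<open>Zeros move continuously, so they can enter an open set only through its frontier or from
  infinity. Formally, the parameters with a zero in \<open>U\<close> form a compact set, and Hurwitz's theorem
  shows that the remaining ones are closed as well. Both stability of \<open>q\<close> and the comparison of
  largest roots below are instances, with \<open>U\<close> a half-plane.\<close>

lemma zero_free_homotopy:
  fixes f :: "real \<Rightarrow> complex \<Rightarrow> complex"
  assumes U: "open U" "connected U"
    and cont: "continuous_on ({0..1} \<times> UNIV) (\<lambda>(t, w). f t w)"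
    and hol: "\<And>t. t \<in> {0..1} \<Longrightarrow> f t holomorphic_on UNIV"
    and bdd: "\<And>t w. t \<in> {0..1} \<Longrightarrow> w \<in> U \<Longrightarrow> f t w = 0 \<Longrightarrow> norm w \<le> R"
    and frontier: "\<And>t w. t \<in> {0..1} \<Longrightarrow> w \<in> frontier U \<Longrightarrow> f t w \<noteq> 0"
    and nonzero: "\<And>t. t \<in> {0..1} \<Longrightarrow> \<exists>w\<in>U. f t w \<noteq> 0"
    and start: "\<And>w. w \<in> U \<Longrightarrow> f 0 w \<noteq> 0"
    and t: "t \<in> {0..1}" and w: "w \<in> U"
  shows "f t w \<noteq> 0"
proof -
  define Z where "Z = {t \<in> {0..1}. \<exists>w\<in>U. f t w = 0}"
  have clU: "closure U = U \<union> frontier U"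
    by (metis Un_commute closure_Un_frontier sup_commute)
  have Z_eq: "Z = fst ` (({0..1} \<times> (closure U \<inter> cball 0 R)) \<inter> (\<lambda>(t, w). f t w) -` {0})"
  proof (intro equalityI subsetI)
    fix t assume "t \<in> Z"
    then obtain w where "t \<in> {0..1}" "w \<in> U" "f t w = 0"
      by (auto simp: Z_def)
    then show "t \<in> fst ` (({0..1} \<times> (closure U \<inter> cball 0 R)) \<inter> (\<lambda>(t, w). f t w) -` {0})"
      using bdd clU by (intro image_eqI[of _ _ "(t, w)"]) auto
  qed (use clU frontier in \<open>auto simp: Z_def\<close>)
  have "closed (({0..1} \<times> (closure U \<inter> cball 0 R)) \<inter> (\<lambda>(t, w). f t w) -` {0})"
    by (intro continuous_closed_preimage continuous_on_subset[OF cont] closed_Times) auto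
  moreover have "compact ({0..1::real} \<times> (closure U \<inter> cball 0 R))"
    by (intro compact_Times closed_Int_compact) auto
  ultimately have "compact (({0..1} \<times> (closure U \<inter> cball 0 R)) \<inter> (\<lambda>(t, w). f t w) -` {0})"
    by (metis closed_Int_compact inf.absorb_iff1 inf_le1)
  then have "compact Z"
    unfolding Z_eq by (intro compact_continuous_image continuous_intros)
  then have clZ: "closed Z"
    by (rule compact_imp_closed)
  have clC: "closed ({0..1} - Z)"
    unfolding closed_sequential_limits
  proof (intro allI impI)
    fix X l assume X: "(\<forall>n. X n \<in> {0..1} - Z) \<and> X \<longlonglongrightarrow> l"
    have l: "l \<in> {0..1}"
      using X closed_sequentially[of "{0..1::real}" X l] by auto
    then obtain w0 where w0: "w0 \<in> U" "f l w0 \<noteq> 0"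
      using nonzero by blast
    have "f l w \<noteq> 0" if "w \<in> U" for w
    proof (rule zero_free_limit[where T = "{0..1}" and f = f and l = l and X = X, OF U _ _ _ _ l _ w0 that])
      show "continuous_on ({0..1} \<times> U) (\<lambda>(t, w). f t w)"
        by (rule continuous_on_subset[OF cont]) auto
      show "f t holomorphic_on U" if "t \<in> {0..1}" for t
        using hol[OF that] by (rule holomorphic_on_subset) auto
    qed (use X in \<open>auto simp: Z_def\<close>)
    then show "l \<in> {0..1} - Z"
      using l by (auto simp: Z_def)
  qed
  have "Z \<inter> {0..1} = {} \<or> ({0..1} - Z) \<inter> {0..1} = {}"
    by (rule connected_closedD[OF connected_Icc]) (use clZ clC in auto)
  moreover have "0 \<in> {0..1::real} - Z"
    using start by (auto simp: Z_def)
  ultimately have "Z \<inter> {0..1} = {}"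
    by blast
  then show ?thesis
    using t w by (auto simp: Z_def)
qed

section \<open>Functions that are quadratic in each variable\<close>

definition quadratic_at :: "'v \<Rightarrow> (('v \<Rightarrow> complex) \<Rightarrow> complex) \<Rightarrow> bool" where
  "quadratic_at i F \<longleftrightarrow> (\<forall>z. \<exists>a b c. \<forall>w. F (z(i := w)) = a + b * w + c * w\<^sup>2)"

text \<open>Partial derivatives as finite differences. On functions that are quadratic in the variable they
  agree with the analytic ones, and they commute with each other for trivial reasons.\<close>

definition pd :: "'v \<Rightarrow> (('v \<Rightarrow> complex) \<Rightarrow> complex) \<Rightarrow> ('v \<Rightarrow> complex) \<Rightarrow> complex" where
  "pd i F z = (F (z(i := z i + 1)) - F (z(i := z i - 1))) / 2"

definition pd2 :: "'v \<Rightarrow> (('v \<Rightarrow> complex) \<Rightarrow> complex) \<Rightarrow> ('v \<Rightarrow> complex) \<Rightarrow> complex" where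
  "pd2 i F z = F (z(i := z i + 1)) + F (z(i := z i - 1)) - 2 * F z"

lemma pd_expansion:
  assumes "\<And>w. F (z(i := w)) = a + b * w + c * w\<^sup>2"
  shows "pd i F (z(i := w)) = b + 2 * c * w" "pd2 i F (z(i := w)) = 2 * c"
  by (simp_all add: pd_def pd2_def assms field_simps power2_eq_square)

lemma quadratic_atD:
  assumes "quadratic_at i F"
  shows "\<exists>a b c. \<forall>w. F (z(i := w)) = a + b * w + c * w\<^sup>2"
  using assms unfolding quadratic_at_def by blast

lemma quadratic_at_linear:
  assumes "quadratic_at i F" "quadratic_at i G"
  shows "quadratic_at i (\<lambda>z. k * F z + l * G z)"
  unfolding quadratic_at_def
proof
  fix z
  obtain a b c where F: "\<And>w. F (z(i := w)) = a + b * w + c * w\<^sup>2"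
    using quadratic_atD[OF assms(1), of "z"] by blast
  obtain a' b' c' where G: "\<And>w. G (z(i := w)) = a' + b' * w + c' * w\<^sup>2"
    using quadratic_atD[OF assms(2), of "z"] by blast
  have "\<forall>w. k * F (z(i := w)) + l * G (z(i := w)) =
      (k * a + l * a') + (k * b + l * b') * w + (k * c + l * c') * w\<^sup>2"
    by (simp add: F G algebra_simps)
  then show "\<exists>a b c. \<forall>w. k * F (z(i := w)) + l * G (z(i := w)) = a + b * w + c * w\<^sup>2"
    by blast
qed

lemma quadratic_at_shift:
  assumes "quadratic_at i F" "i \<noteq> j"
  shows "quadratic_at i (\<lambda>z. F (z(j := z j + s)))"
  unfolding quadratic_at_def
proof
  fix z
  obtain a b c where F: "\<And>w. F (z(j := z j + s, i := w)) = a + b * w + c * w\<^sup>2"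
    using quadratic_atD[OF assms(1), of "z(j := z j + s)"] by blast
  then show "\<exists>a b c. \<forall>w. F ((z(i := w))(j := (z(i := w)) j + s)) = a + b * w + c * w\<^sup>2"
    using assms(2) by (simp add: fun_upd_twist[of i j]) blast
qed

lemma quadratic_at_pd:
  assumes "quadratic_at i F"
  shows "quadratic_at i (pd j F)"
proof (cases "i = j")
  case True
  show ?thesis
    unfolding quadratic_at_def
  proof
    fix z
    obtain a b c where "\<And>w. F (z(i := w)) = a + b * w + c * w\<^sup>2"
      using quadratic_atD[OF assms, of "z"] by blast
    from pd_expansion(1)[OF this] have "\<forall>w. pd j F (z(i := w)) = b + (2 * c) * w + 0 * w\<^sup>2"
      using True by simp
    then show "\<exists>a b c. \<forall>w. pd j F (z(i := w)) = a + b * w + c * w\<^sup>2"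
      by blast
  qed
next
  case False
  have "pd j F = (\<lambda>z. (1/2) * F (z(j := z j + 1)) + (-1/2) * F (z(j := z j + (-1))))"
    by (auto simp: pd_def fun_eq_iff diff_divide_distrib)
  then show ?thesis
    by (simp only:) (intro quadratic_at_linear quadratic_at_shift assms False)
qed

lemma pd_pd:
  assumes "quadratic_at i F"
  shows "pd i (pd i F) = pd2 i F"
proof
  fix z
  obtain a b c where F: "\<And>w. F (z(i := w)) = a + b * w + c * w\<^sup>2"
    using quadratic_atD[OF assms, of "z"] by blast
  have "pd i F (z(i := w)) = b + (2 * c) * w + 0 * w\<^sup>2" for w
    using pd_expansion(1)[OF F] by simp
  from pd_expansion(1)[OF this, of "z i"] pd_expansion(2)[OF F, of "z i"]
  show "pd i (pd i F) z = pd2 i F z"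
    by simp
qed

lemma pd_pd2_commute: "i \<noteq> j \<Longrightarrow> pd2 i (pd j F) = pd j (pd2 i F)"
  by (rule ext) (simp add: pd_def pd2_def fun_upd_twist field_simps)

lemma complex_quadratic_factor:
  fixes a b c :: complex
  assumes "c \<noteq> 0"
  obtains r s where "\<And>w. a + b * w + c * w\<^sup>2 = c * (w - r) * (w - s)" "b = - c * (r + s)"
proof -
  define D where "D = csqrt (b\<^sup>2 - 4 * a * c)"
  define r where "r = (- b + D) / (2 * c)"
  define s where "s = (- b - D) / (2 * c)"
  have DD: "D * D = b\<^sup>2 - 4 * a * c"
    unfolding D_def by (metis power2_csqrt power2_eq_square)
  have sum: "c * (r + s) = - b"
    using assms by (simp add: r_def s_def field_simps)
  have "c * (r * s) = (b\<^sup>2 - D * D) / (4 * c)"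
    using assms by (simp add: r_def s_def field_simps power2_eq_square)
  also have "\<dots> = a"
    using assms by (simp add: DD)
  finally have prod: "c * (r * s) = a" .
  have "a + b * w + c * w\<^sup>2 = c * (w - r) * (w - s)" for w
  proof -
    have "c * (w - r) * (w - s) = c * (r * s) - c * (r + s) * w + c * w\<^sup>2"
      by (simp add: algebra_simps power2_eq_square)
    then show ?thesis
      by (simp add: sum prod)
  qed
  then show ?thesis
    using that sum by (metis minus_mult_left minus_minus)
qed

text \<open>The logarithmic derivative of a polynomial without zeros in the upper half-plane is a sum of
  terms \<open>1/(w - r)\<close> with \<open>Im r \<le> 0\<close>, each of which has negative imaginary part for \<open>Im w > 0\<close>.\<close>

lemma quadratic_Gauss_Lucas:
  fixes a b c w :: complex
  assumes nz: "\<And>w. Im w > 0 \<Longrightarrow> a + b * w + c * w\<^sup>2 \<noteq> 0"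
    and w: "Im w > 0"
  shows "Im ((b + 2 * c * w) * cnj (a + b * w + c * w\<^sup>2)) < 0 \<or> b = 0 \<and> c = 0"
proof (cases "c = 0")
  case c: True
  show ?thesis
  proof (cases "b = 0")
    case False
    have "Im (- a / b) \<le> 0"
      using nz[of "- a / b"] c False by force
    then have im: "Im (w + a / b) > 0"
      using w by simp
    have eq: "a + b * w = b * (w + a / b)"
      using False by (simp add: field_simps)
    have "Im (b * cnj (b * u)) = - (cmod b)\<^sup>2 * Im u" for u
      unfolding cmod_power2 by (simp add: algebra_simps power2_eq_square)
    from this[of "w + a / b"] have "Im (b * cnj (b * (w + a / b))) = - (cmod b)\<^sup>2 * Im (w + a / b)" .
    moreover have "(cmod b)\<^sup>2 * Im (w + a / b) > 0"
      using im False by (intro mult_pos_pos) auto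
    ultimately show ?thesis
      using c by (simp only: eq mult_zero_left mult_zero_right add_0_right) simp
  qed (use c in simp)
next
  case False
  obtain r s where fac: "\<And>w. a + b * w + c * w\<^sup>2 = c * (w - r) * (w - s)" and b: "b = - c * (r + s)"
    using complex_quadratic_factor[OF False] by metis
  have "Im r \<le> 0" "Im s \<le> 0"
    using nz[of r] nz[of s] fac by force+
  then have u: "Im (w - r) > 0" "Im (w - s) > 0"
    using w by simp_all
  define u v where "u = w - r" and "v = w - s"
  have uv: "Im u > 0" "Im v > 0"
    using u by (simp_all add: u_def v_def)
  have "b + 2 * c * w = c * (u + v)"
    by (simp add: b u_def v_def algebra_simps)
  moreover have "cnj (a + b * w + c * w\<^sup>2) = cnj c * cnj u * cnj v"
    by (simp add: fac u_def v_def)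
  ultimately have "(b + 2 * c * w) * cnj (a + b * w + c * w\<^sup>2) =
      (c * cnj c) * ((u * cnj u) * cnj v + (v * cnj v) * cnj u)"
    by (simp add: algebra_simps)
  also have "\<dots> = of_real ((cmod c)\<^sup>2) * (of_real ((cmod u)\<^sup>2) * cnj v + of_real ((cmod v)\<^sup>2) * cnj u)"
    by (simp only: complex_norm_square)
  also have "Im \<dots> = - (cmod c)\<^sup>2 * ((cmod u)\<^sup>2 * Im v + (cmod v)\<^sup>2 * Im u)"
    by (simp only: Im_complex_of_real Re_complex_of_real times_complex.sel plus_complex.sel
        complex_cnj) (simp add: algebra_simps)
  also have "\<dots> < 0"
  proof -
    have "u \<noteq> 0" "v \<noteq> 0"
      using uv by auto
    then have "(cmod u)\<^sup>2 * Im v + (cmod v)\<^sup>2 * Im u > 0"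
      using uv by (intro add_pos_pos mult_pos_pos) auto
    then show ?thesis
      using False by (simp add: mult_neg_pos)
  qed
  finally show ?thesis by blast
qed

definition stable_quadratic :: "'v set \<Rightarrow> (('v \<Rightarrow> complex) \<Rightarrow> complex) \<Rightarrow> bool" where
  "stable_quadratic V F \<longleftrightarrow> continuous_on UNIV F \<and> (\<forall>i\<in>V. quadratic_at i F) \<and>
     (\<forall>z. F (\<lambda>i. cnj (z i)) = cnj (F z)) \<and> (\<forall>z. (\<forall>i\<in>V. Im (z i) > 0) \<longrightarrow> F z \<noteq> 0)"

lemma continuous_on_shift: "continuous_on UNIV (\<lambda>z::'v \<Rightarrow> complex. z(j := z j + s))"
proof (rule continuous_on_coordinatewise_then_product)
  fix i
  have "continuous_on UNIV (\<lambda>z::'v \<Rightarrow> complex. z i)" for i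
    by (rule continuous_on_product_coordinates)
  then show "continuous_on UNIV (\<lambda>z::'v \<Rightarrow> complex. (z(j := z j + s)) i)"
    by (cases "i = j") (auto intro!: continuous_intros)
qed

lemma continuous_on_pd:
  assumes "continuous_on UNIV F"
  shows "continuous_on UNIV (pd j F)"
proof -
  have *: "continuous_on UNIV (\<lambda>z. F (z(j := z j + s)))" for s
    by (rule continuous_on_compose2[OF assms continuous_on_shift]) auto
  show ?thesis
    unfolding pd_def[abs_def] using *[of 1] *[of "-1"] by (auto intro!: continuous_intros)
qed

lemma pd_cnj:
  assumes "\<And>z. F (\<lambda>i. cnj (z i)) = cnj (F z)"
  shows "pd j F (\<lambda>i. cnj (z i)) = cnj (pd j F z)"
proof -
  have "(\<lambda>i. cnj (z i))(j := cnj (z j) + 1) = (\<lambda>i. cnj ((z(j := z j + 1)) i))"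
       "(\<lambda>i. cnj (z i))(j := cnj (z j) - 1) = (\<lambda>i. cnj ((z(j := z j - 1)) i))"
    by auto
  then show ?thesis
    by (simp only: pd_def assms complex_cnj_divide complex_cnj_diff complex_cnj_numeral)
qed

text \<open>A zero of \<open>F + k \<partial>\<^sub>i F\<close> would make \<open>\<partial>\<^sub>i F / F\<close> real and nonzero, against the Gauss--Lucas property.\<close>

lemma stable_quadratic_add_pd:
  assumes F: "stable_quadratic V F" and i: "i \<in> V" and k: "k \<in> \<real>"
  shows "stable_quadratic V (\<lambda>z. F z + k * pd i F z)"
proof -
  have cont: "continuous_on UNIV F" and quad: "\<And>j. j \<in> V \<Longrightarrow> quadratic_at j F"
    and sym: "\<And>z. F (\<lambda>i. cnj (z i)) = cnj (F z)"
    and stab: "\<And>z. (\<forall>i\<in>V. Im (z i) > 0) \<Longrightarrow> F z \<noteq> 0"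
    using F by (auto simp: stable_quadratic_def)
  have "continuous_on UNIV (\<lambda>z. F z + k * pd i F z)"
    by (intro continuous_intros cont continuous_on_pd)
  moreover have "quadratic_at j (\<lambda>z. F z + k * pd i F z)" if "j \<in> V" for j
    using quadratic_at_linear[OF quad[OF that] quadratic_at_pd[OF quad[OF that]], of 1 k i] by simp
  moreover have "F (\<lambda>i. cnj (z i)) + k * pd i F (\<lambda>i. cnj (z i)) = cnj (F z + k * pd i F z)" for z
    using k by (simp add: sym pd_cnj[of F, OF sym] Reals_cnj_iff)
  moreover have "F z + k * pd i F z \<noteq> 0" if z: "\<forall>j\<in>V. Im (z j) > 0" for z
  proof
    assume eq: "F z + k * pd i F z = 0"
    obtain a b c where abc: "\<And>w. F (z(i := w)) = a + b * w + c * w\<^sup>2"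
      using quadratic_atD[OF quad[OF i], of "z"] by blast
    have Fz: "F z = a + b * z i + c * (z i)\<^sup>2"
      using abc[of "z i"] by simp
    have Dz: "pd i F z = b + 2 * c * z i"
      using pd_expansion(1)[OF abc, of "z i"] by simp
    have nz: "a + b * w + c * w\<^sup>2 \<noteq> 0" if "Im w > 0" for w
      using stab[of "z(i := w)"] z that by (auto simp: abc)
    from quadratic_Gauss_Lucas[of a b c "z i", OF nz] z i
    consider "Im (pd i F z * cnj (F z)) < 0" | "pd i F z = 0"
      by (auto simp: Fz Dz)
    then show False
    proof cases
      case 1
      have "F z = - k * pd i F z"
        using eq by (simp add: add_eq_0_iff2)
      then have "pd i F z * cnj (F z) = - k * (pd i F z * cnj (pd i F z))"
        using k by (simp add: Reals_cnj_iff)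
      also have "\<dots> = - k * of_real ((cmod (pd i F z))\<^sup>2)"
        by (simp only: complex_norm_square)
      also have "Im \<dots> = 0"
        using k by (auto elim!: Reals_cases)
      finally show False
        using 1 by simp
    next
      case 2
      then show False
        using eq stab[OF z] by simp
    qed
  qed
  ultimately show ?thesis
    unfolding stable_quadratic_def by blast
qed

lemma stable_quadratic_minus_pd2:
  assumes F: "stable_quadratic V F" and i: "i \<in> V"
  shows "stable_quadratic V (\<lambda>z. F z - pd2 i F z)"
proof -
  let ?G = "\<lambda>z. F z + 1 * pd i F z"
  have quad: "quadratic_at i F"
    using F i by (auto simp: stable_quadratic_def)
  have "stable_quadratic V (\<lambda>z. ?G z + (- 1) * pd i ?G z)"
    by (intro stable_quadratic_add_pd assms) auto
  moreover have "pd i ?G z = pd i F z + pd2 i F z" for z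
    unfolding pd_pd[OF quad, symmetric] by (simp add: pd_def field_simps)
  ultimately show ?thesis
    by simp
qed

text \<open>The Gauss--Lucas inequality survives the passage to the closed upper half-plane, in the form
  cleared of denominators. Stability enters the barrier argument through this inequality.\<close>

lemma stable_quadratic_Im_pd_le:
  assumes F: "stable_quadratic V F" and i: "i \<in> V" and z: "\<And>j. j \<in> V \<Longrightarrow> Im (z j) \<ge> 0"
  shows "Im (pd i F z * cnj (F z)) \<le> 0"
proof -
  have cont: "continuous_on UNIV F" and quad: "quadratic_at i F"
    and stab: "\<And>z. (\<forall>i\<in>V. Im (z i) > 0) \<Longrightarrow> F z \<noteq> 0"
    using F i by (auto simp: stable_quadratic_def)
  define p where "p \<eta> = (\<lambda>j. z j + \<i> * of_real \<eta>)" for \<eta> :: real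
  have pcont: "continuous_on UNIV p"
    unfolding p_def by (intro continuous_on_coordinatewise_then_product continuous_intros)
  have gcont: "continuous_on UNIV (\<lambda>\<eta>. Im (pd i F (p \<eta>) * cnj (F (p \<eta>))))"
    by (intro continuous_intros continuous_on_compose2[OF cont pcont]
        continuous_on_compose2[OF continuous_on_pd[OF cont] pcont]) auto
  have neg: "Im (pd i F (p \<eta>) * cnj (F (p \<eta>))) \<le> 0" if "\<eta> > 0" for \<eta>
  proof -
    have pos: "\<forall>j\<in>V. Im (p \<eta> j) > 0"
      using z that by (auto simp: p_def add_nonneg_pos)
    obtain a b c where abc: "\<And>w. F ((p \<eta>)(i := w)) = a + b * w + c * w\<^sup>2"
      using quadratic_atD[OF quad, of "p \<eta>"] by blast
    have Fz: "F (p \<eta>) = a + b * p \<eta> i + c * (p \<eta> i)\<^sup>2"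
      using abc[of "p \<eta> i"] by simp
    have Dz: "pd i F (p \<eta>) = b + 2 * c * p \<eta> i"
      using pd_expansion(1)[OF abc, of "p \<eta> i"] by simp
    have nz: "a + b * w + c * w\<^sup>2 \<noteq> 0" if "Im w > 0" for w
      using stab[of "(p \<eta>)(i := w)"] pos that by (auto simp: abc)
    from quadratic_Gauss_Lucas[of a b c "p \<eta> i", OF nz] pos i show ?thesis
      by (auto simp: Fz Dz)
  qed
  define g where "g \<eta> = Im (pd i F (p \<eta>) * cnj (F (p \<eta>)))" for \<eta>
  have "isCont g 0"
    using gcont unfolding g_def[abs_def] by (simp add: continuous_on_eq_continuous_at)
  then have "(g \<longlongrightarrow> g 0) (at_right 0)"
    by (simp add: isCont_def filterlim_at_split)
  moreover have "\<forall>\<^sub>F \<eta> in at_right 0. g \<eta> \<le> 0"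
    using neg by (auto simp: eventually_at_right_field g_def intro!: exI[of _ 1])
  ultimately have "g 0 \<le> 0"
    by (rule tendsto_upperbound) simp
  then show ?thesis
    by (simp add: p_def g_def)
qed

section \<open>The barrier argument\<close>

abbreviation cvec :: "('v \<Rightarrow> real) \<Rightarrow> 'v \<Rightarrow> complex" where
  "cvec r \<equiv> \<lambda>i. complex_of_real (r i)"

lemma cvec_upd: "cvec (r(i := x)) = (cvec r)(i := complex_of_real x)"
  by auto

lemma real_quadratic_expansion:
  assumes sym: "\<And>z. F (\<lambda>i. cnj (z i)) = cnj (F z)" and quad: "quadratic_at i F"
  shows "\<exists>a b c. \<forall>w. F ((cvec r)(i := w)) =
           complex_of_real a + complex_of_real b * w + complex_of_real c * w\<^sup>2"
proof -
  obtain a b c where abc: "\<And>w. F ((cvec r)(i := w)) = a + b * w + c * w\<^sup>2"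
    using quadratic_atD[OF quad, of "cvec r"] by blast
  have real: "F ((cvec r)(i := complex_of_real x)) \<in> \<real>" for x
  proof -
    have "(\<lambda>j. cnj (((cvec r)(i := complex_of_real x)) j)) = (cvec r)(i := complex_of_real x)"
      by auto
    then show ?thesis
      using sym[of "(cvec r)(i := complex_of_real x)"] by (simp add: Reals_cnj_iff)
  qed
  have 0: "a \<in> \<real>" and 1: "a + b + c \<in> \<real>" and 2: "a - b + c \<in> \<real>"
    using real[of 0] real[of 1] real[of "-1"] by (simp_all add: abc)
  have "((a + b + c) - (a - b + c)) / 2 \<in> \<real>" "((a + b + c) + (a - b + c)) / 2 - a \<in> \<real>"
    by (rule Reals_divide[OF Reals_diff[OF 1 2] Reals_numeral])
       (rule Reals_diff[OF Reals_divide[OF Reals_add[OF 1 2] Reals_numeral] 0])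
  moreover have "((a + b + c) - (a - b + c)) / 2 = b" "((a + b + c) + (a - b + c)) / 2 - a = c"
    by (simp_all add: field_simps)
  ultimately have "b \<in> \<real>" "c \<in> \<real>"
    by simp_all
  with 0 obtain a' b' c' where "a = complex_of_real a'" "b = complex_of_real b'" "c = complex_of_real c'"
    by (auto elim!: Reals_cases)
  then show ?thesis
    using abc by blast
qed

lemma real_at_cvec:
  assumes "\<And>z. F (\<lambda>i. cnj (z i)) = cnj (F z)"
  shows "complex_of_real (Re (F (cvec r))) = F (cvec r)"
proof -
  have "F (cvec r) = cnj (F (cvec r))"
    using assms[of "cvec r"] by simp
  then have "F (cvec r) \<in> \<real>"
    by (simp add: Reals_cnj_iff)
  then show ?thesis
    by simp
qed

text \<open>Disposes of second-order error terms in the limit \<open>\<epsilon> \<rightarrow> 0\<close>.\<close>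

lemma le_0_if_le_square_mult:
  fixes X K :: real
  assumes "\<And>\<epsilon>. \<epsilon> > 0 \<Longrightarrow> X \<le> \<epsilon>\<^sup>2 * K"
  shows "X \<le> 0"
proof (rule ccontr)
  assume X: "\<not> X \<le> 0"
  then have K: "K > 0"
    using assms[of 1] by simp
  have "X \<le> (sqrt (X / (2 * K)))\<^sup>2 * K"
    using X K by (intro assms) auto
  also have "\<dots> = X / 2"
    using X K by (simp add: field_simps)
  finally show False
    using X by simp
qed

text \<open>At real points with \<open>F \<noteq> 0\<close> the quotient \<open>\<partial>\<^sub>j F / F\<close> is nonincreasing in the variable \<open>z\<^sub>i\<close>, here written without
  denominators: the Gauss--Lucas inequality at \<open>x + \<i>\<epsilon>\<close> is this statement times \<open>\<epsilon>\<close> up to terms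
  of order \<open>\<epsilon>\<^sup>3\<close>. The case \<open>i = j\<close> expresses real-rootedness.\<close>

lemma stable_quadratic_Rayleigh:
  fixes a b c a' b' c' x :: real
  assumes F: "stable_quadratic V F" and i: "i \<in> V" and j: "j \<in> V"
    and A: "\<And>w. F ((cvec r)(i := w)) = of_real a + of_real b * w + of_real c * w\<^sup>2"
    and B: "\<And>w. pd j F ((cvec r)(i := w)) = of_real a' + of_real b' * w + of_real c' * w\<^sup>2"
  shows "(b' + 2 * c' * x) * (a + b * x + c * x\<^sup>2) \<le> (a' + b' * x + c' * x\<^sup>2) * (b + 2 * c * x)"
proof -
  have "(b' + 2 * c' * x) * (a + b * x + c * x\<^sup>2) - (a' + b' * x + c' * x\<^sup>2) * (b + 2 * c * x)
      \<le> \<epsilon>\<^sup>2 * ((b' + 2 * c' * x) * c - c' * (b + 2 * c * x))" (is "?X \<le> \<epsilon>\<^sup>2 * ?K") if \<epsilon>: "\<epsilon> > 0" for \<epsilon>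
  proof -
    let ?w = "Complex x \<epsilon>"
    have "Im (pd j F ((cvec r)(i := ?w)) * cnj (F ((cvec r)(i := ?w)))) \<le> 0"
      by (rule stable_quadratic_Im_pd_le[OF F j]) (use \<epsilon> in auto)
    also have "Im (pd j F ((cvec r)(i := ?w)) * cnj (F ((cvec r)(i := ?w)))) = \<epsilon> * (?X - \<epsilon>\<^sup>2 * ?K)"
      unfolding A B by (simp add: power2_eq_square) (simp add: algebra_simps)
    finally show ?thesis
      using \<epsilon> by (simp add: mult_le_0_iff)
  qed
  from le_0_if_le_square_mult[OF this] show ?thesis
    by simp
qed

lemma quadratic_ratio_antimono:
  fixes a b c a' b' c' :: real
  assumes wronskian: "\<And>x. (b' + 2 * c' * x) * (a + b * x + c * x\<^sup>2) \<le> (a' + b' * x + c' * x\<^sup>2) * (b + 2 * c * x)"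
    and pos: "\<And>x. x1 \<le> x \<Longrightarrow> x \<le> x2 \<Longrightarrow> a + b * x + c * x\<^sup>2 > 0"
    and le: "x1 \<le> x2"
  shows "(a' + b' * x2 + c' * x2\<^sup>2) / (a + b * x2 + c * x2\<^sup>2) \<le> (a' + b' * x1 + c' * x1\<^sup>2) / (a + b * x1 + c * x1\<^sup>2)"
proof (rule DERIV_nonpos_imp_nonincreasing[OF le])
  fix x assume x: "x1 \<le> x" "x \<le> x2"
  let ?A = "a + b * x + c * x\<^sup>2"
  have "((\<lambda>x. (a' + b' * x + c' * x\<^sup>2) / (a + b * x + c * x\<^sup>2)) has_real_derivative
     ((b' + 2 * c' * x) * ?A - (a' + b' * x + c' * x\<^sup>2) * (b + 2 * c * x)) / (?A * ?A)) (at x)"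
    using pos[OF x] by (auto intro!: derivative_eq_intros simp: algebra_simps)
  moreover have "((b' + 2 * c' * x) * ?A - (a' + b' * x + c' * x\<^sup>2) * (b + 2 * c * x)) / (?A * ?A) \<le> 0"
    using wronskian[of x] by (intro divide_nonpos_nonneg) auto
  ultimately show "\<exists>y. ((\<lambda>x. (a' + b' * x + c' * x\<^sup>2) / (a + b * x + c * x\<^sup>2)) has_real_derivative y) (at x) \<and> y \<le> 0"
    by blast
qed

lemma quadratic_lead_coeff_nonneg:
  fixes a b c :: real
  assumes "\<And>x. x \<ge> x0 \<Longrightarrow> a + b * x + c * x\<^sup>2 > 0"
  shows "c \<ge> 0"
proof (rule ccontr)
  assume c: "\<not> c \<ge> 0"
  \<comment> \<open>at this point the quadratic term outweighs the other two\<close>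
  define x where "x = max (max 1 x0) ((\<bar>a\<bar> + \<bar>b\<bar>) / (- c))"
  have x: "x \<ge> 1" "x \<ge> x0" "x \<ge> (\<bar>a\<bar> + \<bar>b\<bar>) / (- c)"
    by (auto simp: x_def)
  have "\<bar>a\<bar> + \<bar>b\<bar> \<le> - c * x"
    using x(3) c by (simp add: field_simps)
  then have "(\<bar>a\<bar> + \<bar>b\<bar>) * x \<le> - c * x * x"
    using x(1) by (intro mult_right_mono) auto
  moreover have "a \<le> \<bar>a\<bar> * x"
    using x(1) by (smt (verit) mult_le_cancel_left1 abs_ge_self abs_ge_zero)
  moreover have "b * x \<le> \<bar>b\<bar> * x"
    using x(1) by (intro mult_right_mono) auto
  ultimately have "a + b * x + c * x\<^sup>2 \<le> 0"
    by (simp add: algebra_simps power2_eq_square)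
  then show False
    using assms[OF x(2)] by simp
qed

text \<open>The one-variable core of the barrier argument. Here \<open>p = \<gamma> + \<beta> x + \<alpha> x\<^sup>2\<close> has the barrier bound
  \<open>p'/p \<le> 1/w\<close> to the right of \<open>x\<^sub>0\<close>, so its largest root \<open>s\<close> satisfies \<open>x\<^sub>0 - s \<ge> w\<close>. If
  \<open>f = c + b x + a x\<^sup>2\<close> with \<open>a > 0\<close> is nonpositive at \<open>s\<close> and nonnegative at \<open>x\<^sub>0\<close>, its slope between \<open>s\<close> and
  \<open>x\<^sub>0\<close> is nonnegative, and convexity yields \<open>f(x\<^sub>0 + \<delta>) \<ge> a \<delta> (w + \<delta>) \<ge> 2 a = f''\<close>. It is
  applied to \<open>f = p\<close> and to the restriction of \<open>p - w \<partial>\<^sub>j p\<close>; for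
  \<open>a \<le> 0\<close> there is nothing to do.\<close>

lemma quadratic_barrier:
  fixes \<alpha> \<beta> \<gamma> a b c w \<delta> :: real
  assumes p_pos: "\<And>x. x \<ge> x0 \<Longrightarrow> \<gamma> + \<beta> * x + \<alpha> * x\<^sup>2 > 0"
    and p_bar: "\<And>x. x \<ge> x0 \<Longrightarrow> w * (\<beta> + 2 * \<alpha> * x) \<le> \<gamma> + \<beta> * x + \<alpha> * x\<^sup>2"
    and f_nonneg: "\<And>x. x \<ge> x0 \<Longrightarrow> c + b * x + a * x\<^sup>2 \<ge> 0"
    and w: "w > 0" and \<delta>: "\<delta> > 0" "\<delta> * w \<ge> 2"
    and disc: "\<alpha> > 0 \<Longrightarrow> \<beta>\<^sup>2 \<ge> 4 * \<alpha> * \<gamma>"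
    and degenerate: "\<alpha> = 0 \<Longrightarrow> a \<le> 0"
    and at_root: "\<And>s. \<alpha> > 0 \<Longrightarrow> \<gamma> + \<beta> * s + \<alpha> * s\<^sup>2 = 0 \<Longrightarrow> s < x0 \<Longrightarrow>
       (\<And>x. x > s \<Longrightarrow> \<gamma> + \<beta> * x + \<alpha> * x\<^sup>2 > 0) \<Longrightarrow> c + b * s + a * s\<^sup>2 \<le> 0"
  shows "2 * a \<le> c + b * (x0 + \<delta>) + a * (x0 + \<delta>)\<^sup>2"
    and "c + b * (x0 + \<delta>) + a * (x0 + \<delta>)\<^sup>2 > 0 \<Longrightarrow> 2 * a < c + b * (x0 + \<delta>) + a * (x0 + \<delta>)\<^sup>2"
proof -
  have "2 * a < c + b * (x0 + \<delta>) + a * (x0 + \<delta>)\<^sup>2" if a: "a > 0"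
  proof -
    have \<alpha>: "\<alpha> > 0"
      using quadratic_lead_coeff_nonneg[OF p_pos] degenerate a by fastforce
    define D where "D = sqrt (\<beta>\<^sup>2 - 4 * \<alpha> * \<gamma>)"
    have D: "D \<ge> 0" "D * D = \<beta>\<^sup>2 - 4 * \<alpha> * \<gamma>"
      using disc[OF \<alpha>] by (simp_all add: D_def)
    define s1 where "s1 = (- \<beta> - D) / (2 * \<alpha>)"
    define s2 where "s2 = (- \<beta> + D) / (2 * \<alpha>)"
    have s12: "s1 \<le> s2"
      using \<alpha> D(1) by (simp add: s1_def s2_def divide_right_mono)
    have sum: "\<alpha> * (s1 + s2) = - \<beta>"
      using \<alpha> by (simp add: s1_def s2_def field_simps)
    have "\<alpha> * (s1 * s2) = (\<beta>\<^sup>2 - D * D) / (4 * \<alpha>)"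
      using \<alpha> by (simp add: s1_def s2_def field_simps power2_eq_square)
    also have "\<dots> = \<gamma>"
      using \<alpha> by (simp add: D(2))
    finally have prod: "\<alpha> * (s1 * s2) = \<gamma>" .
    have fac: "\<gamma> + \<beta> * x + \<alpha> * x\<^sup>2 = \<alpha> * ((x - s1) * (x - s2))" for x
    proof -
      have "\<alpha> * ((x - s1) * (x - s2)) = \<alpha> * (s1 * s2) - \<alpha> * (s1 + s2) * x + \<alpha> * x\<^sup>2"
        by (simp add: algebra_simps power2_eq_square)
      then show ?thesis
        by (simp add: sum prod)
    qed
    have s2: "s2 < x0"
      using p_pos[of s2] fac[of s2] by force
    define A where "A = x0 - s1"
    define B where "B = x0 - s2"
    have AB: "A > 0" "B > 0"
      using s12 s2 by (simp_all add: A_def B_def)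
    have "w * (\<alpha> * (A + B)) \<le> \<alpha> * (A * B)"
    proof -
      have "\<alpha> * (A + B) = \<beta> + 2 * \<alpha> * x0"
        using sum by (simp add: A_def B_def algebra_simps)
      then show ?thesis
        using p_bar[of x0] fac[of x0] by (simp add: A_def B_def)
    qed
    then have "w * (A + B) \<le> A * B"
      using \<alpha> by (simp add: mult.left_commute[of w])
    then have "w * A \<le> B * A"
      using mult_pos_pos[OF w AB(2)] by (simp add: algebra_simps)
    then have wB: "w \<le> B"
      using AB by simp
    have fs: "c + b * s2 + a * s2\<^sup>2 \<le> 0"
    proof (rule at_root[OF \<alpha> _ s2])
      show "\<gamma> + \<beta> * s2 + \<alpha> * s2\<^sup>2 = 0"
        by (simp add: fac)
      show "\<gamma> + \<beta> * x + \<alpha> * x\<^sup>2 > 0" if "x > s2" for x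
        using that s12 \<alpha> by (simp add: fac)
    qed
    define f0 where "f0 = c + b * x0 + a * x0\<^sup>2"
    have f0: "f0 \<ge> 0"
      using f_nonneg[of x0] by (simp add: f0_def)
    have "c + b * s2 + a * s2\<^sup>2 = f0 - B * (b + a * (x0 + s2))"
      by (simp add: f0_def B_def algebra_simps power2_eq_square)
    with fs f0 have "B * (b + a * (x0 + s2)) \<ge> 0"
      by linarith
    then have slope: "b + a * (x0 + s2) \<ge> 0"
      using AB by (simp add: zero_le_mult_iff)
    have "c + b * (x0 + \<delta>) + a * (x0 + \<delta>)\<^sup>2 = f0 + \<delta> * (b + a * (x0 + s2)) + a * (\<delta> * B + \<delta> * \<delta>)"
      by (simp add: f0_def B_def algebra_simps power2_eq_square)
    moreover have "\<delta> * (b + a * (x0 + s2)) \<ge> 0"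
      using slope \<delta> by simp
    moreover have "a * (\<delta> * B + \<delta> * \<delta>) > a * 2"
    proof (rule mult_strict_left_mono[OF _ a])
      have "2 \<le> \<delta> * B"
        using \<delta> wB by (smt (verit) mult_left_mono)
      then show "2 < \<delta> * B + \<delta> * \<delta>"
        using \<delta> using mult_pos_pos[of \<delta> \<delta>] by linarith
    qed
    ultimately show ?thesis
      using f0 by linarith
  qed
  moreover have "c + b * (x0 + \<delta>) + a * (x0 + \<delta>)\<^sup>2 \<ge> 0"
    using f_nonneg[of "x0 + \<delta>"] \<delta> by simp
  ultimately show "2 * a \<le> c + b * (x0 + \<delta>) + a * (x0 + \<delta>)\<^sup>2"
    and "c + b * (x0 + \<delta>) + a * (x0 + \<delta>)\<^sup>2 > 0 \<Longrightarrow> 2 * a < c + b * (x0 + \<delta>) + a * (x0 + \<delta>)\<^sup>2"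
    by (cases "a > 0"; linarith)+
qed

definition above :: "'v set \<Rightarrow> ('v \<Rightarrow> real) \<Rightarrow> ('v \<Rightarrow> real) set" where
  "above V z = {r. (\<forall>i\<in>V. z i \<le> r i) \<and> (\<forall>i. i \<notin> V \<longrightarrow> r i = z i)}"

lemma above_upd: "r \<in> above V z \<Longrightarrow> i \<in> V \<Longrightarrow> z i \<le> x \<Longrightarrow> r(i := x) \<in> above V z"
  by (auto simp: above_def)

text \<open>The point \<open>z\<close> lies above the zeros of \<open>F\<close>, and the logarithmic derivatives in the directions
  \<open>J\<close> are bounded by \<open>1/w\<close> on the whole orthant above it. The bound is required on the orthant
  rather than at \<open>z\<close> alone, so that it can be read as nonnegativity of \<open>F - w \<partial>\<^sub>j F\<close> there.\<close>

definition barrier :: "'v set \<Rightarrow> 'v set \<Rightarrow> real \<Rightarrow> (('v \<Rightarrow> complex) \<Rightarrow> complex) \<Rightarrow> ('v \<Rightarrow> real) \<Rightarrow> bool" where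
  "barrier V J w F z \<longleftrightarrow> (\<forall>r\<in>above V z. Re (F (cvec r)) > 0 \<and>
      (\<forall>j\<in>J. w * Re (pd j F (cvec r)) \<le> Re (F (cvec r))))"

text \<open>Fix all coordinates except the \<open>i\<close>-th and apply \<open>quadratic_barrier\<close> to \<open>f = F\<close> and to
  \<open>f = F - w \<partial>\<^sub>j F\<close>. For the latter, \<open>f\<close> equals \<open>- w \<partial>\<^sub>j F\<close> at the largest root \<open>s\<close> of \<open>F\<close>. As
  \<open>\<partial>\<^sub>j F / F\<close> is nonincreasing on \<open>(s, x\<^sub>0]\<close>, it is bounded below there, which forces
  \<open>\<partial>\<^sub>j F \<ge> 0\<close> at \<open>s\<close>.\<close>

lemma barrier_step:
  assumes F: "stable_quadratic V F" and bar: "barrier V J w F z" and J: "J \<subseteq> V" and i: "i \<in> J"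
    and w: "w > 0" and \<delta>: "\<delta> > 0" "\<delta> * w \<ge> 2"
  shows "barrier V (J - {i}) w (\<lambda>z. F z - pd2 i F z) (z(i := z i + \<delta>))"
  unfolding barrier_def
proof (intro ballI)
  have iV: "i \<in> V"
    using i J by auto
  have quad: "\<And>j. j \<in> V \<Longrightarrow> quadratic_at j F"
    and sym: "\<And>z. F (\<lambda>i. cnj (z i)) = cnj (F z)"
    using F by (auto simp: stable_quadratic_def)
  fix r assume r: "r \<in> above V (z(i := z i + \<delta>))"
  define x0 where "x0 = r i - \<delta>"
  have x0: "x0 \<ge> z i"
    using r iV by (auto simp: above_def x0_def)
  have up: "r(i := x) \<in> above V z" if "x \<ge> x0" for x
    using r that x0 iV by (auto simp: above_def split: if_splits)
  obtain \<gamma> \<beta> \<alpha> where A: "\<And>y. F ((cvec r)(i := y)) = of_real \<gamma> + of_real \<beta> * y + of_real \<alpha> * y\<^sup>2"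
    using real_quadratic_expansion[OF sym quad[OF iV], of r] by blast
  have A_re: "Re (F (cvec (r(i := x)))) = \<gamma> + \<beta> * x + \<alpha> * x\<^sup>2" for x
    unfolding cvec_upd A by (simp flip: of_real_power of_real_mult of_real_add)
  have DA: "pd i F ((cvec r)(i := y)) = of_real \<beta> + of_real (2 * \<alpha>) * y + of_real 0 * y\<^sup>2" for y
    using pd_expansion(1)[OF A, of y] by simp
  have DA_re: "Re (pd i F (cvec (r(i := x)))) = \<beta> + 2 * \<alpha> * x" for x
    unfolding cvec_upd DA by (simp flip: of_real_power of_real_mult of_real_add)
  have p_pos: "\<gamma> + \<beta> * x + \<alpha> * x\<^sup>2 > 0" if "x \<ge> x0" for x
    using bar up[OF that] A_re[of x] by (metis barrier_def)
  have p_bar: "w * (\<beta> + 2 * \<alpha> * x) \<le> \<gamma> + \<beta> * x + \<alpha> * x\<^sup>2" if "x \<ge> x0" for x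
    using bar up[OF that] A_re[of x] DA_re[of x] i by (metis barrier_def)
  \<comment> \<open>the Rayleigh inequality for \<open>j = i\<close> at the vertex of the parabola\<close>
  have disc: "\<beta>\<^sup>2 \<ge> 4 * \<alpha> * \<gamma>" if "\<alpha> > 0"
  proof -
    have "(2 * \<alpha> + 2 * 0 * (- \<beta> / (2 * \<alpha>))) * (\<gamma> + \<beta> * (- \<beta> / (2 * \<alpha>)) + \<alpha> * (- \<beta> / (2 * \<alpha>))\<^sup>2) \<le>
       (\<beta> + 2 * \<alpha> * (- \<beta> / (2 * \<alpha>)) + 0 * (- \<beta> / (2 * \<alpha>))\<^sup>2) * (\<beta> + 2 * \<alpha> * (- \<beta> / (2 * \<alpha>)))"
      by (rule stable_quadratic_Rayleigh[OF F iV iV A DA])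
    then show ?thesis
      using that by (simp add: field_simps power2_eq_square)
  qed
  have ri: "x0 + \<delta> = r i"
    by (simp add: x0_def)
  have r_self: "r(i := r i) = r" "(cvec r)(i := complex_of_real (r i)) = cvec r"
    by auto
  have lead: "pd2 i F (cvec r) = of_real (2 * \<alpha>)"
    using pd_expansion(2)[OF A, of "of_real (r i)"] by (simp add: r_self)
  have val: "Re (F (cvec r)) = \<gamma> + \<beta> * (x0 + \<delta>) + \<alpha> * (x0 + \<delta>)\<^sup>2"
    using A_re[of "r i"] ri by (simp add: r_self)
  have "2 * \<alpha> < \<gamma> + \<beta> * (x0 + \<delta>) + \<alpha> * (x0 + \<delta>)\<^sup>2"
    by (rule quadratic_barrier(2)[where ?x0.0 = x0 and \<alpha> = \<alpha> and \<beta> = \<beta> and \<gamma> = \<gamma> and w = w and \<delta> = \<delta>])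
       (use p_pos p_bar w \<delta> disc in \<open>auto intro: less_imp_le\<close>)
  then have pos: "Re (F (cvec r) - pd2 i F (cvec r)) > 0"
    by (simp add: val lead)
  have "w * Re (pd j (\<lambda>z. F z - pd2 i F z) (cvec r)) \<le> Re (F (cvec r) - pd2 i F (cvec r))"
    if j: "j \<in> J - {i}" for j
  proof -
    have jV: "j \<in> V" and ji: "j \<noteq> i"
      using j J by auto
    obtain \<gamma>' \<beta>' \<alpha>' where B: "\<And>y. pd j F ((cvec r)(i := y)) = of_real \<gamma>' + of_real \<beta>' * y + of_real \<alpha>' * y\<^sup>2"
      using real_quadratic_expansion[OF pd_cnj[of F, OF sym] quadratic_at_pd[OF quad[OF iV]], where r = r] by blast
    have B_re: "Re (pd j F (cvec (r(i := x)))) = \<gamma>' + \<beta>' * x + \<alpha>' * x\<^sup>2" for x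
      unfolding cvec_upd B by (simp flip: of_real_power of_real_mult of_real_add)
    have leadB: "pd2 i (pd j F) (cvec r) = of_real (2 * \<alpha>')"
      using pd_expansion(2)[OF B, of "of_real (r i)"] by (simp add: r_self)
    have Rayleigh: "(\<beta>' + 2 * \<alpha>' * x) * (\<gamma> + \<beta> * x + \<alpha> * x\<^sup>2) \<le> (\<gamma>' + \<beta>' * x + \<alpha>' * x\<^sup>2) * (\<beta> + 2 * \<alpha> * x)" for x
      by (rule stable_quadratic_Rayleigh[OF F iV jV A B])
    have "2 * (\<alpha> - w * \<alpha>') \<le> (\<gamma> - w * \<gamma>') + (\<beta> - w * \<beta>') * (x0 + \<delta>) + (\<alpha> - w * \<alpha>') * (x0 + \<delta>)\<^sup>2"
    proof (rule quadratic_barrier(1)[where ?x0.0 = x0 and \<alpha> = \<alpha> and \<beta> = \<beta> and \<gamma> = \<gamma> and w = w and \<delta> = \<delta>])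
      fix x assume x: "x0 \<le> x"
      have "w * (\<gamma>' + \<beta>' * x + \<alpha>' * x\<^sup>2) \<le> \<gamma> + \<beta> * x + \<alpha> * x\<^sup>2"
        using bar up[OF x] A_re[of x] B_re[of x] j by (metis Diff_iff barrier_def)
      then show "0 \<le> (\<gamma> - w * \<gamma>') + (\<beta> - w * \<beta>') * x + (\<alpha> - w * \<alpha>') * x\<^sup>2"
        by (simp add: algebra_simps)
    next
      assume \<alpha>0: "\<alpha> = 0"
      \<comment> \<open>the coefficient of \<open>z\<^sub>i\<^sup>2\<close> is nonnegative above \<open>z\<close>, so it cannot decrease in \<open>z\<^sub>j\<close> where it vanishes\<close>
      have "\<alpha>' \<ge> 0"
      proof -
        have lead_nonneg: "Re (pd2 i F (cvec (r(j := y)))) \<ge> 0" if y: "y \<ge> r j" for y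
        proof -
          obtain a b c where abc: "\<And>u. F ((cvec (r(j := y)))(i := u)) = of_real a + of_real b * u + of_real c * u\<^sup>2"
            using real_quadratic_expansion[OF sym quad[OF iV], of "r(j := y)"] by blast
          have "a + b * x + c * x\<^sup>2 > 0" if "x \<ge> x0" for x
          proof -
            have "(r(j := y))(i := x) \<in> above V z"
              using up[OF that] y jV ji by (auto simp: above_def)
            then have "Re (F (cvec ((r(j := y))(i := x)))) > 0"
              using bar by (auto simp: barrier_def)
            then show ?thesis
              unfolding cvec_upd[of _ i] abc by (simp flip: of_real_power of_real_mult of_real_add)
          qed
          then have "c \<ge> 0"
            by (rule quadratic_lead_coeff_nonneg)
          moreover have "(cvec (r(j := y)))(i := complex_of_real (r i)) = cvec (r(j := y))"
            using ji by auto
          ultimately show ?thesis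
            using pd_expansion(2)[OF abc, of "complex_of_real (r i)"] by simp
        qed
        have sym2: "pd2 i F (\<lambda>i. cnj (z i)) = cnj (pd2 i F z)" for z
          unfolding pd_pd[OF quad[OF iV], symmetric] by (intro pd_cnj sym)
        have quad2: "quadratic_at j (pd2 i F)"
          unfolding pd_pd[OF quad[OF iV], symmetric] by (intro quadratic_at_pd quad jV)
        obtain a b c where L: "\<And>u. pd2 i F ((cvec r)(j := u)) = of_real a + of_real b * u + of_real c * u\<^sup>2"
          using real_quadratic_expansion[of "pd2 i F", OF sym2 quad2, where r = r] by blast
        have L_re: "Re (pd2 i F (cvec (r(j := y)))) = a + b * y + c * y\<^sup>2" for y
          unfolding cvec_upd L by (simp flip: of_real_power of_real_mult of_real_add)
        have r_selfj: "r(j := r j) = r" "(cvec r)(j := complex_of_real (r j)) = cvec r"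
          by auto
        have zero: "a + b * r j + c * (r j)\<^sup>2 = 0"
          using L_re[of "r j"] \<alpha>0 lead by (simp add: r_selfj)
        have "pd2 i (pd j F) (cvec r) = of_real (b + 2 * c * r j)"
          using pd_expansion(1)[OF L, of "of_real (r j)"] ji by (simp add: r_selfj pd_pd2_commute)
        then have eq: "2 * \<alpha>' = b + 2 * c * r j"
          using leadB by (metis of_real_eq_iff)
        have "- (2 * \<alpha>') \<le> \<epsilon>\<^sup>2 * c" if "\<epsilon> > 0" for \<epsilon>
        proof -
          have "0 \<le> a + b * (r j + \<epsilon>\<^sup>2) + c * (r j + \<epsilon>\<^sup>2)\<^sup>2"
            using lead_nonneg[of "r j + \<epsilon>\<^sup>2"] L_re[of "r j + \<epsilon>\<^sup>2"] by simp
          also have "\<dots> = \<epsilon>\<^sup>2 * (2 * \<alpha>' + c * \<epsilon>\<^sup>2)"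
            using zero eq by (simp add: algebra_simps power2_eq_square)
          finally have "0 \<le> 2 * \<alpha>' + c * \<epsilon>\<^sup>2"
            using that by (simp add: zero_le_mult_iff)
          then show ?thesis
            by (simp add: mult.commute)
        qed
        from le_0_if_le_square_mult[OF this] show ?thesis
          by simp
      qed
      then show "\<alpha> - w * \<alpha>' \<le> 0"
        using \<alpha>0 w by simp
    next
      fix s assume \<alpha>: "\<alpha> > 0" and s: "\<gamma> + \<beta> * s + \<alpha> * s\<^sup>2 = 0" "s < x0"
        and right: "\<And>x. s < x \<Longrightarrow> 0 < \<gamma> + \<beta> * x + \<alpha> * x\<^sup>2"
      define C where "C = (\<gamma>' + \<beta>' * x0 + \<alpha>' * x0\<^sup>2) / (\<gamma> + \<beta> * x0 + \<alpha> * x0\<^sup>2)"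
      define g where "g x = (\<gamma>' + \<beta>' * x + \<alpha>' * x\<^sup>2) - C * (\<gamma> + \<beta> * x + \<alpha> * x\<^sup>2)" for x
      have g_nonneg: "g x \<ge> 0" if x: "s < x" "x \<le> x0" for x
      proof -
        have "C \<le> (\<gamma>' + \<beta>' * x + \<alpha>' * x\<^sup>2) / (\<gamma> + \<beta> * x + \<alpha> * x\<^sup>2)"
          unfolding C_def using x by (intro quadratic_ratio_antimono Rayleigh right) auto
        then show ?thesis
          using right[OF x(1)] by (simp add: g_def pos_le_divide_eq)
      qed
      have "isCont g s"
        unfolding g_def by (intro continuous_intros)
      then have "(g \<longlongrightarrow> g s) (at_right s)"
        by (simp add: isCont_def filterlim_at_split)
      moreover have "\<forall>\<^sub>F x in at_right s. g x \<ge> 0"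
        using g_nonneg s(2) by (auto simp: eventually_at_right_field intro!: exI[of _ x0])
      ultimately have "g s \<ge> 0"
        by (rule tendsto_lowerbound) simp
      then have "w * (\<gamma>' + \<beta>' * s + \<alpha>' * s\<^sup>2) \<ge> 0"
        using w by (simp add: g_def s(1))
      then show "(\<gamma> - w * \<gamma>') + (\<beta> - w * \<beta>') * s + (\<alpha> - w * \<alpha>') * s\<^sup>2 \<le> 0"
        using s(1) by (simp add: algebra_simps)
    qed (use p_pos p_bar w \<delta> disc in auto)
    moreover have "Re (pd j F (cvec r)) = \<gamma>' + \<beta>' * (x0 + \<delta>) + \<alpha>' * (x0 + \<delta>)\<^sup>2"
      using B_re[of "r i"] ri by (simp add: r_self)
    moreover have "pd j (\<lambda>z. F z - pd2 i F z) (cvec r) = pd j F (cvec r) - pd2 i (pd j F) (cvec r)"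
      unfolding pd_pd2_commute[OF ji[symmetric]] by (simp add: pd_def field_simps)
    ultimately have eq: "Re (pd j (\<lambda>z. F z - pd2 i F z) (cvec r)) =
        \<gamma>' + \<beta>' * (x0 + \<delta>) + \<alpha>' * (x0 + \<delta>)\<^sup>2 - 2 * \<alpha>'"
      and le: "2 * (\<alpha> - w * \<alpha>') \<le> (\<gamma> - w * \<gamma>') + (\<beta> - w * \<beta>') * (x0 + \<delta>) + (\<alpha> - w * \<alpha>') * (x0 + \<delta>)\<^sup>2"
      by (simp_all add: leadB)
    show ?thesis
      unfolding eq using le by (simp add: val lead algebra_simps)
  qed
  with pos show "Re (F (cvec r) - pd2 i F (cvec r)) > 0 \<and>
      (\<forall>j\<in>J - {i}. w * Re (pd j (\<lambda>z. F z - pd2 i F z) (cvec r)) \<le> Re (F (cvec r) - pd2 i F (cvec r)))"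
    by blast
qed

section \<open>Products of stable multiaffine functions\<close>

definition affine_at :: "'v \<Rightarrow> (('v \<Rightarrow> complex) \<Rightarrow> complex) \<Rightarrow> bool" where
  "affine_at i q \<longleftrightarrow> (\<forall>z. \<exists>a b. \<forall>w. q (z(i := w)) = a + b * w)"

text \<open>The common properties of \<open>g\<close> and \<open>q\<close>, stated for functions instead of families of
  coefficients, so that substitutions and limits are available directly.\<close>

definition stable_multiaffine :: "'v set \<Rightarrow> nat \<Rightarrow> (('v \<Rightarrow> complex) \<Rightarrow> complex) \<Rightarrow> bool" where
  "stable_multiaffine V d q \<longleftrightarrow> continuous_on UNIV q \<and> (\<forall>i\<in>V. affine_at i q) \<and>
     (\<forall>z. q (\<lambda>i. cnj (z i)) = cnj (q z)) \<and> (\<forall>z. (\<forall>i\<in>V. Im (z i) > 0) \<longrightarrow> q z \<noteq> 0) \<and>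
     (\<forall>c z. q (\<lambda>i. c * z i) = c ^ d * q z) \<and>
     (\<forall>u v. (\<lambda>w. q (\<lambda>i. u i + w * v i)) holomorphic_on UNIV) \<and>
     (\<forall>z z'. (\<forall>i\<in>V. z i = z' i) \<longrightarrow> q z = q z')"

lemma stable_quadratic_mult:
  assumes "stable_multiaffine V k g" "stable_multiaffine V d q"
  shows "stable_quadratic V (\<lambda>z. g z * q z)"
proof -
  have "quadratic_at i (\<lambda>z. g z * q z)" if "i \<in> V" for i
    unfolding quadratic_at_def
  proof
    fix z
    obtain a b where g: "\<forall>w. g (z(i := w)) = a + b * w"
      using assms(1) \<open>i \<in> V\<close> unfolding stable_multiaffine_def affine_at_def by blast
    obtain a' b' where q: "\<forall>w. q (z(i := w)) = a' + b' * w"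
      using assms(2) \<open>i \<in> V\<close> unfolding stable_multiaffine_def affine_at_def by blast
    have "\<forall>w. g (z(i := w)) * q (z(i := w)) = a * a' + (a * b' + b * a') * w + (b * b') * w\<^sup>2"
      by (simp add: g q algebra_simps power2_eq_square)
    then show "\<exists>a b c. \<forall>w. g (z(i := w)) * q (z(i := w)) = a + b * w + c * w\<^sup>2"
      by blast
  qed
  then show ?thesis
    using assms by (auto simp: stable_multiaffine_def stable_quadratic_def intro!: continuous_on_mult)
qed

lemma pd_mult:
  assumes "affine_at i g" "affine_at i q"
  shows "pd i (\<lambda>z. g z * q z) z = pd i g z * q z + g z * pd i q z"
proof -
  obtain a b where g: "\<forall>w. g (z(i := w)) = a + b * w"
    using assms(1) unfolding affine_at_def by blast
  obtain a' b' where q: "\<forall>w. q (z(i := w)) = a' + b' * w"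
    using assms(2) unfolding affine_at_def by blast
  have "g z = a + b * z i" "q z = a' + b' * z i"
    using g[rule_format, of "z i"] q[rule_format, of "z i"] by simp_all
  then show ?thesis
    by (simp add: pd_def g q field_simps)
qed

lemma pd_homogeneous:
  assumes aff: "affine_at i q" and hom: "\<And>c z. q (\<lambda>i. c * z i) = c ^ d * q z" and c: "c \<noteq> 0"
  shows "c * pd i q (\<lambda>i. c * z i) = c ^ d * pd i q z"
proof -
  obtain a b where q: "\<forall>w. q (z(i := w)) = a + b * w"
    using aff unfolding affine_at_def by blast
  have "q ((\<lambda>i. c * z i)(i := w)) = c ^ d * (a + b * (w / c))" for w
  proof -
    have "(\<lambda>i. c * z i)(i := w) = (\<lambda>j. c * (z(i := w / c)) j)"
      using c by auto
    then show ?thesis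
      using hom[of c "z(i := w / c)"] q by simp
  qed
  then show ?thesis
    using c by (simp add: pd_def q field_simps)
qed

text \<open>A homogeneous stable function has no zero \<open>r\<close> in the positive orthant, for then \<open>\<i> r\<close> would
  be a zero in the upper half-plane. Hence the sign is the one at the all-ones vector.\<close>

lemma stable_multiaffine_pos:
  assumes q: "stable_multiaffine V d q" and one: "Re (q (\<lambda>_. 1)) > 0" and r: "\<And>i. i \<in> V \<Longrightarrow> r i > 0"
  shows "Re (q (cvec r)) > 0"
proof (rule ccontr)
  assume neg: "\<not> Re (q (cvec r)) > 0"
  have cont: "continuous_on UNIV q" and sym: "\<And>z. q (\<lambda>i. cnj (z i)) = cnj (q z)"
    and stab: "\<And>z. (\<forall>i\<in>V. Im (z i) > 0) \<Longrightarrow> q z \<noteq> 0" and hom: "\<And>c z. q (\<lambda>i. c * z i) = c ^ d * q z"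
    using q by (auto simp: stable_multiaffine_def)
  define p where "p t = (\<lambda>i. complex_of_real ((1 - t) + t * r i))" for t
  have "continuous_on {0..1} p"
    unfolding p_def by (intro continuous_on_coordinatewise_then_product continuous_intros)
  then have "continuous_on {0..1} (\<lambda>t. Re (q (p t)))"
    by (intro continuous_on_Re continuous_on_compose2[OF cont]) auto
  moreover have "Re (q (p 1)) \<le> 0" "0 \<le> Re (q (p 0))"
    using neg one by (simp_all add: p_def)
  ultimately obtain t where t: "0 \<le> t" "t \<le> 1" "Re (q (p t)) = 0"
    using IVT2'[of "\<lambda>t. Re (q (p t))" 1 0 0] by auto
  then have "q (p t) = 0"
    using real_at_cvec[of q, OF sym, of "\<lambda>i. (1 - t) + t * r i"] by (simp add: p_def)
  moreover have "q (\<lambda>i. \<i> * p t i) \<noteq> 0"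
  proof (rule stab, rule ballI)
    fix i assume i: "i \<in> V"
    have "(1 - t) + t * r i > 0"
    proof (cases "t = 0")
      case False
      then have "t * r i > 0"
        using t r[OF i] by simp
      then show ?thesis
        using t by linarith
    qed simp
    then show "Im (\<i> * p t i) > 0"
      by (simp add: p_def)
  qed
  ultimately show False
    by (simp add: hom)
qed

lemma log_derivative_antimono:
  assumes F: "stable_quadratic V F" and fin: "finite V" and j: "j \<in> V"
    and pos: "\<And>r. r \<in> above V z \<Longrightarrow> Re (F (cvec r)) > 0" and r: "r \<in> above V z"
  shows "Re (pd j F (cvec r)) / Re (F (cvec r)) \<le> Re (pd j F (cvec z)) / Re (F (cvec z))"
proof -
  have quad: "\<And>j. j \<in> V \<Longrightarrow> quadratic_at j F"
    and sym: "\<And>z. F (\<lambda>i. cnj (z i)) = cnj (F z)"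
    using F by (auto simp: stable_quadratic_def)
  define h where "h r = Re (pd j F (cvec r)) / Re (F (cvec r))" for r
  have step: "h (s(i := x)) \<le> h s" if s: "s \<in> above V z" and i: "i \<in> V" and x: "s i \<le> x" for s i x
  proof -
    obtain a b c where A: "\<And>y. F ((cvec s)(i := y)) = of_real a + of_real b * y + of_real c * y\<^sup>2"
      using real_quadratic_expansion[OF sym quad[OF i], of s] by blast
    obtain a' b' c' where B: "\<And>y. pd j F ((cvec s)(i := y)) = of_real a' + of_real b' * y + of_real c' * y\<^sup>2"
      using real_quadratic_expansion[OF pd_cnj[of F, OF sym] quadratic_at_pd[OF quad[OF i]], where r = s] by blast
    have A_re: "Re (F (cvec (s(i := y)))) = a + b * y + c * y\<^sup>2" for y
      unfolding cvec_upd A by (simp flip: of_real_power of_real_mult of_real_add)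
    have B_re: "Re (pd j F (cvec (s(i := y)))) = a' + b' * y + c' * y\<^sup>2" for y
      unfolding cvec_upd B by (simp flip: of_real_power of_real_mult of_real_add)
    have h: "h (s(i := y)) = (a' + b' * y + c' * y\<^sup>2) / (a + b * y + c * y\<^sup>2)" for y
      unfolding h_def A_re B_re ..
    have "h (s(i := x)) \<le> h (s(i := s i))"
      unfolding h
    proof (rule quadratic_ratio_antimono[OF _ _ x])
      show "(b' + 2 * c' * x) * (a + b * x + c * x\<^sup>2) \<le> (a' + b' * x + c' * x\<^sup>2) * (b + 2 * c * x)" for x
        by (rule stable_quadratic_Rayleigh[OF F i j A B])
      show "a + b * y + c * y\<^sup>2 > 0" if "s i \<le> y" for y
        using pos[OF above_upd[OF s i, of y]] A_re[of y] s i that by (auto simp: above_def)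
    qed
    then show ?thesis
      by simp
  qed
  have "h (\<lambda>i. if i \<in> A then r i else z i) \<le> h z" if "finite A" "A \<subseteq> V" for A
    using that
  proof (induction A rule: finite_induct)
    case (insert a A)
    let ?s = "\<lambda>i. if i \<in> A then r i else z i"
    have eq: "(\<lambda>i. if i \<in> insert a A then r i else z i) = ?s(a := r a)"
      by auto
    have "h (?s(a := r a)) \<le> h ?s"
      using r insert.prems insert.hyps by (intro step) (auto simp: above_def)
    then show ?case
      using insert unfolding eq by simp
  qed simp
  from this[OF fin subset_refl] have "h (\<lambda>i. if i \<in> V then r i else z i) \<le> h z" .
  moreover have "(\<lambda>i. if i \<in> V then r i else z i) = r"
    using r by (auto simp: above_def)
  ultimately show ?thesis
    by (simp add: h_def)
qed

definition sub_pd2 :: "'v \<Rightarrow> (('v \<Rightarrow> complex) \<Rightarrow> complex) \<Rightarrow> ('v \<Rightarrow> complex) \<Rightarrow> complex" where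
  "sub_pd2 i F = (\<lambda>z. F z - pd2 i F z)"

lemma stable_quadratic_sub_pd2_list:
  assumes "stable_quadratic V F" "set xs \<subseteq> V"
  shows "stable_quadratic V (foldr sub_pd2 xs F)"
  using assms by (induction xs) (auto simp: sub_pd2_def intro: stable_quadratic_minus_pd2)

lemma barrier_sub_pd2_list:
  assumes F: "stable_quadratic V F" and bar: "barrier V V w F z"
    and w: "w > 0" and \<delta>: "\<delta> > 0" "\<delta> * w \<ge> 2" and xs: "distinct xs" "set xs \<subseteq> V"
  shows "barrier V (V - set xs) w (foldr sub_pd2 xs F) (\<lambda>i. if i \<in> set xs then z i + \<delta> else z i)"
  using xs
proof (induction xs)
  case (Cons a xs)
  let ?z = "\<lambda>i. if i \<in> set xs then z i + \<delta> else z i"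
  have "barrier V (V - set xs - {a}) w (\<lambda>z. foldr sub_pd2 xs F z - pd2 a (foldr sub_pd2 xs F) z) (?z(a := ?z a + \<delta>))"
    using Cons by (intro barrier_step w \<delta> stable_quadratic_sub_pd2_list F) auto
  moreover have "?z(a := ?z a + \<delta>) = (\<lambda>i. if i \<in> set (a # xs) then z i + \<delta> else z i)"
    using Cons.prems by auto
  moreover have "V - set xs - {a} = V - set (a # xs)"
    by auto
  moreover have "foldr sub_pd2 (a # xs) F = (\<lambda>z. foldr sub_pd2 xs F z - pd2 a (foldr sub_pd2 xs F) z)"
    by (simp add: sub_pd2_def[of a])
  ultimately show ?case
    by (simp only:)
qed (use bar in simp)

lemma sub_pd2_list_sum:
  "foldr sub_pd2 xs (\<lambda>z. \<Sum>S\<in>A. c S * F S z) = (\<lambda>z. \<Sum>S\<in>A. c S * foldr sub_pd2 xs (F S) z)"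
proof (induction xs)
  case (Cons a xs)
  then show ?case
    by (simp add: sub_pd2_def pd2_def fun_eq_iff sum_subtractf sum.distrib sum_distrib_left algebra_simps)
qed simp

text \<open>In each variable \<open>z\<^sub>i\<close> with \<open>i \<in> S\<close> the function is \<open>z\<^sub>i (\<alpha> + \<beta> z\<^sub>i)\<close>, and
  \<open>(1 - \<partial>\<^sub>i\<^sup>2) (z\<^sub>i (\<alpha> + \<beta> z\<^sub>i)) = z\<^sub>i (\<alpha> + \<beta> (z\<^sub>i - 2/z\<^sub>i))\<close>; in the other variables it is affine and
  \<open>1 - \<partial>\<^sub>i\<^sup>2\<close> acts trivially.\<close>

lemma sub_pd2_list_monomial_mult:
  assumes aff: "\<And>i. i \<in> V \<Longrightarrow> affine_at i q" and S: "finite S"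
    and xs: "distinct xs" "set xs \<subseteq> V" and z: "\<And>i. i \<in> set xs \<Longrightarrow> z i \<noteq> 0"
  shows "foldr sub_pd2 xs (\<lambda>z. (\<Prod>i\<in>S. z i) * q z) z =
    (\<Prod>i\<in>S. z i) * q (\<lambda>i. if i \<in> S \<inter> set xs then z i - 2 / z i else z i)"
  using xs z
proof (induction xs arbitrary: z)
  case (Cons a xs)
  define G where "G = foldr sub_pd2 xs (\<lambda>z. (\<Prod>i\<in>S. z i) * q z)"
  have a: "a \<in> V" "a \<notin> set xs" "z a \<noteq> 0"
    using Cons.prems by auto
  define y where "y = (\<lambda>i. if i \<in> S \<inter> set xs then z i - 2 / z i else z i)"
  obtain \<alpha> \<beta> where q: "\<And>w. q (y(a := w)) = \<alpha> + \<beta> * w"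
    using aff[OF a(1)] unfolding affine_at_def by blast
  have F: "G (z(a := w)) = (\<Prod>i\<in>S. (z(a := w)) i) * (\<alpha> + \<beta> * w)" for w
  proof -
    have "(\<lambda>i. if i \<in> S \<inter> set xs then (z(a := w)) i - 2 / (z(a := w)) i else (z(a := w)) i) = y(a := w)"
      using a by (auto simp: y_def)
    moreover have "G (z(a := w)) = (\<Prod>i\<in>S. (z(a := w)) i) *
       q (\<lambda>i. if i \<in> S \<inter> set xs then (z(a := w)) i - 2 / (z(a := w)) i else (z(a := w)) i)"
      unfolding G_def using Cons.prems a by (intro Cons.IH) auto
    ultimately show ?thesis
      by (simp add: q)
  qed
  have goal: "foldr sub_pd2 (a # xs) (\<lambda>z. (\<Prod>i\<in>S. z i) * q z) z = G z - pd2 a G z"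
    by (simp add: sub_pd2_def[of a] G_def)
  show ?case
  proof (cases "a \<in> S")
    case True
    define P where "P = (\<Prod>i\<in>S - {a}. z i)"
    have P: "(\<Prod>i\<in>S. (z(a := w)) i) = w * P" for w
    proof -
      have "(\<Prod>i\<in>S - {a}. (z(a := w)) i) = P"
        unfolding P_def by (rule prod.cong) auto
      then show ?thesis
        using prod.remove[OF S True, of "z(a := w)"] by simp
    qed
    have "G (z(a := w)) = 0 + (P * \<alpha>) * w + (P * \<beta>) * w\<^sup>2" for w
      unfolding F P by (simp add: algebra_simps power2_eq_square)
    from pd_expansion(2)[OF this, of "z a"] this[of "z a"]
    have "G z - pd2 a G z = z a * P * (\<alpha> + \<beta> * (z a - 2 / z a))"
      using a by (simp add: field_simps power2_eq_square)
    moreover have "y(a := z a - 2 / z a) = (\<lambda>i. if i \<in> S \<inter> set (a # xs) then z i - 2 / z i else z i)"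
      using True by (auto simp: y_def)
    ultimately show ?thesis
      unfolding goal using P[of "z a"] by (simp add: q[symmetric])
  next
    case False
    define P where "P = (\<Prod>i\<in>S. z i)"
    have P: "(\<Prod>i\<in>S. (z(a := w)) i) = P" for w
      unfolding P_def using False by (intro prod.cong) auto
    have "G (z(a := w)) = P * \<alpha> + (P * \<beta>) * w + 0 * w\<^sup>2" for w
      unfolding F P by (simp add: algebra_simps)
    from pd_expansion(2)[OF this, of "z a"] this[of "z a"]
    have "G z - pd2 a G z = P * (\<alpha> + \<beta> * z a)"
      by (simp add: algebra_simps)
    moreover have "y(a := z a) = (\<lambda>i. if i \<in> S \<inter> set (a # xs) then z i - 2 / z i else z i)"
      using False by (auto simp: y_def)
    ultimately show ?thesis
      unfolding goal P_def by (simp add: q[symmetric])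
  qed
qed simp

section \<open>Real-rootedness of the mixed characteristic polynomials\<close>

text \<open>Follow the convex combinations of \<open>f\<^sub>0\<close> and \<open>f\<^sub>1\<close> from the midpoint to \<open>f\<^sub>0\<close>. They are real-rooted
  and positive at \<open>B\<close>, so no zero can cross the line \<open>Re w = B\<close>; and there is no zero to the
  right of it at the midpoint.\<close>

lemma interlacing_choice:
  fixes f0 f1 :: "complex \<Rightarrow> complex" and B Y :: real
  assumes hol: "f0 holomorphic_on UNIV" "f1 holomorphic_on UNIV"
    and real: "\<And>y::real. f0 y \<in> \<real>" "\<And>y::real. f1 y \<in> \<real>"
    and f0B: "Re (f0 B) > 0"
    and sum_pos: "\<And>y::real. y \<ge> B \<Longrightarrow> Re (f0 y + f1 y) > 0"
    and real_rooted: "\<And>t y. 0 \<le> t \<Longrightarrow> t \<le> 1/2 \<Longrightarrow> Im y \<noteq> 0 \<Longrightarrow>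
         of_real (1 - t) * f0 y + of_real t * f1 y \<noteq> 0"
    and large: "\<And>t y. 0 \<le> t \<Longrightarrow> t \<le> 1/2 \<Longrightarrow> y > Y \<Longrightarrow>
         of_real (1 - t) * f0 (complex_of_real y) + of_real t * f1 (complex_of_real y) \<noteq> 0"
    and y: "y \<ge> B"
  shows "Re (f0 (complex_of_real y)) > 0"
proof -
  define F where "F s w = of_real ((1 + s) / 2) * f0 w + of_real ((1 - s) / 2) * f1 w" for s w
  have F_eq: "F s w = of_real (1 - (1 - s) / 2) * f0 w + of_real ((1 - s) / 2) * f1 w" for s w
    by (simp add: F_def field_simps)
  have cont: "continuous_on UNIV f0" "continuous_on UNIV f1"
    using hol by (auto intro: holomorphic_on_imp_continuous_on)
  have FB: "F s B \<noteq> 0" if s: "0 \<le> s" "s \<le> 1" for s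
  proof -
    have "Re (F s B) = s * Re (f0 B) + ((1 - s) / 2) * Re (f0 B + f1 B)"
      by (simp add: F_def field_simps)
    also have "\<dots> > 0"
    proof (cases "s = 0")
      case True
      then show ?thesis using sum_pos[of B] by simp
    next
      case False
      then show ?thesis using s f0B sum_pos[of B]
        by (intro add_pos_nonneg mult_pos_pos mult_nonneg_nonneg) auto
    qed
    finally show ?thesis by auto
  qed
  \<comment> \<open>\<open>F s\<close> runs from the midpoint at \<open>s = 0\<close> to \<open>f0\<close> at \<open>s = 1\<close>\<close>
  have nz: "f0 w \<noteq> 0" if w: "Re w > B" for w
  proof -
    have "F 1 w \<noteq> 0"
    proof (rule zero_free_homotopy[where U = "{w. Re w > B}" and R = "max \<bar>B\<bar> \<bar>Y\<bar>" and f = F])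
      show "open {w. Re w > B}"
        by (rule open_halfspace_Re_gt)
      show "connected {w. Re w > B}"
        by (intro convex_connected convex_halfspace_Re_gt)
      have "continuous_on ({0..1} \<times> UNIV) (\<lambda>p. f (snd p))"
        if "continuous_on UNIV f" for f :: "complex \<Rightarrow> complex"
        by (rule continuous_on_compose2[OF that]) (auto intro!: continuous_intros)
      then show "continuous_on ({0..1} \<times> UNIV) (\<lambda>(s, w). F s w)"
        unfolding F_def case_prod_beta using cont by (intro continuous_intros) auto
      show "F s holomorphic_on UNIV" for s
        unfolding F_def by (intro holomorphic_intros hol)
      fix s :: real assume s: "s \<in> {0..1}"
      have real_zero: "Im u = 0" if "F s u = 0" for u
        using real_rooted[of "(1 - s) / 2" u] that s by (auto simp: F_eq)
      show "norm u \<le> max \<bar>B\<bar> \<bar>Y\<bar>" if u: "u \<in> {w. Re w > B}" "F s u = 0" for u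
      proof -
        have u_eq: "u = complex_of_real (Re u)"
          using real_zero[OF u(2)] by (simp add: complex_eq_iff)
        have "Re u \<le> Y"
          using large[of "(1 - s) / 2" "Re u"] u(2) s unfolding F_eq by (metis atLeastAtMost_iff
              diff_ge_0_iff_ge divide_nonneg_pos divide_right_mono not_le u_eq zero_less_numeral
              zero_le_numeral diff_le_eq le_add_same_cancel1)
        then have "\<bar>Re u\<bar> \<le> max \<bar>B\<bar> \<bar>Y\<bar>"
          using u(1) by auto
        then show ?thesis
          using u_eq by (metis norm_of_real)
      qed
      show "F s u \<noteq> 0" if "u \<in> frontier {w. Re w > B}" for u
      proof
        assume z: "F s u = 0"
        have "closure {w. Re w > B} \<subseteq> {w. Re w \<ge> B}"
          by (intro closure_minimal closed_halfspace_Re_ge) auto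
        then have "Re u = B"
          using that open_halfspace_Re_gt[of B] by (auto simp: frontier_def interior_open)
        with real_zero[OF z] have "u = complex_of_real B"
          by (simp add: complex_eq_iff)
        then show False
          using FB[of s] s z by simp
      qed
      show "\<exists>u\<in>{w. Re w > B}. F s u \<noteq> 0"
        using real_zero[of "Complex (B + 1) 1"] by (intro bexI[of _ "Complex (B + 1) 1"]) auto
    next
      show "F 0 u \<noteq> 0" if u: "u \<in> {w. Re w > B}" for u
      proof
        assume z: "F 0 u = 0"
        have "Im u = 0"
          using real_rooted[of "1/2" u] z by (auto simp: F_eq)
        then have "u = complex_of_real (Re u)"
          by (simp add: complex_eq_iff)
        moreover have "f0 u + f1 u = 0"
          using z by (simp add: F_def field_simps add_eq_0_iff2)
        ultimately show False
          using sum_pos[of "Re u"] u by (metis less_imp_le less_irrefl mem_Collect_eq zero_complex.sel(1))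
      qed
    qed (use w in auto)
    then show ?thesis
      by (simp add: F_def)
  qed
  show ?thesis
  proof (rule ccontr)
    assume neg: "\<not> Re (f0 (complex_of_real y)) > 0"
    have "continuous_on {B..y} (\<lambda>x. Re (f0 (complex_of_real x)))"
      by (intro continuous_intros continuous_on_compose2[OF cont(1)]) auto
    then obtain x where x: "B \<le> x" "x \<le> y" "Re (f0 (complex_of_real x)) = 0"
      using IVT2'[of "\<lambda>x. Re (f0 (complex_of_real x))" y 0 B] neg f0B y by auto
    then have "f0 (complex_of_real x) = 0"
      using real(1)[of x] by (metis Reals_cases Re_complex_of_real of_real_0)
    moreover have "x \<noteq> B"
      using x(3) f0B by auto
    ultimately show False
      using nz[of "complex_of_real x"] x by simp
  qed
qed

text \<open>For the polynomial \<open>q\<close> of a family of vectors this is \<open>h(y e - 2 \<Sum>\<^bsub>i\<in>S\<^esub> v\<^sub>i)\<close>.\<close>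

definition subset_charpoly :: "(('v \<Rightarrow> complex) \<Rightarrow> complex) \<Rightarrow> 'v set \<Rightarrow> complex \<Rightarrow> complex" where
  "subset_charpoly q S y = q (\<lambda>i. if i \<in> S then y - 2 else y)"

text \<open>External fields: \<open>c\<close> weights the elements of the set, \<open>a\<close> those outside it. Two parameters
  per element make it possible to force an element into the set (\<open>a\<^sub>i = 0\<close>) or out of it
  (\<open>c\<^sub>i = 0\<close>) by finite weights.\<close>

definition tilt :: "'v set \<Rightarrow> ('v set \<Rightarrow> real) \<Rightarrow> ('v \<Rightarrow> real) \<Rightarrow> ('v \<Rightarrow> real) \<Rightarrow> 'v set \<Rightarrow> real" where
  "tilt V \<mu> a c S = \<mu> S * (\<Prod>i\<in>V. if i \<in> S then c i else a i)"

definition mixed_charpoly ::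
  "'v set \<Rightarrow> (('v \<Rightarrow> complex) \<Rightarrow> complex) \<Rightarrow> ('v set \<Rightarrow> real) \<Rightarrow> complex \<Rightarrow> complex" where
  "mixed_charpoly V q m y = (\<Sum>S\<in>Pow V. of_real (m S) * subset_charpoly q S y)"

locale stable_pair =
  fixes V :: "'v set" and k d :: nat and \<mu> :: "'v set \<Rightarrow> real" and g q :: "('v \<Rightarrow> complex) \<Rightarrow> complex"
  assumes finV: "finite V"
    and \<mu>_nonneg: "\<And>S. \<mu> S \<ge> 0" and \<mu>_hom: "\<And>S. S \<subseteq> V \<Longrightarrow> \<mu> S \<noteq> 0 \<Longrightarrow> card S = k"
    and \<mu>_total: "(\<Sum>S\<in>Pow V. \<mu> S) = 1"
    and g_eq: "g = (\<lambda>z. \<Sum>S\<in>Pow V. of_real (\<mu> S) * (\<Prod>i\<in>S. z i))"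
    and g_stable: "\<And>z. (\<forall>i\<in>V. Im (z i) > 0) \<Longrightarrow> g z \<noteq> 0"
    and q: "stable_multiaffine V d q" and q_one: "Re (q (\<lambda>_. 1)) > 0"
begin

abbreviation R where "R \<equiv> subset_charpoly q"

abbreviation genpoly where "genpoly m \<equiv> (\<lambda>z. \<Sum>S\<in>Pow V. complex_of_real (m S) * (\<Prod>i\<in>S. z i))"

lemma q_props:
  shows q_cont: "continuous_on UNIV q" and q_affine: "\<And>i. i \<in> V \<Longrightarrow> affine_at i q"
    and q_sym: "\<And>z. q (\<lambda>i. cnj (z i)) = cnj (q z)"
    and q_hom: "\<And>c z. q (\<lambda>i. c * z i) = c ^ d * q z"
    and q_hol: "\<And>u v. (\<lambda>w. q (\<lambda>i. u i + w * v i)) holomorphic_on UNIV"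
    and q_local: "\<And>z z'. (\<And>i. i \<in> V \<Longrightarrow> z i = z' i) \<Longrightarrow> q z = q z'"
  using q by (auto simp: stable_multiaffine_def)

lemma genpoly_stable_multiaffine:
  assumes stab: "\<And>z. (\<forall>i\<in>V. Im (z i) > 0) \<Longrightarrow> genpoly m z \<noteq> 0"
    and hom: "\<And>S. S \<subseteq> V \<Longrightarrow> m S \<noteq> 0 \<Longrightarrow> card S = k"
  shows "stable_multiaffine V k (genpoly m)"
proof -
  have "continuous_on UNIV (genpoly m)"
    by (intro continuous_intros continuous_on_product_coordinates)
  moreover have "affine_at i (genpoly m)" if i: "i \<in> V" for i
    unfolding affine_at_def
  proof
    fix z :: "'v \<Rightarrow> complex"
    have mono: "(\<Prod>j\<in>S. (z(i := w)) j) =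
        (if i \<in> S then 0 else \<Prod>j\<in>S. z j) + (if i \<in> S then \<Prod>j\<in>S - {i}. z j else 0) * w"
      if S: "S \<in> Pow V" for S w
    proof (cases "i \<in> S")
      case True
      have "(\<Prod>j\<in>S. (z(i := w)) j) = (z(i := w)) i * (\<Prod>j\<in>S - {i}. (z(i := w)) j)"
        using S finV True by (intro prod.remove) (auto intro: finite_subset)
      also have "(\<Prod>j\<in>S - {i}. (z(i := w)) j) = (\<Prod>j\<in>S - {i}. z j)"
        by (intro prod.cong) auto
      finally show ?thesis
        using True by (simp add: mult.commute)
    next
      case False
      have "(\<Prod>j\<in>S. (z(i := w)) j) = (\<Prod>j\<in>S. z j)"
        using False by (intro prod.cong) auto
      then show ?thesis
        using False by simp
    qed
    have "genpoly m (z(i := w)) =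
       (\<Sum>S\<in>Pow V. complex_of_real (m S) * (if i \<in> S then 0 else \<Prod>j\<in>S. z j)) +
       (\<Sum>S\<in>Pow V. complex_of_real (m S) * (if i \<in> S then \<Prod>j\<in>S - {i}. z j else 0)) * w" for w
      unfolding sum_distrib_right sum.distrib[symmetric]
      by (intro sum.cong refl) (simp only: mono ring_distribs mult.assoc)
    then show "\<exists>a b. \<forall>w. genpoly m (z(i := w)) = a + b * w"
      by blast
  qed
  moreover have "genpoly m (\<lambda>i. cnj (z i)) = cnj (genpoly m z)" for z
    by simp
  moreover have "genpoly m (\<lambda>i. c * z i) = c ^ k * genpoly m z" for c z
    unfolding sum_distrib_left
  proof (intro sum.cong refl)
    fix S assume "S \<in> Pow V"
    then show "complex_of_real (m S) * (\<Prod>i\<in>S. c * z i) = c ^ k * (complex_of_real (m S) * (\<Prod>i\<in>S. z i))"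
      using hom[of S] by (cases "m S = 0") (auto simp: prod.distrib)
  qed
  moreover have "(\<lambda>w. genpoly m (\<lambda>i. u i + w * v i)) holomorphic_on UNIV" for u v
    by (intro holomorphic_intros)
  moreover have "genpoly m z = genpoly m z'" if "\<forall>i\<in>V. z i = z' i" for z z'
  proof -
    have "(\<Prod>i\<in>S. z i) = (\<Prod>i\<in>S. z' i)" if "S \<in> Pow V" for S
      using that \<open>\<forall>i\<in>V. z i = z' i\<close> by (intro prod.cong) auto
    then show ?thesis
      by simp
  qed
  ultimately show ?thesis
    using stab unfolding stable_multiaffine_def by blast
qed

lemma sub_pd2_genpoly_mult:
  assumes xs: "distinct xs" "set xs = V" and x: "x \<noteq> 0" and z: "\<And>i. i \<in> V \<Longrightarrow> z i = x"
    and hom: "\<And>S. S \<subseteq> V \<Longrightarrow> m S \<noteq> 0 \<Longrightarrow> card S = k"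
  shows "x ^ d * foldr sub_pd2 xs (\<lambda>z. genpoly m z * q z) z = x ^ k * mixed_charpoly V q m (x\<^sup>2)"
proof -
  have "(\<lambda>z. genpoly m z * q z) = (\<lambda>z. \<Sum>S\<in>Pow V. of_real (m S) * ((\<Prod>i\<in>S. z i) * q z))"
    by (simp add: sum_distrib_right mult.assoc)
  then have "foldr sub_pd2 xs (\<lambda>z. genpoly m z * q z) =
      (\<lambda>z. \<Sum>S\<in>Pow V. of_real (m S) * foldr sub_pd2 xs (\<lambda>z. (\<Prod>i\<in>S. z i) * q z) z)"
    by (simp only: sub_pd2_list_sum)
  then have "x ^ d * foldr sub_pd2 xs (\<lambda>z. genpoly m z * q z) z =
      (\<Sum>S\<in>Pow V. of_real (m S) * (x ^ d * foldr sub_pd2 xs (\<lambda>z. (\<Prod>i\<in>S. z i) * q z) z))"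
    by (simp add: sum_distrib_left mult.left_commute)
  also have "\<dots> = (\<Sum>S\<in>Pow V. of_real (m S) * (x ^ k * R S (x\<^sup>2)))"
  proof (intro sum.cong refl)
    fix S assume S: "S \<in> Pow V"
    show "of_real (m S) * (x ^ d * foldr sub_pd2 xs (\<lambda>z. (\<Prod>i\<in>S. z i) * q z) z) =
          of_real (m S) * (x ^ k * R S (x\<^sup>2))"
    proof (cases "m S = 0")
      case False
      have "foldr sub_pd2 xs (\<lambda>z. (\<Prod>i\<in>S. z i) * q z) z =
         (\<Prod>i\<in>S. z i) * q (\<lambda>i. if i \<in> S \<inter> set xs then z i - 2 / z i else z i)"
        using S xs x z finV finite_subset by (intro sub_pd2_list_monomial_mult[where V = V] q_affine) auto
      also have "q (\<lambda>i. if i \<in> S \<inter> set xs then z i - 2 / z i else z i) = q (\<lambda>i. if i \<in> S then x - 2 / x else x)"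
        using S xs z by (intro q_local) auto
      also have "(\<Prod>i\<in>S. z i) = (\<Prod>i\<in>S. x)"
        using S z by (intro prod.cong) auto
      also have "\<dots> = x ^ k"
        using hom[of S] S False by simp
      finally have "x ^ d * foldr sub_pd2 xs (\<lambda>z. (\<Prod>i\<in>S. z i) * q z) z =
          x ^ k * (x ^ d * q (\<lambda>i. if i \<in> S then x - 2 / x else x))"
        by simp
      also have "x ^ d * q (\<lambda>i. if i \<in> S then x - 2 / x else x) =
          q (\<lambda>i. x * (if i \<in> S then x - 2 / x else x))"
        by (simp only: q_hom)
      also have "(\<lambda>i. x * (if i \<in> S then x - 2 / x else x)) = (\<lambda>i. if i \<in> S then x\<^sup>2 - 2 else x\<^sup>2)"
        using x by (auto simp: field_simps power2_eq_square)
      finally show ?thesis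
        by (simp add: subset_charpoly_def)
    qed simp
  qed
  also have "\<dots> = x ^ k * mixed_charpoly V q m (x\<^sup>2)"
    by (simp add: mixed_charpoly_def sum_distrib_left mult.left_commute)
  finally show ?thesis .
qed

lemma R_hol: "R S holomorphic_on UNIV"
proof -
  have "R S = (\<lambda>y. q (\<lambda>i. (if i \<in> S then - 2 else 0) + y * 1))"
    unfolding subset_charpoly_def by (intro ext arg_cong[where f = q]) auto
  then show ?thesis
    using q_hol[of "\<lambda>i. if i \<in> S then - 2 else 0" "\<lambda>_. 1"] by simp
qed

lemma R_cnj: "R S (cnj y) = cnj (R S y)"
proof -
  have "(\<lambda>i. if i \<in> S then cnj y - 2 else cnj y) = (\<lambda>i. cnj (if i \<in> S then y - 2 else y))"
    by auto
  then show ?thesis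
    by (simp only: subset_charpoly_def q_sym)
qed

lemma R_pos: "y > 2 \<Longrightarrow> Re (R S (complex_of_real y)) > 0"
proof -
  assume y: "y > 2"
  have "(\<lambda>i. if i \<in> S then complex_of_real y - 2 else complex_of_real y) = cvec (\<lambda>i. if i \<in> S then y - 2 else y)"
    by auto
  then show ?thesis
    using stable_multiaffine_pos[OF q q_one, of "\<lambda>i. if i \<in> S then y - 2 else y"] y
    by (simp add: subset_charpoly_def)
qed

lemma mixed_hol: "mixed_charpoly V q m holomorphic_on UNIV"
  unfolding mixed_charpoly_def by (intro holomorphic_intros R_hol)

lemma mixed_cnj: "mixed_charpoly V q m (cnj y) = cnj (mixed_charpoly V q m y)"
  by (simp add: mixed_charpoly_def R_cnj)

lemma mixed_real: "mixed_charpoly V q m (complex_of_real y) \<in> \<real>"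
  using mixed_cnj[of m "complex_of_real y"] by (simp add: Reals_cnj_iff)

lemma mixed_pos:
  assumes "\<And>S. S \<subseteq> V \<Longrightarrow> m S \<ge> 0" "S \<subseteq> V" "m S > 0" "y > 2"
  shows "Re (mixed_charpoly V q m (complex_of_real y)) > 0"
proof -
  have "0 < (\<Sum>S\<in>Pow V. m S * Re (R S (complex_of_real y)))"
    using assms finV R_pos[OF assms(4)]
    by (intro sum_pos2[where i = S]) (auto intro!: mult_nonneg_nonneg less_imp_le[OF R_pos])
  then show ?thesis
    by (simp add: mixed_charpoly_def)
qed

lemma tilt_nonneg:
  assumes "\<And>i. i \<in> V \<Longrightarrow> a i \<ge> 0" "\<And>i. i \<in> V \<Longrightarrow> c i \<ge> 0"
  shows "tilt V \<mu> a c S \<ge> 0"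
  using assms \<mu>_nonneg unfolding tilt_def by (intro mult_nonneg_nonneg prod_nonneg) auto

text \<open>Every \<open>y\<close> off the real axis is \<open>x\<^sup>2\<close> with \<open>Im x > 0\<close>, where a stable function does not vanish
  on the diagonal. Tilting rescales the variables of the generating polynomial by positive
  factors and thus keeps it stable.\<close>

lemma mixed_real_rooted_pos:
  assumes pos: "\<And>i. i \<in> V \<Longrightarrow> a i > 0" "\<And>i. i \<in> V \<Longrightarrow> c i > 0" and y: "Im y \<noteq> 0"
  shows "mixed_charpoly V q (tilt V \<mu> a c) y \<noteq> 0"
proof -
  let ?m = "tilt V \<mu> a c"
  obtain xs where xs: "distinct xs" "set xs = V"
    using finite_distinct_list[OF finV] by blast
  have hom: "card S = k" if "S \<subseteq> V" "?m S \<noteq> 0" for S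
    using \<mu>_hom[OF that(1)] that(2) by (auto simp: tilt_def)
  have tilt_prod: "of_real (?m S) * (\<Prod>i\<in>S. z i) =
     (\<Prod>i\<in>V. of_real (a i)) * (of_real (\<mu> S) * (\<Prod>i\<in>S. of_real (c i / a i) * z i))"
    if S: "S \<in> Pow V" for S and z :: "'v \<Rightarrow> complex"
  proof -
    have "(\<Prod>i\<in>V. if i \<in> S then c i else a i) = (\<Prod>i\<in>V. a i * (if i \<in> S then c i / a i else 1))"
      using pos by (intro prod.cong) (auto simp: less_imp_neq[symmetric])
    also have "\<dots> = (\<Prod>i\<in>V. a i) * (\<Prod>i\<in>S. c i / a i)"
      using S finV by (simp add: prod.distrib prod.If_cases Int_absorb1)
    finally show ?thesis
      by (simp add: tilt_def prod.distrib prod_dividef)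
  qed
  have gm: "genpoly ?m z = (\<Prod>i\<in>V. of_real (a i)) * g (\<lambda>i. of_real (c i / a i) * z i)" for z
    unfolding g_eq sum_distrib_left by (intro sum.cong refl tilt_prod)
  have "genpoly ?m z \<noteq> 0" if z: "\<forall>i\<in>V. Im (z i) > 0" for z
  proof -
    have "g (\<lambda>i. of_real (c i / a i) * z i) \<noteq> 0"
      using z pos by (intro g_stable) (auto intro!: divide_pos_pos mult_pos_pos)
    moreover have "(\<Prod>i\<in>V. complex_of_real (a i)) \<noteq> 0"
      using pos finV by (auto simp: prod_zero_iff less_imp_neq[symmetric])
    ultimately show ?thesis
      unfolding gm by simp
  qed
  then have "stable_multiaffine V k (genpoly ?m)"
    using hom by (rule genpoly_stable_multiaffine)
  from stable_quadratic_mult[OF this q]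
  have "stable_quadratic V (foldr sub_pd2 xs (\<lambda>z. genpoly ?m z * q z))"
    using xs by (intro stable_quadratic_sub_pd2_list) auto
  then have nz: "foldr sub_pd2 xs (\<lambda>z. genpoly ?m z * q z) (\<lambda>_. x) \<noteq> 0" if "Im x > 0" for x
    using that by (auto simp: stable_quadratic_def)
  define u where "u = csqrt y"
  have u: "u\<^sup>2 = y"
    unfolding u_def by (rule power2_csqrt)
  then have "Im y = 2 * Re u * Im u"
    by (auto simp: power2_eq_square)
  then have Im_u: "Im u \<noteq> 0"
    using y by auto
  define x where "x = (if Im u > 0 then u else - u)"
  have x: "Im x > 0" "x\<^sup>2 = y"
    using Im_u u by (auto simp: x_def)
  have "x \<noteq> 0"
    using x by auto
  from sub_pd2_genpoly_mult[where m = ?m and z = "\<lambda>_. x", OF xs this refl hom] nz[OF x(1)] \<open>x \<noteq> 0\<close> x(2) show ?thesis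
    by auto
qed

text \<open>Weights that vanish are limits of positive ones. The limit does not vanish identically because
  all the polynomials involved are positive for real \<open>y > 2\<close>.\<close>

lemma mixed_real_rooted:
  assumes nonneg: "\<And>i. i \<in> V \<Longrightarrow> a i \<ge> 0" "\<And>i. i \<in> V \<Longrightarrow> c i \<ge> 0"
    and mass: "S \<subseteq> V" "tilt V \<mu> a c S > 0" and y: "Im y \<noteq> 0"
  shows "mixed_charpoly V q (tilt V \<mu> a c) y \<noteq> 0"
proof -
  define f where "f t = mixed_charpoly V q (tilt V \<mu> (\<lambda>i. a i + t) (\<lambda>i. c i + t))" for t :: real
  have f0: "f 0 = mixed_charpoly V q (tilt V \<mu> a c)"
    by (simp add: f_def)
  have upper: "f 0 w \<noteq> 0" if w: "Im w > 0" for w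
  proof -
    have "\<exists>w0. Im w0 > 0 \<and> f 0 w0 \<noteq> 0"
    proof (rule ccontr)
      assume "\<not> ?thesis"
      then have zero: "f 0 (Complex 3 \<eta>) = 0" if "\<eta> > 0" for \<eta>
        using that by simp
      have "continuous_on UNIV (f 0)"
        unfolding f0 by (intro holomorphic_on_imp_continuous_on mixed_hol)
      then have "continuous_on UNIV (\<lambda>\<eta>. f 0 (3 + \<i> * of_real \<eta>))"
        by (rule continuous_on_compose2) (auto intro!: continuous_intros)
      then have "isCont (\<lambda>\<eta>. f 0 (3 + \<i> * of_real \<eta>)) 0"
        by (simp add: continuous_on_eq_continuous_at)
      then have "((\<lambda>\<eta>. f 0 (3 + \<i> * of_real \<eta>)) \<longlongrightarrow> f 0 3) (at_right 0)"
        by (simp add: isCont_def filterlim_at_split)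
      moreover have "\<forall>\<^sub>F \<eta> in at_right 0. f 0 (3 + \<i> * of_real \<eta>) = 0"
      proof -
        have "3 + \<i> * of_real \<eta> = Complex 3 \<eta>" for \<eta>
          by (simp add: complex_eq_iff)
        then show ?thesis
          using zero by (auto simp: eventually_at_right_field intro!: exI[of _ 1])
      qed
      ultimately have "f 0 3 = 0"
        using tendsto_cong tendsto_const tendsto_unique trivial_limit_at_right_real by fast
      moreover have "Re (f 0 (complex_of_real 3)) > 0"
        unfolding f0 using mass tilt_nonneg[of a c] nonneg by (intro mixed_pos[where S = S]) auto
      ultimately show False
        by simp
    qed
    then obtain w0 where w0: "w0 \<in> {w. Im w > 0}" "f 0 w0 \<noteq> 0"
      by auto
    show ?thesis
    proof (rule zero_free_limit[where U = "{w. Im w > 0}" and T = "{0..1}" and f = f and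
          X = "\<lambda>n. inverse (real (Suc n))" and l = 0, OF _ _ _ _ _ _ _ _ w0])
      show "open {w. Im w > 0}"
        by (rule open_halfspace_Im_gt)
      show "connected {w. Im w > 0}"
        by (intro convex_connected convex_halfspace_Im_gt)
      have "continuous_on ({0..1} \<times> {w. Im w > 0}) (\<lambda>p. R S (snd p))" for S
        by (rule continuous_on_compose2[OF holomorphic_on_imp_continuous_on[OF R_hol]])
           (auto intro!: continuous_intros)
      moreover have "continuous_on ({0..1::real} \<times> {w. Im w > 0})
          (\<lambda>p. tilt V \<mu> (\<lambda>i. a i + fst p) (\<lambda>i. c i + fst p) S)" for S
      proof -
        have "continuous_on ({0..1::real} \<times> {w. Im w > 0}) (\<lambda>p. if i \<in> S then c i + fst p else a i + fst p)" for i
          by (cases "i \<in> S") (auto intro!: continuous_intros)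
        then show ?thesis
          unfolding tilt_def by (intro continuous_intros)
      qed
      ultimately show "continuous_on ({0..1} \<times> {w. Im w > 0}) (\<lambda>(t, w). f t w)"
        unfolding f_def mixed_charpoly_def case_prod_beta by (intro continuous_intros)
      show "f t holomorphic_on {w. 0 < Im w}" for t
        unfolding f_def by (rule holomorphic_on_subset[OF mixed_hol]) auto
      show "inverse (real (Suc n)) \<in> {0..1}" for n
        by (simp add: inverse_le_1_iff)
      show "(\<lambda>n. inverse (real (Suc n))) \<longlonglongrightarrow> 0"
        by (rule LIMSEQ_inverse_real_of_nat)
      show "f (inverse (real (Suc n))) w \<noteq> 0" if "w \<in> {w. 0 < Im w}" for n w
        unfolding f_def using that nonneg by (intro mixed_real_rooted_pos) (auto intro!: add_nonneg_pos)
    qed (use w in auto)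
  qed
  show ?thesis
  proof (cases "Im y > 0")
    case True
    then show ?thesis
      using upper f0 by simp
  next
    case False
    then have "f 0 (cnj y) \<noteq> 0"
      using y by (intro upper) auto
    then show ?thesis
      using mixed_cnj[of "tilt V \<mu> a c" y] by (simp add: f0)
  qed
qed

end

section \<open>Selecting a set and bounding the mixed characteristic polynomial\<close>

context stable_pair
begin

lemma tilt_upd:
  assumes i: "i \<in> V"
  shows "tilt V \<mu> (a(i := x)) (c(i := y)) S =
    (if i \<in> S then y else x) * (\<mu> S * (\<Prod>j\<in>V - {i}. if j \<in> S then c j else a j))"
proof -
  have "(\<Prod>j\<in>V. if j \<in> S then (c(i := y)) j else (a(i := x)) j) =
     (if i \<in> S then (c(i := y)) i else (a(i := x)) i) *
     (\<Prod>j\<in>V - {i}. if j \<in> S then (c(i := y)) j else (a(i := x)) j)"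
    by (rule prod.remove[OF finV i])
  also have "(\<Prod>j\<in>V - {i}. if j \<in> S then (c(i := y)) j else (a(i := x)) j) =
      (\<Prod>j\<in>V - {i}. if j \<in> S then c j else a j)"
    by (intro prod.cong) auto
  finally show ?thesis
    by (simp add: tilt_def)
qed

lemma mixed_tilt_linear:
  assumes i: "i \<in> V"
  shows "mixed_charpoly V q (tilt V \<mu> (a(i := \<alpha> * s0 + \<beta> * s1)) (c(i := \<alpha> * t0 + \<beta> * t1))) y =
    of_real \<alpha> * mixed_charpoly V q (tilt V \<mu> (a(i := s0)) (c(i := t0))) y +
    of_real \<beta> * mixed_charpoly V q (tilt V \<mu> (a(i := s1)) (c(i := t1))) y"
proof -
  have "tilt V \<mu> (a(i := \<alpha> * s0 + \<beta> * s1)) (c(i := \<alpha> * t0 + \<beta> * t1)) S =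
     \<alpha> * tilt V \<mu> (a(i := s0)) (c(i := t0)) S + \<beta> * tilt V \<mu> (a(i := s1)) (c(i := t1)) S" for S
    unfolding tilt_upd[OF i] by (simp add: algebra_simps)
  then show ?thesis
    by (simp only: mixed_charpoly_def sum_distrib_left sum.distrib[symmetric])
       (intro sum.cong refl, simp add: algebra_simps)
qed

lemma mixed_tilt_split:
  assumes i: "i \<in> V" and split: "s0 + s1 = a i" "t0 + t1 = c i"
  shows "mixed_charpoly V q (tilt V \<mu> a c) y =
    mixed_charpoly V q (tilt V \<mu> (a(i := s0)) (c(i := t0))) y +
    mixed_charpoly V q (tilt V \<mu> (a(i := s1)) (c(i := t1))) y"
  using mixed_tilt_linear[OF i, of a 1 s0 1 s1 c t0 t1 y] split by simp

text \<open>Splitting the weight of element \<open>i\<close> splits the mixed characteristic polynomial; the convex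
  combinations of the two parts are again mixed characteristic polynomials.\<close>

lemma interlacing_step:
  fixes B :: real
  assumes nonneg: "\<And>i. i \<in> V \<Longrightarrow> a i \<ge> 0" "\<And>i. i \<in> V \<Longrightarrow> c i \<ge> 0" and i: "i \<in> V"
    and st: "s0 \<ge> 0" "t0 \<ge> 0" "s1 \<ge> 0" "t1 \<ge> 0" "s0 + s1 = a i" "t0 + t1 = c i"
    and pos: "\<And>y::real. y \<ge> B \<Longrightarrow> Re (mixed_charpoly V q (tilt V \<mu> a c) y) > 0"
    and B: "Re (mixed_charpoly V q (tilt V \<mu> (a(i := s0)) (c(i := t0))) B) > 0"
    and y: "y \<ge> B"
  shows "Re (mixed_charpoly V q (tilt V \<mu> (a(i := s0)) (c(i := t0))) (complex_of_real y)) > 0"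
proof -
  define f0 where "f0 = mixed_charpoly V q (tilt V \<mu> (a(i := s0)) (c(i := t0)))"
  define f1 where "f1 = mixed_charpoly V q (tilt V \<mu> (a(i := s1)) (c(i := t1)))"
  define s where "s t = (1 - t) * s0 + t * s1" for t
  define u where "u t = (1 - t) * t0 + t * t1" for t
  have combo: "of_real (1 - t) * f0 w + of_real t * f1 w =
      mixed_charpoly V q (tilt V \<mu> (a(i := s t)) (c(i := u t))) w" for t w
    unfolding f0_def f1_def s_def u_def by (rule mixed_tilt_linear[OF i, symmetric])
  have half: "f0 w + f1 w = mixed_charpoly V q (tilt V \<mu> a c) w" for w
    unfolding f0_def f1_def using mixed_tilt_split[OF i] st by metis
  have weights: "(a(i := s t)) j \<ge> 0" "(c(i := u t)) j \<ge> 0" if "0 \<le> t" "t \<le> 1/2" "j \<in> V" for t j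
    using that st nonneg by (auto simp: s_def u_def)
  have mass: "\<exists>S\<subseteq>V. tilt V \<mu> (a(i := s t)) (c(i := u t)) S > 0" if t: "0 \<le> t" "t \<le> 1/2" for t
  proof (rule ccontr)
    assume neg: "\<not> ?thesis"
    have "tilt V \<mu> (a(i := s t)) (c(i := u t)) S = 0" if "S \<subseteq> V" for S
    proof (rule antisym)
      show "tilt V \<mu> (a(i := s t)) (c(i := u t)) S \<le> 0"
        using neg that by (meson not_le)
      show "0 \<le> tilt V \<mu> (a(i := s t)) (c(i := u t)) S"
        using weights[OF t] by (rule tilt_nonneg)
    qed
    then have "of_real (1 - t) * f0 B + of_real t * f1 B = 0"
      unfolding combo by (simp add: mixed_charpoly_def)
    then have "(1 - t) * Re (f0 B) + t * Re (f1 B) = 0"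
      by (drule_tac arg_cong[where f = Re]) simp
    moreover have "(1 - t) * Re (f0 B) + t * Re (f1 B) = (1 - 2 * t) * Re (f0 B) + t * Re (f0 B + f1 B)"
      by (simp add: algebra_simps)
    moreover have "(1 - 2 * t) * Re (f0 B) + t * Re (f0 B + f1 B) > 0"
    proof (cases "t = 0")
      case False
      then show ?thesis
        using t B pos[of B] unfolding half f0_def[symmetric]
        by (intro add_nonneg_pos mult_nonneg_nonneg mult_pos_pos) auto
    qed (use B in \<open>simp add: f0_def\<close>)
    ultimately show False
      by simp
  qed
  have "Re (f0 (complex_of_real y)) > 0"
  proof (rule interlacing_choice[where ?f1.0 = f1 and B = B and Y = 2])
    show "f0 holomorphic_on UNIV" "f1 holomorphic_on UNIV"
      unfolding f0_def f1_def by (rule mixed_hol)+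
    show "f0 (complex_of_real y) \<in> \<real>" "f1 (complex_of_real y) \<in> \<real>" for y
      unfolding f0_def f1_def by (rule mixed_real)+
    show "0 < Re (f0 (complex_of_real B))"
      using B by (simp add: f0_def)
    show "0 < Re (f0 (complex_of_real y) + f1 (complex_of_real y))" if "B \<le> y" for y
      unfolding half using pos[OF that] .
    fix t :: real assume t: "0 \<le> t" "t \<le> 1/2"
    obtain S where S: "S \<subseteq> V" "tilt V \<mu> (a(i := s t)) (c(i := u t)) S > 0"
      using mass[OF t] by blast
    show "complex_of_real (1 - t) * f0 y + complex_of_real t * f1 y \<noteq> 0" if "Im y \<noteq> 0" for y
      unfolding combo using weights[OF t] by (intro mixed_real_rooted[OF _ _ S that])
    show "complex_of_real (1 - t) * f0 (complex_of_real y) + complex_of_real t * f1 (complex_of_real y) \<noteq> 0"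
      if "2 < y" for y
    proof -
      have "Re (mixed_charpoly V q (tilt V \<mu> (a(i := s t)) (c(i := u t))) (complex_of_real y)) > 0"
        using weights[OF t] by (intro mixed_pos[where m = "tilt V \<mu> (a(i := s t)) (c(i := u t))", OF _ S that] tilt_nonneg)
      then show ?thesis
        unfolding combo by auto
    qed
  qed (use y in auto)
  then show ?thesis
    by (simp add: f0_def)
qed

text \<open>Decide one element after the other. After the elements of \<open>A\<close> have been treated, the weights
  admit only sets that meet \<open>A\<close> in \<open>T\<close>.\<close>

lemma interlacing_selection:
  fixes B :: real
  assumes pos: "\<And>y::real. y \<ge> B \<Longrightarrow> Re (mixed_charpoly V q \<mu> y) > 0"
  shows "\<exists>S\<subseteq>V. \<mu> S > 0 \<and> (\<forall>y\<ge>B. Re (R S (complex_of_real y)) > 0)"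
proof -
  define f where "f A T y = Re (mixed_charpoly V q
    (tilt V \<mu> (\<lambda>i. if i \<in> T then 0 else 1) (\<lambda>i. if i \<in> A - T then 0 else 1)) (complex_of_real y))"
    for A T y
  have "\<exists>T\<subseteq>A. \<forall>y\<ge>B. f A T y > 0" if "finite A" "A \<subseteq> V" for A
    using that
  proof (induction A rule: finite_induct)
    case empty
    have "tilt V \<mu> (\<lambda>i. 1) (\<lambda>i. 1) = \<mu>"
      by (simp add: tilt_def fun_eq_iff)
    then show ?case
      using pos by (simp add: f_def)
  next
    case (insert x A)
    then obtain T where T: "T \<subseteq> A" "\<And>y. y \<ge> B \<Longrightarrow> f A T y > 0"
      by auto
    let ?a = "\<lambda>i. if i \<in> T then 0 else 1 :: real" and ?c = "\<lambda>i. if i \<in> A - T then 0 else 1 :: real"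
    have x: "x \<in> V" "x \<notin> T" "x \<notin> A - T"
      using insert T by auto
    have out: "f (insert x A) T y = Re (mixed_charpoly V q (tilt V \<mu> (?a(x := 1)) (?c(x := 0))) (complex_of_real y))" for y
    proof -
      have "(\<lambda>i. if i \<in> insert x A - T then 0 else 1) = ?c(x := 0)" "?a(x := 1) = ?a"
        using x by auto
      then show ?thesis
        unfolding f_def by (simp only:)
    qed
    have into: "f (insert x A) (insert x T) y =
        Re (mixed_charpoly V q (tilt V \<mu> (?a(x := 0)) (?c(x := 1))) (complex_of_real y))" for y
    proof -
      have "(\<lambda>i. if i \<in> insert x A - insert x T then 0 else 1) = ?c(x := 1)"
           "(\<lambda>i. if i \<in> insert x T then 0 else 1) = ?a(x := 0)"
        using x by auto
      then show ?thesis
        unfolding f_def by (simp only:)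
    qed
    have split: "f A T y = f (insert x A) T y + f (insert x A) (insert x T) y" for y
      unfolding out into unfolding f_def
      using mixed_tilt_split[OF x(1), of 1 0 ?a 0 1 ?c "complex_of_real y"] x by simp
    have pos': "\<And>y::real. y \<ge> B \<Longrightarrow> Re (mixed_charpoly V q (tilt V \<mu> ?a ?c) y) > 0"
      using T(2) by (simp add: f_def)
    consider "f (insert x A) T B > 0" | "f (insert x A) (insert x T) B > 0"
      using T(2)[of B] split[of B] by fastforce
    then show ?case
    proof cases
      case 1
      have "f (insert x A) T y > 0" if "y \<ge> B" for y
        unfolding out
        by (rule interlacing_step[where ?s1.0 = 0 and ?t1.0 = 1, OF _ _ x(1) _ _ _ _ _ _ pos' _ that])
           (use 1 x in \<open>auto simp: out\<close>)
      then show ?thesis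
        using T(1) by (intro exI[of _ T]) auto
    next
      case 2
      have "f (insert x A) (insert x T) y > 0" if "y \<ge> B" for y
        unfolding into
        by (rule interlacing_step[where ?s1.0 = 1 and ?t1.0 = 0, OF _ _ x(1) _ _ _ _ _ _ pos' _ that])
           (use 2 x in \<open>auto simp: into\<close>)
      then show ?thesis
        using T(1) by (intro exI[of _ "insert x T"]) auto
    qed
  qed
  from this[OF finV subset_refl] obtain T where T: "T \<subseteq> V" "\<And>y. y \<ge> B \<Longrightarrow> f V T y > 0"
    by auto
  have tilt_T: "tilt V \<mu> (\<lambda>i. if i \<in> T then 0 else 1) (\<lambda>i. if i \<in> V - T then 0 else 1) S =
      (if S = T then \<mu> T else 0)" if S: "S \<in> Pow V" for S
  proof (cases "S = T")
    case True
    then have eq: "(\<Prod>i\<in>V. if i \<in> S then (if i \<in> V - T then 0 else 1) else (if i \<in> T then 0 else 1 :: real)) = 1"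
      by (intro prod.neutral) auto
    then show ?thesis
      unfolding tilt_def eq using True by simp
  next
    case False
    then obtain j where "j \<in> V" "j \<in> S \<longleftrightarrow> j \<notin> T"
      using S T(1) by blast
    then have eq: "(\<Prod>i\<in>V. if i \<in> S then (if i \<in> V - T then 0 else 1) else (if i \<in> T then 0 else 1 :: real)) = 0"
      using finV by (intro prod_zero) auto
    then show ?thesis
      unfolding tilt_def eq using False by simp
  qed
  have f_T: "f V T y = \<mu> T * Re (R T (complex_of_real y))" for y
  proof -
    have "f V T y = Re (\<Sum>S\<in>Pow V. of_real (if S = T then \<mu> T else 0) * R S (complex_of_real y))"
      unfolding f_def mixed_charpoly_def by (intro arg_cong[where f = Re] sum.cong refl) (simp only: tilt_T)
    also have "\<dots> = Re (\<Sum>S\<in>Pow V. if S = T then of_real (\<mu> T) * R T (complex_of_real y) else 0)"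
      by (intro arg_cong[where f = Re] sum.cong refl) auto
    finally show ?thesis
      using T(1) finV by (simp add: sum.delta)
  qed
  have "\<mu> T > 0"
    using T(2)[of B] \<mu>_nonneg[of T] unfolding f_T by (cases "\<mu> T = 0") auto
  then show ?thesis
    using T unfolding f_T by (intro exI[of _ T]) (auto simp: zero_less_mult_iff)
qed

text \<open>The barrier with \<open>\<delta> = t\<close>, \<open>w = t/\<epsilon>\<close> and \<open>t = \<surd>y / 2\<close>, for which \<open>\<delta> w = t\<^sup>2/\<epsilon> \<ge> 2\<close> is exactly
  \<open>y \<ge> 8 \<epsilon>\<close>. The starting bound at \<open>t 1\<close> follows from the one at \<open>1\<close> by homogeneity and
  extends to the orthant above by monotonicity of logarithmic derivatives.\<close>

lemma mixed_charpoly_pos: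
  assumes eps: "\<epsilon>1 + \<epsilon>2 > 0"
    and marginals: "\<And>i. i \<in> V \<Longrightarrow> (\<Sum>S | S \<subseteq> V \<and> i \<in> S. \<mu> S) \<le> \<epsilon>1"
    and slopes: "\<And>i. i \<in> V \<Longrightarrow> Re (pd i q (\<lambda>_. 1)) \<le> \<epsilon>2 * Re (q (\<lambda>_. 1))"
    and y: "y \<ge> 8 * (\<epsilon>1 + \<epsilon>2)"
  shows "Re (mixed_charpoly V q \<mu> (complex_of_real y)) > 0"
proof -
  define \<epsilon> where "\<epsilon> = \<epsilon>1 + \<epsilon>2"
  have \<epsilon>: "\<epsilon> > 0"
    using eps by (simp add: \<epsilon>_def)
  define t where "t = sqrt y / 2"
  have y0: "y > 0"
    using y \<epsilon> by (simp add: \<epsilon>_def)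
  have t: "t > 0" "(2 * t)\<^sup>2 = y" "t * t \<ge> 2 * \<epsilon>"
  proof -
    show "t > 0" "(2 * t)\<^sup>2 = y"
      using y0 by (simp_all add: t_def)
    then show "t * t \<ge> 2 * \<epsilon>"
      using y by (simp add: \<epsilon>_def power2_eq_square)
  qed
  define w where "w = t / \<epsilon>"
  have w: "w > 0" "t * w \<ge> 2"
    using t \<epsilon> by (simp_all add: w_def field_simps)
  obtain xs where xs: "distinct xs" "set xs = V"
    using finite_distinct_list[OF finV] by blast
  have g: "stable_multiaffine V k g"
    unfolding g_eq by (rule genpoly_stable_multiaffine) (use g_stable g_eq \<mu>_hom in auto)
  have g_one: "g (\<lambda>_. 1) = 1"
    by (simp add: g_eq \<mu>_total flip: of_real_sum)
  let ?G = "\<lambda>z. g z * q z"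
  have G: "stable_quadratic V ?G"
    by (rule stable_quadratic_mult[OF g q])
  have g_sym: "g (\<lambda>i. cnj (z i)) = cnj (g z)" and g_aff: "i \<in> V \<Longrightarrow> affine_at i g"
    and g_hom: "g (\<lambda>i. c * z i) = c ^ k * g z" for z i c
    using g unfolding stable_multiaffine_def by blast+
  have Re_G: "Re (g (cvec r) * q (cvec r)) = Re (g (cvec r)) * Re (q (cvec r))" for r
  proof -
    have "g (cvec r) = of_real (Re (g (cvec r)))"
      by (rule real_at_cvec[of g, OF g_sym, symmetric])
    then have "Im (g (cvec r)) = 0"
      by (metis Im_complex_of_real)
    then show ?thesis
      by simp
  qed
  have G_pos: "Re (?G (cvec r)) > 0" if "\<And>i. i \<in> V \<Longrightarrow> r i > 0" for r
    unfolding Re_G using stable_multiaffine_pos[OF g _ that] stable_multiaffine_pos[OF q q_one that] g_one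
    by simp
  have pd_g: "pd i g (\<lambda>_. 1) = of_real (\<Sum>S | S \<subseteq> V \<and> i \<in> S. \<mu> S)" if i: "i \<in> V" for i
  proof -
    have prod: "(\<Prod>j\<in>S. ((\<lambda>_. 1)(i := u)) j) = (if i \<in> S then u else 1)" if "S \<in> Pow V" for S and u :: complex
    proof -
      have "(\<Prod>j\<in>S. ((\<lambda>_. 1)(i := u)) j) = (\<Prod>j\<in>S. if j = i then u else 1)"
        by (intro prod.cong) auto
      also have "\<dots> = (if i \<in> S then u else 1)"
        using that finV by (subst prod.delta) (auto intro: finite_subset)
      finally show ?thesis .
    qed
    have "pd i g (\<lambda>_. 1) = (\<Sum>S\<in>Pow V. of_real (\<mu> S) * (if i \<in> S then 1 else 0))"
      unfolding pd_def g_eq sum_subtractf[symmetric] sum_divide_distrib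
      by (intro sum.cong refl) (simp only: prod, simp)
    also have "\<dots> = (\<Sum>S\<in>Pow V. if i \<in> S then of_real (\<mu> S) else 0)"
      by (intro sum.cong) auto
    also have "\<dots> = (\<Sum>S\<in>{S\<in>Pow V. i \<in> S}. of_real (\<mu> S))"
      using finV by (subst sum.inter_filter) auto
    finally show ?thesis
      by simp
  qed
  have base: "t * Re (pd i ?G (\<lambda>_. of_real t)) \<le> \<epsilon> * Re (?G (\<lambda>_. of_real t))" if i: "i \<in> V" for i
  proof -
    have hom_g: "of_real t * pd i g (\<lambda>_. of_real t) = of_real t ^ k * pd i g (\<lambda>_. 1)"
      using pd_homogeneous[OF g_aff[OF i] g_hom, of "of_real t" "\<lambda>_. 1"] t by simp
    have hom_q: "of_real t * pd i q (\<lambda>_. of_real t) = of_real t ^ d * pd i q (\<lambda>_. 1)"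
      using pd_homogeneous[OF q_affine[OF i] q_hom, of "of_real t" "\<lambda>_. 1"] t by simp
    have val_g: "g (\<lambda>_. of_real t) = of_real t ^ k" and val_q: "q (\<lambda>_. of_real t) = of_real t ^ d * q (\<lambda>_. 1)"
      using g_hom[of "of_real t" "\<lambda>_. 1"] q_hom[of "of_real t" "\<lambda>_. 1"] g_one by simp_all
    have "of_real t * pd i ?G (\<lambda>_. of_real t) =
       (of_real t * pd i g (\<lambda>_. of_real t)) * q (\<lambda>_. of_real t) + g (\<lambda>_. of_real t) * (of_real t * pd i q (\<lambda>_. of_real t))"
      by (simp add: pd_mult[OF g_aff[OF i] q_affine[OF i]] algebra_simps)
    also have "\<dots> = of_real (t ^ (k + d)) * (pd i g (\<lambda>_. 1) * q (\<lambda>_. 1) + pd i q (\<lambda>_. 1))"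
      unfolding hom_g hom_q val_g val_q by (simp add: power_add algebra_simps)
    finally have "of_real t * pd i ?G (\<lambda>_. of_real t) =
       of_real (t ^ (k + d)) * (pd i g (\<lambda>_. 1) * q (\<lambda>_. 1) + pd i q (\<lambda>_. 1))" .
    from arg_cong[OF this, of Re]
    have "t * Re (pd i ?G (\<lambda>_. of_real t)) =
       t ^ (k + d) * ((\<Sum>S | S \<subseteq> V \<and> i \<in> S. \<mu> S) * Re (q (\<lambda>_. 1)) + Re (pd i q (\<lambda>_. 1)))"
      by (simp add: pd_g[OF i] del: of_real_power of_real_sum)
    also have "\<dots> \<le> t ^ (k + d) * (\<epsilon> * Re (q (\<lambda>_. 1)))"
    proof (rule mult_left_mono)
      have "(\<Sum>S | S \<subseteq> V \<and> i \<in> S. \<mu> S) * Re (q (\<lambda>_. 1)) \<le> \<epsilon>1 * Re (q (\<lambda>_. 1))"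
        using marginals[OF i] q_one by (intro mult_right_mono) auto
      then show "(\<Sum>S | S \<subseteq> V \<and> i \<in> S. \<mu> S) * Re (q (\<lambda>_. 1)) + Re (pd i q (\<lambda>_. 1)) \<le> \<epsilon> * Re (q (\<lambda>_. 1))"
        using slopes[OF i] by (simp add: \<epsilon>_def algebra_simps)
    qed (use t in simp)
    also have "\<dots> = \<epsilon> * Re (?G (\<lambda>_. of_real t))"
      unfolding val_g val_q by (simp add: power_add flip: of_real_power of_real_mult mult.assoc)
    finally show ?thesis .
  qed
  have "barrier V V w ?G (\<lambda>_. t)"
    unfolding barrier_def
  proof (intro ballI conjI)
    fix r assume r: "r \<in> above V (\<lambda>_. t)"
    show pos: "Re (?G (cvec r)) > 0"
      using r t by (intro G_pos) (force simp: above_def)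
    fix i assume i: "i \<in> V"
    have "Re (pd i ?G (cvec r)) / Re (?G (cvec r)) \<le> Re (pd i ?G (cvec (\<lambda>_. t))) / Re (?G (cvec (\<lambda>_. t)))"
    proof (rule log_derivative_antimono[OF G finV i _ r])
      show "Re (?G (cvec s)) > 0" if "s \<in> above V (\<lambda>_. t)" for s
        using that t by (intro G_pos) (force simp: above_def)
    qed
    also have "\<dots> \<le> 1 / w"
      using base[OF i] G_pos[of "\<lambda>_. t"] t \<epsilon> by (simp add: w_def field_simps)
    finally show "w * Re (pd i ?G (cvec r)) \<le> Re (?G (cvec r))"
      using pos w by (simp add: field_simps)
  qed
  from barrier_sub_pd2_list[OF G this w(1) t(1) w(2) xs(1)] xs(2)
  have "barrier V {} w (foldr sub_pd2 xs ?G) (\<lambda>i. if i \<in> V then t + t else t)"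
    by simp
  then have pos: "Re (foldr sub_pd2 xs ?G (cvec (\<lambda>i. if i \<in> V then t + t else t))) > 0"
    by (auto simp: barrier_def above_def)
  have "of_real (2 * t) ^ d * foldr sub_pd2 xs ?G (cvec (\<lambda>i. if i \<in> V then t + t else t)) =
      of_real (2 * t) ^ k * mixed_charpoly V q \<mu> ((of_real (2 * t))\<^sup>2)"
    unfolding g_eq using t by (intro sub_pd2_genpoly_mult[OF xs _ _ \<mu>_hom]) auto
  moreover have "(complex_of_real (2 * t))\<^sup>2 = of_real y"
    using t(2) by (metis of_real_power)
  ultimately have "of_real ((2 * t) ^ d) * foldr sub_pd2 xs ?G (cvec (\<lambda>i. if i \<in> V then t + t else t)) =
      of_real ((2 * t) ^ k) * mixed_charpoly V q \<mu> (of_real y)"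
    by (simp only: of_real_power)
  from arg_cong[OF this, of Re]
  have "(2 * t) ^ d * Re (foldr sub_pd2 xs ?G (cvec (\<lambda>i. if i \<in> V then t + t else t))) =
      (2 * t) ^ k * Re (mixed_charpoly V q \<mu> (of_real y))"
    by (simp only: Re_complex_of_real Im_complex_of_real times_complex.sel mult_zero_left diff_zero)
  moreover have "(2 * t) ^ d * Re (foldr sub_pd2 xs ?G (cvec (\<lambda>i. if i \<in> V then t + t else t))) > 0"
    using pos t by (intro mult_pos_pos) auto
  ultimately have "(2 * t) ^ k * Re (mixed_charpoly V q \<mu> (of_real y)) > 0"
    by simp
  moreover have "(2 * t) ^ k > 0"
    using t by simp
  ultimately show ?thesis
    by (rule zero_less_mult_pos)
qed

end

section \<open>Evaluation and eigenvalues of hyperbolic polynomials\<close>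

lemma mpsubst_homogeneous:
  assumes "homogeneous_of_degree d h"
  shows "mpsubst c (\<lambda>v. t * x v) h = t ^ d * mpsubst c x h"
  unfolding mpsubst_def sum_distrib_left
proof (intro sum.cong refl)
  fix a assume a: "a \<in> Poly_Mapping.keys h"
  have "(\<Prod>v\<in>Poly_Mapping.keys a. (t * x v) ^ Poly_Mapping.lookup a v) =
    (\<Prod>v\<in>Poly_Mapping.keys a. t ^ Poly_Mapping.lookup a v) *
    (\<Prod>v\<in>Poly_Mapping.keys a. x v ^ Poly_Mapping.lookup a v)"
    by (simp add: power_mult_distrib prod.distrib)
  also have "(\<Prod>v\<in>Poly_Mapping.keys a. t ^ Poly_Mapping.lookup a v) = t ^ d"
    using assms a by (simp add: power_sum[symmetric] homogeneous_of_degree_def)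
  finally show "c (Poly_Mapping.lookup h a) * (\<Prod>v\<in>Poly_Mapping.keys a. (t * x v) ^ Poly_Mapping.lookup a v) =
      t ^ d * (c (Poly_Mapping.lookup h a) * (\<Prod>v\<in>Poly_Mapping.keys a. x v ^ Poly_Mapping.lookup a v))"
    by (simp add: algebra_simps)
qed

lemma poly_mpsubst:
  "poly (mpsubst c x h) w = mpsubst (\<lambda>r. poly (c r) w) (\<lambda>v. poly (x v) w) h"
  by (simp add: mpsubst_def poly_sum poly_prod)

lemma mpsubst_cnj: "mpsubst complex_of_real (\<lambda>v. cnj (x v)) h = cnj (mpsubst complex_of_real x h)"
  by (simp add: mpsubst_def)

lemma mpsubst_of_real:
  "mpsubst complex_of_real (\<lambda>v. complex_of_real (x v)) h = complex_of_real (mpsubst (\<lambda>r. r) x h)"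
  by (simp add: mpsubst_def)

lemma continuous_on_mpsubst:
  assumes "\<And>v. continuous_on A (\<lambda>t. x t v)"
  shows "continuous_on A (\<lambda>t. mpsubst complex_of_real (x t) h)"
  unfolding mpsubst_def by (intro continuous_intros assms)

lemma holomorphic_on_mpsubst:
  assumes "\<And>v. (\<lambda>t. x t v) holomorphic_on A"
  shows "(\<lambda>t. mpsubst complex_of_real (x t) h) holomorphic_on A"
  unfolding mpsubst_def by (intro holomorphic_intros assms)

text \<open>Transfers identities between real polynomials to complex arguments.\<close>

lemma complex_poly_eqI_on_reals:
  fixes P Q :: "complex poly"
  assumes "\<And>t::real. poly P (of_real t) = poly Q (of_real t)"
  shows "P = Q"
proof (rule ccontr)
  assume "P \<noteq> Q"
  then have "finite {x. poly (P - Q) x = 0}"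
    by (intro poly_roots_finite) auto
  moreover have "range complex_of_real \<subseteq> {x. poly (P - Q) x = 0}"
    using assms by auto
  ultimately have "finite (range complex_of_real)"
    by (rule finite_subset[rotated])
  then show False
    using infinite_UNIV_char_0[where 'a = real] by (simp add: finite_image_iff inj_on_def)
qed

lemma poly_map_poly_of_real: "poly (map_poly complex_of_real p) (of_real t) = of_real (poly p t)"
  by (simp add: poly_altdef coeff_map_poly degree_map_poly)

lemma poly_hyp_charpoly_complex:
  "poly (map_poly complex_of_real (hyp_charpoly h e x)) z =
   mpsubst complex_of_real (\<lambda>m. z * of_real (e $ m) - of_real (x $ m)) h"
proof -
  define P where "P = mpsubst (\<lambda>r. [:complex_of_real r:]) (\<lambda>m. [:- of_real (x $ m), of_real (e $ m):]) h"
  have P: "poly P z = mpsubst complex_of_real (\<lambda>m. z * of_real (e $ m) - of_real (x $ m)) h" for z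
    by (simp add: P_def poly_mpsubst)
  have "map_poly complex_of_real (hyp_charpoly h e x) = P"
  proof (rule complex_poly_eqI_on_reals)
    fix t :: real
    have "poly P (of_real t) = mpsubst complex_of_real (\<lambda>m. of_real ((t *\<^sub>R e - x) $ m)) h"
      unfolding P by simp
    also have "\<dots> = of_real (poly (hyp_charpoly h e x) t)"
      by (simp only: mpsubst_of_real poly_hyp_charpoly)
    finally show "poly (map_poly complex_of_real (hyp_charpoly h e x)) (of_real t) = poly P (of_real t)"
      by (simp add: poly_map_poly_of_real)
  qed
  then show ?thesis
    using P by simp
qed

text \<open>By homogeneity \<open>h(t e - x) = t\<^sup>d k(1/t)\<close> with \<open>k(s) = h(e - s x)\<close> and \<open>k(0) = h(e) \<noteq> 0\<close>, so the
  characteristic polynomial is the reversal of \<open>k\<close> up to a power of \<open>t\<close>.\<close>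

lemma hyp_charpoly_degree:
  assumes "hyperbolic d h e"
  shows "degree (hyp_charpoly h e x) = d" "lead_coeff (hyp_charpoly h e x) = mpsubst (\<lambda>r. r) (($) e) h"
proof -
  let ?p = "hyp_charpoly h e x"
  have hom: "homogeneous_of_degree d h" and he: "mpsubst (\<lambda>r. r) (($) e) h > 0"
    using assms by (auto simp: hyperbolic_def)
  define k where "k = mpsubst (\<lambda>r. [:r:]) (\<lambda>v. [:e $ v, - (x $ v):]) h"
  have k: "poly k s = mpsubst (\<lambda>r. r) (\<lambda>v. e $ v - s * x $ v) h" for s
    by (simp add: k_def poly_mpsubst)
  have k0: "coeff k 0 = mpsubst (\<lambda>r. r) (($) e) h"
    using k[of 0] by (simp add: poly_0_coeff_0 cong: mpsubst_def)
  have rel: "poly ?p t = t ^ d * poly k (inverse t)" if "t \<noteq> 0" for t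
  proof -
    have "poly ?p t = mpsubst (\<lambda>r. r) (\<lambda>v. t * (e $ v - inverse t * x $ v)) h"
      unfolding poly_hyp_charpoly using that
      by (intro arg_cong2[where f = "mpsubst (\<lambda>r. r)"] ext) (auto simp: field_simps)
    then show ?thesis
      unfolding k by (simp only: mpsubst_homogeneous[OF hom])
  qed
  have "pCons 0 (monom 1 (degree k) * ?p - monom 1 d * reflect_poly k) = 0"
    unfolding poly_all_0_iff_0[symmetric]
  proof
    fix t
    show "poly (pCons 0 (monom 1 (degree k) * ?p - monom 1 d * reflect_poly k)) t = 0"
      by (cases "t = 0") (simp_all add: poly_monom rel poly_reflect_poly_nz)
  qed
  then have eq: "monom 1 (degree k) * ?p = monom 1 d * reflect_poly k"
    by simp
  have nz: "reflect_poly k \<noteq> 0" "coeff k 0 \<noteq> 0"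
    using he k0 by auto
  have pnz: "?p \<noteq> 0"
    using eq nz by auto
  have "degree k + degree ?p = d + degree (reflect_poly k)"
    using arg_cong[OF eq, of degree] nz pnz by (simp add: degree_mult_eq degree_monom_eq)
  then show "degree ?p = d"
    using degree_reflect_poly_eq[OF nz(2)] by simp
  show "lead_coeff ?p = mpsubst (\<lambda>r. r) (($) e) h"
    using arg_cong[OF eq, of lead_coeff] degree_reflect_poly_eq[OF nz(2)] k0
    by (simp add: lead_coeff_mult coeff_reflect_poly degree_monom_eq)
qed

lemma real_rooted_factorization:
  fixes p :: "real poly"
  assumes "p \<noteq> 0" "\<And>z. poly (map_poly complex_of_real p) z = 0 \<Longrightarrow> z \<in> \<real>"
  shows "p = smult (lead_coeff p) (\<Prod>r\<in>#proots p. [:- r, 1:]) \<and> size (proots p) = degree p"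
  using assms
proof (induction "degree p" arbitrary: p)
  case 0
  then obtain c where "p = [:c:]"
    using degree_eq_zeroE by metis
  then show ?case
    by simp
next
  case (Suc n)
  have "degree (map_poly complex_of_real p) = Suc n"
    using Suc.hyps(2) by (simp add: degree_map_poly)
  then obtain z where z: "poly (map_poly complex_of_real p) z = 0"
    using alg_closed_imp_poly_has_root[of "map_poly complex_of_real p"] by auto
  then obtain r where "z = of_real r"
    using Suc.prems(2) by (metis Reals_cases)
  with z have "poly p r = 0"
    by (simp add: poly_map_poly_of_real)
  then obtain q where q: "p = [:- r, 1:] * q"
    by (auto simp: poly_eq_0_iff_dvd)
  have q0: "q \<noteq> 0"
    using Suc.prems(1) q by auto
  have deg: "degree q = n"
    using Suc.hyps(2) degree_mult_eq[of "[:- r, 1:]" q] q0 unfolding q by auto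
  have lc: "lead_coeff p = lead_coeff q"
    unfolding q lead_coeff_mult by simp
  have "z \<in> \<real>" if "poly (map_poly complex_of_real q) z = 0" for z
  proof (rule Suc.prems(2))
    have "map_poly complex_of_real p = [:- of_real r, 1:] * map_poly complex_of_real q"
      by (rule complex_poly_eqI_on_reals) (simp only: poly_map_poly_of_real poly_mult, simp add: q poly_map_poly_of_real algebra_simps)
    then show "poly (map_poly complex_of_real p) z = 0"
      using that by simp
  qed
  from Suc.hyps(1)[OF deg[symmetric] q0 this]
  have IH: "q = smult (lead_coeff q) (\<Prod>r\<in>#proots q. [:- r, 1:])" "size (proots q) = degree q"
    by blast+
  have pr: "proots p = add_mset r (proots q)"
    unfolding q using q0 by (subst proots_mult) auto
  have "p = [:- r, 1:] * smult (lead_coeff q) (\<Prod>r\<in>#proots q. [:- r, 1:])"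
    using q IH(1) by simp
  then have "p = smult (lead_coeff p) (\<Prod>r\<in>#proots p. [:- r, 1:])"
    unfolding pr lc by (simp only: image_mset_add_mset prod_mset.add_mset mult_smult_right)
  moreover have "size (proots p) = degree p"
    using IH(2) deg Suc.hyps(2) by (simp add: pr)
  ultimately show ?case
    by blast
qed

lemma hyperbolic_factorization:
  assumes "hyperbolic d h e"
  shows "hyp_charpoly h e x = smult (mpsubst (\<lambda>r. r) (($) e) h) (\<Prod>r\<in>#proots (hyp_charpoly h e x). [:- r, 1:])"
    and "size (proots (hyp_charpoly h e x)) = d"
proof -
  have "hyp_charpoly h e x \<noteq> 0"
    using hyp_charpoly_degree(2)[OF assms, of x] assms by (auto simp: hyperbolic_def)
  then have "hyp_charpoly h e x = smult (lead_coeff (hyp_charpoly h e x)) (\<Prod>r\<in>#proots (hyp_charpoly h e x). [:- r, 1:])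
     \<and> size (proots (hyp_charpoly h e x)) = degree (hyp_charpoly h e x)"
    using assms by (intro real_rooted_factorization) (auto simp: hyperbolic_def)
  then show "hyp_charpoly h e x = smult (mpsubst (\<lambda>r. r) (($) e) h) (\<Prod>r\<in>#proots (hyp_charpoly h e x). [:- r, 1:])"
    and "size (proots (hyp_charpoly h e x)) = d"
    using hyp_charpoly_degree[OF assms, of x] by simp_all
qed

definition eigenvalue_list :: "'m rmpoly \<Rightarrow> real ^ 'm \<Rightarrow> real ^ 'm \<Rightarrow> real list" where
  "eigenvalue_list h e x = rev (sorted_list_of_multiset (proots (hyp_charpoly h e x)))"

lemma mset_eigenvalue_list: "mset (eigenvalue_list h e x) = proots (hyp_charpoly h e x)"
  by (simp add: eigenvalue_list_def)

lemma length_eigenvalue_list: "hyperbolic d h e \<Longrightarrow> length (eigenvalue_list h e x) = d"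
  using hyperbolic_factorization(2) by (metis mset_eigenvalue_list size_mset)

lemma hyp_eigenvalue_nth: "hyp_eigenvalue h e x (Suc j) = eigenvalue_list h e x ! j"
  by (simp add: hyp_eigenvalue_def eigenvalue_list_def)

lemma hyp_eigenvalue_image:
  assumes "hyperbolic d h e"
  shows "hyp_eigenvalue h e x ` {1..d} = set_mset (proots (hyp_charpoly h e x))"
proof -
  have "hyp_eigenvalue h e x ` {1..d} = (\<lambda>j. hyp_eigenvalue h e x (Suc j)) ` {..<d}"
    by (simp only: image_Suc_lessThan[symmetric] image_image)
  also have "\<dots> = set (eigenvalue_list h e x)"
    using length_eigenvalue_list[OF assms, of x] by (auto simp: hyp_eigenvalue_nth set_conv_nth)
  finally show ?thesis
    by (metis mset_eigenvalue_list set_mset_mset)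
qed

lemma hyp_norm_le_iff:
  assumes "hyperbolic d h e" "d \<ge> 1"
  shows "hyp_norm d h e x \<le> B \<longleftrightarrow> (\<forall>r. poly (hyp_charpoly h e x) r = 0 \<longrightarrow> \<bar>r\<bar> \<le> B)"
proof -
  have nz: "hyp_charpoly h e x \<noteq> 0"
    using hyp_charpoly_degree(2)[OF assms(1), of x] assms by (auto simp: hyperbolic_def)
  have "(\<lambda>i. \<bar>hyp_eigenvalue h e x i\<bar>) ` {1..d} = abs ` (hyp_eigenvalue h e x ` {1..d})"
    by (simp add: image_image)
  also have "\<dots> = abs ` {r. poly (hyp_charpoly h e x) r = 0}"
    unfolding hyp_eigenvalue_image[OF assms(1)] using nz by simp
  finally have eq: "(\<lambda>i. \<bar>hyp_eigenvalue h e x i\<bar>) ` {1..d} = abs ` {r. poly (hyp_charpoly h e x) r = 0}" .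
  have "hyp_norm d h e x \<le> B \<longleftrightarrow> (\<forall>a \<in> (\<lambda>i. \<bar>hyp_eigenvalue h e x i\<bar>) ` {1..d}. a \<le> B)"
    unfolding hyp_norm_def using assms(2) by (intro Max_le_iff) auto
  then show ?thesis
    unfolding eq by auto
qed

lemma hyp_cone_roots_nonneg:
  assumes hyp: "hyperbolic d h e" and d: "d \<ge> 1" and x: "x \<in> hyp_cone d h e"
    and r: "r \<in># proots (hyp_charpoly h e x)"
  shows "r \<ge> 0"
proof -
  define L where "L = sorted_list_of_multiset (proots (hyp_charpoly h e x))"
  have len: "length L = d"
    using length_eigenvalue_list[OF hyp, of x] by (simp add: eigenvalue_list_def L_def)
  have "hyp_eigenvalue h e x d = rev L ! (d - 1)"
    by (simp add: hyp_eigenvalue_def L_def)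
  also have "\<dots> = L ! 0"
    using len d by (simp add: rev_nth)
  finally have "L ! 0 \<ge> 0"
    using x by (simp add: hyp_cone_def)
  moreover obtain j where "j < length L" "r = L ! j"
    using r by (metis L_def in_set_conv_nth set_sorted_list_of_multiset)
  moreover have "sorted L"
    by (simp add: L_def)
  ultimately show ?thesis
    by (metis le0 order_trans sorted_nth_mono)
qed

lemma rank_one_roots:
  assumes hyp: "hyperbolic d h e" and d: "d \<ge> 1" and rank: "hyp_rank d h e x \<le> 1"
  shows "\<exists>l. proots (hyp_charpoly h e x) = add_mset l (replicate_mset (d - 1) 0)"
proof -
  define L where "L = eigenvalue_list h e x"
  have len: "length L = d"
    using length_eigenvalue_list[OF hyp, of x] by (simp add: L_def)
  have A: "mset L = proots (hyp_charpoly h e x)"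
    by (simp add: L_def mset_eigenvalue_list)
  have "{i \<in> {1..d}. hyp_eigenvalue h e x i \<noteq> 0} = Suc ` {j. j < length L \<and> L ! j \<noteq> 0}"
  proof (intro equalityI subsetI)
    fix i assume i: "i \<in> {i \<in> {1..d}. hyp_eigenvalue h e x i \<noteq> 0}"
    then obtain j where "i = Suc j"
      by (cases i) auto
    then show "i \<in> Suc ` {j. j < length L \<and> L ! j \<noteq> 0}"
      using i len by (auto simp: hyp_eigenvalue_nth L_def)
  qed (use len in \<open>auto simp: hyp_eigenvalue_nth L_def\<close>)
  then have "hyp_rank d h e x = card {j. j < length L \<and> L ! j \<noteq> 0}"
    by (simp add: hyp_rank_def card_image)
  also have "\<dots> = length (filter (\<lambda>r. r \<noteq> 0) L)"
    by (simp add: length_filter_conv_card)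
  finally have size: "size (filter_mset (\<lambda>r. r \<noteq> 0) (mset L)) \<le> 1"
    using rank by (metis mset_filter size_mset)
  have "filter_mset (\<lambda>r. \<not> r \<noteq> 0) (mset L) = replicate_mset (count (mset L) 0) 0"
    by (intro multiset_eqI) auto
  then have split: "mset L = filter_mset (\<lambda>r. r \<noteq> 0) (mset L) + replicate_mset (count (mset L) 0) 0"
    using multiset_partition[of "mset L" "\<lambda>r. r \<noteq> 0"] by (simp only:)
  show ?thesis
  proof (cases "size (filter_mset (\<lambda>r. r \<noteq> 0) (mset L)) = 0")
    case True
    then have empty: "filter_mset (\<lambda>r. r \<noteq> 0) (mset L) = {#}"
      by (simp only: size_eq_0_iff_empty)
    have "mset L = replicate_mset (count (mset L) 0) 0"
      by (rule split[unfolded empty add_0_left])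
    moreover from arg_cong[OF this, of size] have "count (mset L) 0 = d"
      using len by simp
    ultimately have "mset L = replicate_mset (Suc (d - 1)) 0"
      using d by simp
    then have "proots (hyp_charpoly h e x) = add_mset 0 (replicate_mset (d - 1) 0)"
      by (simp only: A replicate_mset_Suc)
    then show ?thesis
      by (rule exI)
  next
    case False
    with size have "size (filter_mset (\<lambda>r. r \<noteq> 0) (mset L)) = 1"
      by linarith
    then obtain l where l: "filter_mset (\<lambda>r. r \<noteq> 0) (mset L) = {#l#}"
      using size_1_singleton_mset by blast
    have eq: "mset L = {#l#} + replicate_mset (count (mset L) 0) 0"
      by (rule split[unfolded l])
    from arg_cong[OF this, of size] have "count (mset L) 0 = d - 1"
      using len by simp
    then show ?thesis
      using eq A by auto
  qed
qed

section \<open>Sums of rank-one vectors give stable multiaffine polynomials\<close>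

text \<open>For a rank-one vector \<open>x\<close> of the cone the restriction of \<open>h\<close> to the plane of \<open>e\<close> and \<open>x\<close> is
  explicit. The formula stands in for cone membership and rank in what follows.\<close>

lemma rank_one_eval:
  fixes h :: "('m::finite) rmpoly"
  assumes hyp: "hyperbolic d h e" and d: "d \<ge> 1" and cone: "x \<in> hyp_cone d h e"
    and rank: "hyp_rank d h e x \<le> 1" and norm: "hyp_norm d h e x \<le> \<epsilon>"
  shows "\<exists>l. 0 \<le> l \<and> l \<le> \<epsilon> \<and> (\<forall>s w. mpsubst complex_of_real (\<lambda>m. s * of_real (e $ m) + w * of_real (x $ m)) h =
           of_real (mpsubst (\<lambda>r. r) (($) e) h) * s ^ (d - 1) * (s + of_real l * w))"
proof -
  define he where "he = mpsubst (\<lambda>r. r) (($) e) h"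
  have hom: "homogeneous_of_degree d h"
    using hyp by (simp add: hyperbolic_def)
  obtain l where l: "proots (hyp_charpoly h e x) = add_mset l (replicate_mset (d - 1) 0)"
    using rank_one_roots[OF hyp d rank] by blast
  have "l \<in># proots (hyp_charpoly h e x)"
    by (simp add: l)
  moreover have "hyp_charpoly h e x \<noteq> 0"
    using hyp_charpoly_degree(2)[OF hyp, of x] hyp by (auto simp: hyperbolic_def)
  ultimately have root: "poly (hyp_charpoly h e x) l = 0"
    by simp
  have "l \<ge> 0"
    by (rule hyp_cone_roots_nonneg[OF hyp d cone]) (simp add: l)
  moreover have "l \<le> \<epsilon>"
    using norm root unfolding hyp_norm_le_iff[OF hyp d] by auto
  moreover have "mpsubst complex_of_real (\<lambda>m. s * of_real (e $ m) + w * of_real (x $ m)) h =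
      of_real he * s ^ (d - 1) * (s + of_real l * w)" for s w
  proof -
    have char: "mpsubst complex_of_real (\<lambda>m. z * of_real (e $ m) - of_real (x $ m)) h =
        of_real he * z ^ (d - 1) * (z - of_real l)" for z
    proof -
      have "hyp_charpoly h e x = smult he (\<Prod>r\<in>#proots (hyp_charpoly h e x). [:- r, 1:])"
        unfolding he_def by (rule hyperbolic_factorization(1)[OF hyp])
      then have p: "hyp_charpoly h e x = smult he ([:- l, 1:] * [:0, 1:] ^ (d - 1))"
        unfolding l by (simp add: image_replicate_mset)
      define P where "P = smult (complex_of_real he) ([:- of_real l, 1:] * [:0, 1:] ^ (d - 1))"
      have "map_poly complex_of_real (hyp_charpoly h e x) = P"
        by (rule complex_poly_eqI_on_reals) (simp add: poly_map_poly_of_real p P_def)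
      then show ?thesis
        using poly_hyp_charpoly_complex[of h e x z] by (simp add: P_def algebra_simps)
    qed
    show ?thesis
    proof (cases "w = 0")
      case True
      have "mpsubst complex_of_real (\<lambda>m. s * of_real (e $ m)) h = s ^ d * of_real he"
        by (simp only: mpsubst_homogeneous[OF hom] mpsubst_of_real he_def)
      then show ?thesis
        using True d by (simp add: power_eq_if)
    next
      case False
      have "mpsubst complex_of_real (\<lambda>m. s * of_real (e $ m) + w * of_real (x $ m)) h =
          mpsubst complex_of_real (\<lambda>m. (- w) * ((- s / w) * of_real (e $ m) - of_real (x $ m))) h"
        using False by (intro arg_cong2[where f = "mpsubst complex_of_real"] ext) (auto simp: field_simps)
      also have "\<dots> = (- w) ^ d * (of_real he * (- s / w) ^ (d - 1) * (- s / w - of_real l))"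
        by (simp only: mpsubst_homogeneous[OF hom] char)
      also have "(- w) ^ d = (- w) ^ (d - 1) * (- w)"
        using d by (simp add: power_eq_if)
      also have "(- w) ^ (d - 1) * (- w) * (of_real he * (- s / w) ^ (d - 1) * (- s / w - of_real l)) =
          of_real he * ((- w) * (- s / w)) ^ (d - 1) * ((- w) * (- s / w - of_real l))"
        by (simp only: power_mult_distrib mult_ac)
      also have "\<dots> = of_real he * s ^ (d - 1) * (s + of_real l * w)"
        using False by (simp add: field_simps)
      finally show ?thesis .
    qed
  qed
  ultimately show ?thesis
    unfolding he_def by blast
qed

text \<open>Here \<open>l i\<close> is the only eigenvalue of \<open>v i\<close> that may be nonzero.\<close>

locale rank_one_vectors =
  fixes d :: nat and h :: "('m::finite) rmpoly" and e :: "real ^ 'm" and V :: "'v set"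
    and v :: "'v \<Rightarrow> real ^ 'm" and l :: "'v \<Rightarrow> real" and he :: real
  assumes hyp: "hyperbolic d h e" and finV: "finite V" and sum_v: "(\<Sum>i\<in>V. v i) = e"
    and he_eq: "he = mpsubst (\<lambda>r. r) (($) e) h"
    and l_nonneg: "\<And>i. i \<in> V \<Longrightarrow> l i \<ge> 0"
    and eval: "\<And>i s w. i \<in> V \<Longrightarrow>
      mpsubst complex_of_real (\<lambda>m. s * of_real (e $ m) + w * of_real (v i $ m)) h =
      of_real he * s ^ (d - 1) * (s + of_real (l i) * w)"
begin

abbreviation H where "H u \<equiv> mpsubst complex_of_real u h"

abbreviation ec where "ec m \<equiv> complex_of_real (e $ m)"

abbreviation vc where "vc i m \<equiv> complex_of_real (v i $ m)"

lemma he_pos: "he > 0"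
  using hyp by (simp add: he_eq hyperbolic_def)

lemma H_hom: "H (\<lambda>m. t * u m) = t ^ d * H u"
  by (rule mpsubst_homogeneous) (use hyp in \<open>simp add: hyperbolic_def\<close>)

lemma H_real_shift: "Im s \<noteq> 0 \<Longrightarrow> H (\<lambda>m. of_real (x m) + s * ec m) \<noteq> 0"
proof
  assume s: "Im s \<noteq> 0" and "H (\<lambda>m. of_real (x m) + s * ec m) = 0"
  then have "poly (map_poly complex_of_real (hyp_charpoly h e (\<chi> m. - x m))) s = 0"
    unfolding poly_hyp_charpoly_complex by (simp add: add.commute)
  then have "s \<in> \<real>"
    using hyp unfolding hyperbolic_def by blast
  then show False
    using s by (simp add: complex_is_Real_iff)
qed

text \<open>The analogue of Garding's theorem that hyperbolicity extends from \<open>e\<close> to the cone. Scale the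
  vector \<open>Y\<close> by \<open>\<theta>\<close> from 0 to 1 and regard the expression as a polynomial in \<open>w\<close>: for \<open>\<theta> = 0\<close>
  the rank-one formula excludes zeros in the upper half-plane, and on the real axis \<open>w v\<^sub>i\<close> is
  just another real vector. To keep zeros from coming in from infinity, \<open>v\<^sub>i\<close> is replaced by
  \<open>v\<^sub>i + \<eta> e\<close>, at which \<open>h\<close> does not vanish; this is compensated in the coefficient of \<open>e\<close>.\<close>

lemma H_add_direction:
  assumes Y: "\<And>(x :: 'm \<Rightarrow> real) \<theta> s. 0 \<le> \<theta> \<Longrightarrow> \<theta> \<le> 1 \<Longrightarrow> Im s > 0 \<Longrightarrow>
      H (\<lambda>m. of_real (x m) + of_real \<theta> * Y m + s * ec m) \<noteq> 0"
    and i: "i \<in> V" and s: "Im s > 0" and w: "Im w > 0"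
  shows "H (\<lambda>m. Y m + s * ec m + w * vc i m) \<noteq> 0"
proof -
  define \<eta> where "\<eta> = Im s / (2 * Im w)"
  have \<eta>: "\<eta> > 0"
    using s w by (simp add: \<eta>_def)
  define s' where "s' = s - of_real \<eta> * w"
  have s': "Im s' > 0"
    using s w by (simp add: s'_def \<eta>_def)
  define f where "f \<theta> u = H (\<lambda>m. of_real \<theta> * Y m + s' * ec m + u * (of_real \<eta> * ec m + vc i m))"
    for \<theta> :: real and u
  define K where "K p = H (\<lambda>m. of_real \<eta> * ec m + vc i m + snd p * (of_real (fst p) * Y m + s' * ec m))"
    for p :: "real \<times> complex"
  define c where "c = he * \<eta> ^ (d - 1) * (\<eta> + l i)"
  have K0: "K (\<theta>, 0) = of_real c" for \<theta>
    using eval[OF i, of "of_real \<eta>" 1] by (simp add: K_def c_def)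
  have c: "c > 0"
    unfolding c_def using he_pos \<eta> l_nonneg[OF i] by (intro mult_pos_pos) auto
  have "continuous_on ({0..1} \<times> cball 0 1) K"
    unfolding K_def by (intro continuous_on_mpsubst continuous_intros)
  then have "uniformly_continuous_on ({0..1} \<times> cball 0 1) K"
    by (intro compact_uniformly_continuous compact_Times) auto
  then obtain \<delta> where \<delta>: "\<delta> > 0" "\<And>p p'. p \<in> {0..1} \<times> cball 0 1 \<Longrightarrow> p' \<in> {0..1} \<times> cball 0 1 \<Longrightarrow>
      dist p' p < \<delta> \<Longrightarrow> dist (K p') (K p) < c"
    unfolding uniformly_continuous_on_def using c by meson
  \<comment> \<open>as \<open>f \<theta> u = u\<^sup>d K (\<theta>, 1/u)\<close>, zeros of \<open>f\<close> far out correspond to zeros of \<open>K\<close> near \<open>(\<theta>, 0)\<close>\<close>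
  define R where "R = max 1 (2 / \<delta>)"
  have bound: "norm u \<le> R" if \<theta>: "\<theta> \<in> {0..1}" and z: "f \<theta> u = 0" for \<theta> u
  proof (rule ccontr)
    assume "\<not> norm u \<le> R"
    then have u: "norm u > 1" "norm u > 2 / \<delta>"
      by (auto simp: R_def)
    have u0: "u \<noteq> 0"
      using u(1) by auto
    have "f \<theta> u = H (\<lambda>m. u * (of_real \<eta> * ec m + vc i m + inverse u * (of_real \<theta> * Y m + s' * ec m)))"
      unfolding f_def using u0
      by (intro arg_cong2[where f = "mpsubst complex_of_real"] ext) (auto simp: field_simps)
    also have "\<dots> = u ^ d * K (\<theta>, inverse u)"
      unfolding H_hom K_def by simp
    finally have "K (\<theta>, inverse u) = 0"
      using z u0 by simp
    moreover have "dist (K (\<theta>, inverse u)) (K (\<theta>, 0)) < c"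
    proof (rule \<delta>(2))
      have "norm (inverse u) < 1"
        using u(1) by (simp add: norm_inverse inverse_less_1_iff)
      then show "(\<theta>, inverse u) \<in> {0..1} \<times> cball 0 1"
        using \<theta> by simp
      have "norm (inverse u) < \<delta>"
      proof -
        have "2 < \<delta> * norm u"
          using u(2) \<delta>(1) by (simp add: field_simps)
        then have "1 < \<delta> * norm u"
          by linarith
        then have "1 / norm u < \<delta>"
          using u(1) by (simp add: pos_divide_less_eq u0)
        then show ?thesis
          unfolding norm_inverse by (simp only: inverse_eq_divide)
      qed
      then show "dist (\<theta>, inverse u) (\<theta>, 0) < \<delta>"
        by (simp add: dist_Pair_Pair)
    qed (use \<theta> in auto)
    ultimately show False
      using c by (simp add: K0 dist_norm)
  qed
  have "f 1 w \<noteq> 0"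
  proof (rule zero_free_homotopy[where U = "{u. Im u > 0}" and f = f and R = R])
    show "open {u. Im u > 0}"
      by (rule open_halfspace_Im_gt)
    show "connected {u. Im u > 0}"
      by (intro convex_connected convex_halfspace_Im_gt)
    show "continuous_on ({0..1} \<times> UNIV) (\<lambda>(\<theta>, u). f \<theta> u)"
      unfolding f_def case_prod_beta by (intro continuous_on_mpsubst continuous_intros)
    show "f \<theta> holomorphic_on UNIV" for \<theta>
      unfolding f_def by (intro holomorphic_on_mpsubst holomorphic_intros)
    fix \<theta> :: real assume \<theta>: "\<theta> \<in> {0..1}"
    show "norm u \<le> R" if "f \<theta> u = 0" for u
      using bound[OF \<theta> that] .
    show "f \<theta> u \<noteq> 0" if "u \<in> frontier {u. Im u > 0}" for u
    proof -
      have "closure {u. Im u > 0} \<subseteq> {u. Im u \<ge> 0}"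
        by (intro closure_minimal closed_halfspace_Im_ge) auto
      then have "Im u = 0"
        using that open_halfspace_Im_gt[of 0] by (auto simp: frontier_def interior_open)
      then have u: "u = of_real (Re u)"
        by (simp add: complex_eq_iff)
      have "f \<theta> u = H (\<lambda>m. of_real (Re u * (\<eta> * e $ m + v i $ m)) + of_real \<theta> * Y m + s' * ec m)"
        unfolding f_def by (subst u, intro arg_cong2[where f = "mpsubst complex_of_real"] ext) auto
      then show ?thesis
        using Y[of \<theta> s' "\<lambda>m. Re u * (\<eta> * e $ m + v i $ m)"] \<theta> s' by simp
    qed
    show "\<exists>u\<in>{u. Im u > 0}. f \<theta> u \<noteq> 0"
    proof (intro bexI[of _ "\<i> * of_real (R + 1)"] notI)
      assume "f \<theta> (\<i> * of_real (R + 1)) = 0"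
      from bound[OF \<theta> this] show False
        by (simp add: norm_mult R_def)
    qed (simp add: R_def)
  next
    show "f 0 u \<noteq> 0" if "u \<in> {u. Im u > 0}" for u
    proof
      assume f0: "f 0 u = 0"
      define X where "X = s' + of_real \<eta> * u"
      have pos: "Im X > 0"
        using s' \<eta> that by (simp add: X_def add_pos_nonneg)
      then have X: "X \<noteq> 0"
        by auto
      have "f 0 u = H (\<lambda>m. X * ec m + u * vc i m)"
        unfolding f_def X_def
        by (intro arg_cong2[where f = "mpsubst complex_of_real"] ext) (auto simp: algebra_simps)
      also have "\<dots> = of_real he * X ^ (d - 1) * (X + of_real (l i) * u)"
        by (rule eval[OF i])
      finally have "X + of_real (l i) * u = 0"
        using f0 X he_pos by simp
      moreover have "Im (X + of_real (l i) * u) > 0"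
        using pos l_nonneg[OF i] that by (simp add: add_pos_nonneg)
      ultimately show False
        by simp
    qed
  qed (use w in auto)
  moreover have "f 1 w = H (\<lambda>m. Y m + s * ec m + w * vc i m)"
    unfolding f_def s'_def by (intro arg_cong2[where f = "mpsubst complex_of_real"] ext) (auto simp: algebra_simps)
  ultimately show ?thesis
    by simp
qed

text \<open>Adding the vectors one at a time; a real multiple is absorbed into \<open>x\<close>.\<close>

lemma H_stable_aux:
  assumes "finite A" "A \<subseteq> V" "Im s > 0" "\<And>i. i \<in> A \<Longrightarrow> Im (w i) \<ge> 0"
  shows "H (\<lambda>m. of_real (x m) + (\<Sum>i\<in>A. w i * vc i m) + s * ec m) \<noteq> 0"
  using assms
proof (induction A arbitrary: x s w rule: finite_induct)
  case empty
  then show ?case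
    using H_real_shift[of s x] by simp
next
  case (insert a A)
  define Y where "Y m = of_real (x m) + (\<Sum>i\<in>A. w i * vc i m)" for m
  have expand: "(\<lambda>m. of_real (x m) + (\<Sum>i\<in>insert a A. w i * vc i m) + s * ec m) = (\<lambda>m. Y m + s * ec m + w a * vc a m)"
    using insert.hyps by (auto simp: Y_def)
  show ?case
  proof (cases "Im (w a) = 0")
    case True
    then have wa: "w a = of_real (Re (w a))"
      by (simp add: complex_eq_iff)
    have "(\<lambda>m. Y m + s * ec m + w a * vc a m) =
        (\<lambda>m. of_real (x m + Re (w a) * v a $ m) + (\<Sum>i\<in>A. w i * vc i m) + s * ec m)"
      by (subst wa) (auto simp: Y_def)
    then show ?thesis
      unfolding expand using insert.IH[of s w "\<lambda>m. x m + Re (w a) * v a $ m"] insert.prems by simp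
  next
    case False
    show ?thesis
      unfolding expand
    proof (rule H_add_direction)
      fix x' :: "'m \<Rightarrow> real" and \<theta> :: real and s' :: complex
      assume \<theta>: "0 \<le> \<theta>" "\<theta> \<le> 1" and s': "Im s' > 0"
      have "(\<lambda>m. of_real (x' m) + of_real \<theta> * Y m + s' * ec m) =
          (\<lambda>m. of_real (x' m + \<theta> * x m) + (\<Sum>i\<in>A. (of_real \<theta> * w i) * vc i m) + s' * ec m)"
        by (auto simp: Y_def algebra_simps sum_distrib_left)
      then show "H (\<lambda>m. of_real (x' m) + of_real \<theta> * Y m + s' * ec m) \<noteq> 0"
        using insert.IH[of s' "\<lambda>i. of_real \<theta> * w i" "\<lambda>m. x' m + \<theta> * x m"] insert.prems \<theta> s'
        by simp
    qed (use insert.prems False in \<open>auto simp: less_le\<close>)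
  qed
qed

definition q :: "('v \<Rightarrow> complex) \<Rightarrow> complex" where
  "q z = H (\<lambda>m. \<Sum>i\<in>V. z i * vc i m)"

lemma sum_vc: "(\<Sum>i\<in>V. vc i m) = ec m"
  by (simp flip: sum_v of_real_sum)

text \<open>As \<open>e\<close> is the sum of the \<open>v\<^sub>i\<close>, a common positive imaginary part \<open>c\<close> of the coefficients can
  be traded for \<open>\<i> c e\<close>.\<close>

lemma q_stable:
  assumes z: "\<And>i. i \<in> V \<Longrightarrow> Im (z i) > 0"
  shows "q z \<noteq> 0"
proof -
  define c where "c = Min (insert 1 ((\<lambda>i. Im (z i)) ` V))"
  have c: "c > 0" "\<And>i. i \<in> V \<Longrightarrow> c \<le> Im (z i)"
    using z finV by (auto simp: c_def Min_gr_iff intro: Min_le)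
  have "(\<lambda>m. of_real 0 + (\<Sum>i\<in>V. (z i - \<i> * of_real c) * vc i m) + (\<i> * of_real c) * ec m) =
      (\<lambda>m. \<Sum>i\<in>V. z i * vc i m)"
    by (auto simp: left_diff_distrib sum_subtractf sum_distrib_left[symmetric] sum_vc)
  moreover have "H (\<lambda>m. of_real 0 + (\<Sum>i\<in>V. (z i - \<i> * of_real c) * vc i m) + (\<i> * of_real c) * ec m) \<noteq> 0"
    using c finV by (intro H_stable_aux[where x = "\<lambda>_. 0"]) auto
  ultimately show ?thesis
    by (simp add: q_def)
qed

lemma q_line: 
  assumes i: "i \<in> V"
  shows "q (\<lambda>j. s + \<tau> * y j + (if j = i then w else 0)) =
     H (\<lambda>m. s * ec m + \<tau> * (\<Sum>j\<in>V. y j * vc j m) + w * vc i m)"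
proof -
  have "(\<Sum>j\<in>V. (s + \<tau> * y j + (if j = i then w else 0)) * vc j m) =
     s * ec m + \<tau> * (\<Sum>j\<in>V. y j * vc j m) + w * vc i m" for m
  proof -
    have "(\<Sum>j\<in>V. (s + \<tau> * y j + (if j = i then w else 0)) * vc j m) =
       (\<Sum>j\<in>V. s * vc j m + \<tau> * (y j * vc j m) + (if j = i then w * vc i m else 0))"
      by (intro sum.cong) (auto simp: algebra_simps)
    also have "\<dots> = s * ec m + \<tau> * (\<Sum>j\<in>V. y j * vc j m) + w * vc i m"
      using i finV by (simp add: sum.distrib sum_distrib_left[symmetric] sum_vc)
    finally show ?thesis .
  qed
  then show ?thesis
    by (simp add: q_def)
qed

text \<open>Along a line \<open>\<i> 1 + \<tau> y\<close> consider \<open>q\<close> as a polynomial in the additional multiple \<open>w\<close> of the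
  \<open>i\<close>-th unit vector, with leading coefficient \<open>C\<^sub>N(\<tau>)\<close>. Dividing by \<open>w\<^sup>N\<close> and letting \<open>w\<close> tend to
  infinity along the imaginary axis exhibits \<open>C\<^sub>N\<close> as a limit of functions that have no zeros near
  \<open>\<tau> = 0\<close> by stability, so \<open>C\<^sub>N(0) \<noteq> 0\<close>. But at \<open>\<tau> = 0\<close> the rank-one formula leaves no terms of
  degree above one in \<open>w\<close>.\<close>

lemma q_affine:
  assumes i: "i \<in> V"
  shows "affine_at i q"
  unfolding affine_at_def
proof
  fix z :: "'v \<Rightarrow> complex"
  \<comment> \<open>at \<open>\<tau> = 1\<close> the line passes through \<open>z\<close>, except that the \<open>i\<close>-th coordinate is \<open>w\<close>\<close>
  define y where "y = (\<lambda>j. (if j = i then 0 else z j) - \<i>)"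
  define P where "P = mpsubst (\<lambda>r. [:[:complex_of_real r:]:])
     (\<lambda>m. [:[:\<i> * ec m, \<Sum>j\<in>V. y j * vc j m:], [:vc i m:]:]) h"
  have P_q: "poly (poly P [:w:]) \<tau> = q (\<lambda>j. \<i> + \<tau> * y j + (if j = i then w else 0))" for \<tau> w
    unfolding P_def poly_mpsubst q_line[OF i] by (simp add: algebra_simps)
  define N where "N = degree P"
  define C where "C b \<tau> = poly (coeff P b) \<tau>" for b \<tau>
  have expand: "q (\<lambda>j. \<i> + \<tau> * y j + (if j = i then w else 0)) = (\<Sum>b\<le>N. C b \<tau> * w ^ b)" for \<tau> w
    unfolding P_q[symmetric] C_def N_def by (simp add: poly_altdef[of P] poly_sum)
  have N: "N \<le> 1"
  proof (rule ccontr)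
    assume N: "\<not> N \<le> 1"
    have "coeff P N \<noteq> 0"
      using N unfolding N_def by (intro leading_coeff_neq_0) auto
    have C0: "C N 0 = 0"
    proof -
      define Q where "Q = (\<Sum>b\<le>N. monom (C b 0) b)"
      have "poly Q w = poly [:of_real he * \<i> ^ (d - 1) * \<i>, of_real he * \<i> ^ (d - 1) * of_real (l i):] w" for w
      proof -
        have "poly Q w = q (\<lambda>j. \<i> + 0 * y j + (if j = i then w else 0))"
          unfolding expand by (simp add: Q_def poly_sum poly_monom)
        also have "\<dots> = of_real he * \<i> ^ (d - 1) * (\<i> + of_real (l i) * w)"
          unfolding q_line[OF i] using eval[OF i, of \<i> w] by simp
        finally show ?thesis
          by (simp add: algebra_simps)
      qed
      then have "Q = [:of_real he * \<i> ^ (d - 1) * \<i>, of_real he * \<i> ^ (d - 1) * of_real (l i):]"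
        by (intro poly_eq_poly_eq_iff[THEN iffD1] ext)
      then have "coeff Q N = 0"
        using N by (simp add: coeff_pCons split: nat.split)
      then show ?thesis
        by (simp add: Q_def coeff_sum)
    qed
    \<comment> \<open>for \<open>norm \<tau> < 1 / M\<close> all coordinates of \<open>\<i> 1 + \<tau> y\<close> stay in the upper half-plane\<close>
    define M where "M = Max (insert 1 ((\<lambda>j. norm (y j)) ` V))"
    have M: "M \<ge> 1" "\<And>j. j \<in> V \<Longrightarrow> norm (y j) \<le> M"
      using finV by (auto simp: M_def intro: Max_ge)
    define f where "f \<epsilon> \<tau> = (\<Sum>b\<le>N. C b \<tau> * \<epsilon> ^ (N - b))" for \<epsilon> \<tau> :: complex
    have f0: "f 0 \<tau> = C N \<tau>" for \<tau>
    proof -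
      have "f 0 \<tau> = (\<Sum>b\<le>N. if b = N then C N \<tau> else 0)"
        unfolding f_def by (intro sum.cong) (auto simp: power_0_left)
      then show ?thesis
        by simp
    qed
    have "\<exists>\<tau>\<in>ball 0 (1 / M). f 0 \<tau> \<noteq> 0"
    proof (rule ccontr)
      assume "\<not> ?thesis"
      then have "ball 0 (1 / M) \<subseteq> {\<tau>. poly (coeff P N) \<tau> = 0}"
        by (auto simp: f0 C_def)
      moreover have "finite {\<tau>. poly (coeff P N) \<tau> = 0}"
        using \<open>coeff P N \<noteq> 0\<close> by (rule poly_roots_finite)
      ultimately have "finite (ball (0::complex) (1 / M))"
        by (rule finite_subset)
      then have "countable (ball (0::complex) (1 / M))"
        by (rule countable_finite)
      then show False
        using M(1) uncountable_ball[of "1 / M" "0::complex"] by simp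
    qed
    then obtain \<tau>0 where \<tau>0: "\<tau>0 \<in> ball 0 (1 / M)" "f 0 \<tau>0 \<noteq> 0"
      by blast
    have "f 0 0 \<noteq> 0"
    proof (rule zero_free_limit[where U = "ball 0 (1 / M)" and T = UNIV and f = f and l = 0 and
          X = "\<lambda>n. - \<i> * of_real (inverse (real (Suc n)))", OF _ _ _ _ _ _ _ _ \<tau>0])
      show "continuous_on (UNIV \<times> ball 0 (1 / M)) (\<lambda>(\<epsilon>, \<tau>). f \<epsilon> \<tau>)"
        unfolding f_def C_def case_prod_beta by (intro continuous_intros)
      show "f \<epsilon> holomorphic_on ball 0 (1 / M)" for \<epsilon>
        unfolding f_def C_def by (intro holomorphic_intros)
      have "(\<lambda>n. - \<i> * complex_of_real (inverse (real (Suc n)))) \<longlonglongrightarrow> - \<i> * of_real 0"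
        by (intro tendsto_intros LIMSEQ_inverse_real_of_nat)
      then show "(\<lambda>n. - \<i> * complex_of_real (inverse (real (Suc n)))) \<longlonglongrightarrow> 0"
        by simp
      fix n :: nat and \<tau> :: complex assume \<tau>: "\<tau> \<in> ball 0 (1 / M)"
      define w where "w = \<i> * complex_of_real (real (Suc n))"
      have w0: "w \<noteq> 0"
        unfolding w_def by (simp del: of_nat_Suc)
      have inv: "- \<i> * of_real (inverse (real (Suc n))) = inverse w"
        by (simp add: w_def field_simps del: of_nat_Suc)
      have "w ^ N * f (inverse w) \<tau> = (\<Sum>b\<le>N. C b \<tau> * w ^ b)"
        unfolding f_def sum_distrib_left
      proof (intro sum.cong refl)
        fix b assume "b \<in> {..N}"
        then have "w ^ N = w ^ b * w ^ (N - b)"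
          by (simp add: power_add[symmetric])
        then show "w ^ N * (C b \<tau> * inverse w ^ (N - b)) = C b \<tau> * w ^ b"
          using w0 by (simp add: power_inverse field_simps)
      qed
      also have "\<dots> = q (\<lambda>j. \<i> + \<tau> * y j + (if j = i then w else 0))"
        by (simp only: expand)
      also have "\<dots> \<noteq> 0"
      proof (rule q_stable)
        fix j assume j: "j \<in> V"
        have "norm (\<tau> * y j) < 1"
        proof -
          have "norm (\<tau> * y j) \<le> norm \<tau> * M"
            using M(2)[OF j] by (simp add: norm_mult mult_left_mono)
          also have "\<dots> < 1"
            using \<tau> M(1) by (simp add: field_simps)
          finally show ?thesis .
        qed
        then have "\<bar>Im (\<tau> * y j)\<bar> < 1"
          using abs_Im_le_cmod le_less_trans by blast
        moreover have "Im (if j = i then w else 0) \<ge> 0"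
          by (simp add: w_def)
        ultimately show "Im (\<i> + \<tau> * y j + (if j = i then w else 0)) > 0"
          by (simp only: plus_complex.sel imaginary_unit.sel)
      qed
      finally show "f (- \<i> * of_real (inverse (real (Suc n)))) \<tau> \<noteq> 0"
        unfolding inv by auto
    qed (use M in auto)
    then show False
      using C0 f0 by simp
  qed
  have "q (z(i := w)) = C 0 1 + (if N = 0 then 0 else C 1 1) * w" for w
  proof -
    have "q (z(i := w)) = q (\<lambda>j. \<i> + 1 * y j + (if j = i then w else 0))"
      by (intro arg_cong[where f = q]) (auto simp: y_def)
    also have "\<dots> = (\<Sum>b\<le>N. C b 1 * w ^ b)"
      by (rule expand)
    also have "\<dots> = C 0 1 + (if N = 0 then 0 else C 1 1) * w"
      using N by (cases N) auto
    finally show ?thesis .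
  qed
  then show "\<exists>a b. \<forall>w. q (z(i := w)) = a + b * w"
    by blast
qed

lemma q_stable_multiaffine: "stable_multiaffine V d q"
proof -
  have "continuous_on UNIV q"
    unfolding q_def by (intro continuous_on_mpsubst continuous_intros continuous_on_product_coordinates)
  moreover have "q (\<lambda>i. cnj (z i)) = cnj (q z)" for z
    unfolding q_def mpsubst_cnj[symmetric] by simp
  moreover have "q (\<lambda>i. c * z i) = c ^ d * q z" for c z
    unfolding q_def H_hom[symmetric] by (simp add: sum_distrib_left mult.assoc)
  moreover have "(\<lambda>w. q (\<lambda>i. u i + w * z i)) holomorphic_on UNIV" for u z
    unfolding q_def by (intro holomorphic_on_mpsubst holomorphic_intros)
  moreover have "q z = q z'" if "\<forall>i\<in>V. z i = z' i" for z z'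
    unfolding q_def using that by simp
  ultimately show ?thesis
    using q_affine q_stable unfolding stable_multiaffine_def by blast
qed

lemma q_upd_one:
  assumes i: "i \<in> V"
  shows "q ((\<lambda>_. 1)(i := w)) = of_real he * (1 + of_real (l i) * (w - 1))"
proof -
  have "q ((\<lambda>_. 1)(i := w)) = q (\<lambda>j. 1 + 0 * 0 + (if j = i then w - 1 else 0))"
    by (intro arg_cong[where f = q]) auto
  also have "\<dots> = of_real he * (1 + of_real (l i) * (w - 1))"
    unfolding q_line[OF i, where y = "\<lambda>_. 0"] using eval[OF i, of 1 "w - 1"] by simp
  finally show ?thesis .
qed

lemma q_one: "q (\<lambda>_. 1) = of_real he"
  by (simp add: q_def sum_vc mpsubst_of_real he_eq)

lemma pd_q_one: "i \<in> V \<Longrightarrow> pd i q (\<lambda>_. 1) = of_real (he * l i)"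
  by (simp add: pd_def q_upd_one field_simps)

lemma q_charpoly:
  assumes S: "S \<subseteq> V"
  shows "q (\<lambda>i. if i \<in> S then of_real (t - 1) else of_real t) = of_real (poly (hyp_charpoly h e (\<Sum>i\<in>S. v i)) t)"
proof -
  have "(\<Sum>i\<in>V. (if i \<in> S then of_real (t - 1) else of_real t) * vc i m) =
     of_real ((t *\<^sub>R e - (\<Sum>i\<in>S. v i)) $ m)" for m
  proof -
    have "(\<Sum>i\<in>V. (if i \<in> S then of_real (t - 1) else of_real t) * vc i m) =
       (\<Sum>i\<in>V. of_real t * vc i m - (if i \<in> S then vc i m else 0))"
      by (intro sum.cong) (auto simp: algebra_simps)
    also have "\<dots> = of_real t * ec m - (\<Sum>i\<in>S. vc i m)"
      using finV S by (simp add: sum_subtractf sum_distrib_left[symmetric] sum_vc sum.inter_restrict[symmetric] Int_absorb1)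
    finally show ?thesis
      by simp
  qed
  then show ?thesis
    by (simp only: q_def mpsubst_of_real poly_hyp_charpoly)
qed

end

section \<open>Strongly Rayleigh distributions\<close>

definition squarefree_monomial :: "'v set \<Rightarrow> 'v \<Rightarrow>\<^sub>0 nat" where
  "squarefree_monomial S = (\<Sum>i\<in>S. Poly_Mapping.single i 1)"

lemma lookup_squarefree_monomial:
  assumes "finite S"
  shows "Poly_Mapping.lookup (squarefree_monomial S) i = (if i \<in> S then 1 else 0)"
proof -
  have "Poly_Mapping.lookup (squarefree_monomial S) i = (\<Sum>j\<in>S. if j = i then 1 else 0)"
    unfolding squarefree_monomial_def lookup_sum by (intro sum.cong) (auto simp: lookup_single)
  then show ?thesis
    using assms by simp
qed

lemma keys_squarefree_monomial: "finite S \<Longrightarrow> Poly_Mapping.keys (squarefree_monomial S) = S"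
  by (auto simp: in_keys_iff lookup_squarefree_monomial split: if_splits)

lemma inj_on_squarefree_monomial: "finite V \<Longrightarrow> inj_on squarefree_monomial (Pow V)"
  by (rule inj_onI) (metis PowD finite_subset keys_squarefree_monomial)

lemma lookup_generating_poly:
  assumes V: "finite V" and S: "S \<in> Pow V"
  shows "Poly_Mapping.lookup (generating_poly V \<mu>) (squarefree_monomial S) = pmf \<mu> S"
proof -
  have "Poly_Mapping.lookup (generating_poly V \<mu>) (squarefree_monomial S) =
      (\<Sum>T\<in>Pow V. if T = S then pmf \<mu> S else 0)"
    unfolding generating_poly_def lookup_sum squarefree_monomial_def[symmetric]
  proof (intro sum.cong refl)
    fix T assume "T \<in> Pow V"
    then have "squarefree_monomial T = squarefree_monomial S \<longleftrightarrow> T = S"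
      using inj_on_eq_iff[OF inj_on_squarefree_monomial[OF V]] S by blast
    then show "Poly_Mapping.lookup (Poly_Mapping.single (squarefree_monomial T) (pmf \<mu> T)) (squarefree_monomial S) =
        (if T = S then pmf \<mu> S else 0)"
      by (auto simp: lookup_single)
  qed
  then show ?thesis
    using V S by simp
qed

lemma keys_generating_poly:
  assumes V: "finite V"
  shows "Poly_Mapping.keys (generating_poly V \<mu>) \<subseteq> squarefree_monomial ` Pow V"
  unfolding generating_poly_def squarefree_monomial_def[symmetric]
  using keys_sum[of "\<lambda>S. Poly_Mapping.single (squarefree_monomial S) (pmf \<mu> S)" "Pow V"]
  by (auto split: if_splits)

lemma mpsubst_generating_poly:
  assumes V: "finite V"
  shows "mpsubst complex_of_real z (generating_poly V \<mu>) = (\<Sum>S\<in>Pow V. of_real (pmf \<mu> S) * (\<Prod>i\<in>S. z i))"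
proof -
  let ?p = "generating_poly V \<mu>"
  let ?t = "\<lambda>a. complex_of_real (Poly_Mapping.lookup ?p a) *
       (\<Prod>i\<in>Poly_Mapping.keys a. z i ^ Poly_Mapping.lookup a i)"
  have "mpsubst complex_of_real z ?p = (\<Sum>a\<in>squarefree_monomial ` Pow V. ?t a)"
    unfolding mpsubst_def using V keys_generating_poly[OF V, of \<mu>]
    by (intro sum.mono_neutral_left) (auto simp: in_keys_iff)
  also have "\<dots> = (\<Sum>S\<in>Pow V. ?t (squarefree_monomial S))"
    by (simp add: sum.reindex[OF inj_on_squarefree_monomial[OF V]])
  also have "\<dots> = (\<Sum>S\<in>Pow V. of_real (pmf \<mu> S) * (\<Prod>i\<in>S. z i))"
  proof (intro sum.cong refl)
    fix S assume S: "S \<in> Pow V"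
    then have "finite S"
      using V by (auto intro: finite_subset)
    then show "?t (squarefree_monomial S) = of_real (pmf \<mu> S) * (\<Prod>i\<in>S. z i)"
      by (simp add: lookup_generating_poly[OF V S] keys_squarefree_monomial lookup_squarefree_monomial)
  qed
  finally show ?thesis .
qed

lemma homogeneous_distribution_card:
  assumes V: "finite V" and hom: "homogeneous_of_degree k (generating_poly V \<mu>)"
    and S: "S \<subseteq> V" "pmf \<mu> S \<noteq> 0"
  shows "card S = k"
proof -
  have fin: "finite S"
    using V S by (auto intro: finite_subset)
  have "squarefree_monomial S \<in> Poly_Mapping.keys (generating_poly V \<mu>)"
    using lookup_generating_poly[OF V, of S \<mu>] S by (simp add: in_keys_iff)
  then show ?thesis
    using hom fin by (auto simp: homogeneous_of_degree_def keys_squarefree_monomial lookup_squarefree_monomial)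
qed

theorem theorem1p6:
  fixes h :: "('m::finite) rmpoly" and e :: "real ^ 'm" and d n :: nat
    and \<mu> :: "nat set pmf" and v :: "nat \<Rightarrow> real ^ 'm" and \<epsilon>1 \<epsilon>2 :: real
  assumes "hyperbolic d h e" and "d \<ge> 1"
    and "strongly_rayleigh {1..n} \<mu>" and "homogeneous_distribution {1..n} \<mu>"
    and "\<And>i. i \<in> {1..n} \<Longrightarrow> measure_pmf.prob \<mu> {S. i \<in> S} \<le> \<epsilon>1"
    and "\<And>i. i \<in> {1..n} \<Longrightarrow> v i \<in> hyp_cone d h e"
    and "(\<Sum>i = 1..n. v i) = e"
    and "\<And>i. i \<in> {1..n} \<Longrightarrow> hyp_rank d h e (v i) \<le> 1"
    and "\<And>i. i \<in> {1..n} \<Longrightarrow> hyp_norm d h e (v i) \<le> \<epsilon>2"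
  shows "measure_pmf.prob \<mu>
    {S. hyp_norm d h e (\<Sum>i\<in>S. v i) \<le> 4 * (\<epsilon>1 + \<epsilon>2) + 2 * (\<epsilon>1 + \<epsilon>2)\<^sup>2} > 0"
proof -
  define V where "V = {1..n}"
  define \<epsilon> where "\<epsilon> = \<epsilon>1 + \<epsilon>2"
  define he where "he = mpsubst (\<lambda>r. r) (($) e) h"
  have finV: "finite V"
    by (simp add: V_def)
  have hyp: "hyperbolic d h e" and d: "d \<ge> 1"
    by fact+
  have supp: "set_pmf \<mu> \<subseteq> Pow V" and stable: "real_stable V (generating_poly V \<mu>)"
    using assms(3) by (simp_all add: strongly_rayleigh_def V_def)
  obtain k where k: "homogeneous_of_degree k (generating_poly V \<mu>)"
    using assms(4) by (auto simp: homogeneous_distribution_def V_def)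
  have "\<exists>l. \<forall>i\<in>V. 0 \<le> l i \<and> l i \<le> \<epsilon>2 \<and>
      (\<forall>s w. mpsubst complex_of_real (\<lambda>m. s * of_real (e $ m) + w * of_real (v i $ m)) h =
           of_real he * s ^ (d - 1) * (s + of_real (l i) * w))"
    unfolding he_def by (intro bchoice ballI rank_one_eval hyp d assms(6,8,9)) (simp_all add: V_def)
  then obtain l where l: "\<And>i. i \<in> V \<Longrightarrow> 0 \<le> l i" "\<And>i. i \<in> V \<Longrightarrow> l i \<le> \<epsilon>2"
     "\<And>i s w. i \<in> V \<Longrightarrow> mpsubst complex_of_real (\<lambda>m. s * of_real (e $ m) + w * of_real (v i $ m)) h =
           of_real he * s ^ (d - 1) * (s + of_real (l i) * w)"
    by blast
  interpret vecs: rank_one_vectors d h e V v l he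
    by unfold_locales (use hyp finV l assms(7) in \<open>auto simp: he_def V_def\<close>)
  define q where "q = vecs.q"
  have q: "stable_multiaffine V d q"
    unfolding q_def by (rule vecs.q_stable_multiaffine)
  have q_one: "q (\<lambda>_. 1) = of_real he" and he: "he > 0"
    unfolding q_def by (rule vecs.q_one, rule vecs.he_pos)
  interpret pair: stable_pair V k d "pmf \<mu>" "\<lambda>z. \<Sum>S\<in>Pow V. of_real (pmf \<mu> S) * (\<Prod>i\<in>S. z i)" q
  proof
    show "(\<Sum>S\<in>Pow V. pmf \<mu> S) = 1"
      using finV supp by (intro sum_pmf_eq_1) auto
    show "card S = k" if "S \<subseteq> V" "pmf \<mu> S \<noteq> 0" for S
      by (rule homogeneous_distribution_card[OF finV k that])
    show "(\<Sum>S\<in>Pow V. complex_of_real (pmf \<mu> S) * (\<Prod>i\<in>S. z i)) \<noteq> 0" if "\<forall>i\<in>V. 0 < Im (z i)" for z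
      using stable that unfolding real_stable_def mpsubst_generating_poly[OF finV] by blast
  qed (use finV q q_one he in auto)
  have norm_le: "hyp_norm d h e (\<Sum>i\<in>S. v i) \<le> B"
    if S: "S \<subseteq> V" and B: "B \<ge> 0" and pos: "\<And>y. y > 2 * B \<Longrightarrow> Re (subset_charpoly q S (complex_of_real y)) > 0"
    for S B
    unfolding hyp_norm_le_iff[OF hyp d]
  proof (intro allI impI)
    fix r assume r: "poly (hyp_charpoly h e (\<Sum>i\<in>S. v i)) r = 0"
    have zero: "q (\<lambda>i. if i \<in> S then of_real (r - 1) else of_real r) = 0"
      unfolding q_def vecs.q_charpoly[OF S] by (simp add: r)
    have "r \<ge> 0"
    proof (rule ccontr)
      assume "\<not> r \<ge> 0"
      then have "Re (q (\<lambda>i. of_real (if i \<in> S then 1 - r else - r))) > 0"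
        using he by (intro stable_multiaffine_pos[OF q]) (auto simp: q_one)
      moreover have "(\<lambda>i. of_real (if i \<in> S then 1 - r else - r)) =
         (\<lambda>i. (- 1) * (if i \<in> S then of_real (r - 1) else complex_of_real r))"
        by auto
      ultimately show False
        using zero by (simp only: pair.q_hom) simp
    qed
    moreover have "r \<le> B"
    proof (rule ccontr)
      assume "\<not> r \<le> B"
      then have "Re (subset_charpoly q S (complex_of_real (2 * r))) > 0"
        by (intro pos) simp
      moreover have "subset_charpoly q S (complex_of_real (2 * r)) =
          q (\<lambda>i. 2 * (if i \<in> S then of_real (r - 1) else complex_of_real r))"
        unfolding subset_charpoly_def by (intro arg_cong[where f = q]) auto
      ultimately show False
        using zero by (simp only: pair.q_hom) simp
    qed
    ultimately show "\<bar>r\<bar> \<le> B"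
      by simp
  qed
  have "\<exists>S\<in>set_pmf \<mu>. hyp_norm d h e (\<Sum>i\<in>S. v i) \<le> 4 * \<epsilon> + 2 * \<epsilon>\<^sup>2"
  \<comment> \<open>unless \<open>\<mu>\<close> is concentrated on the empty set, \<open>\<epsilon>1\<close> is positive, as the barrier needs\<close>
  proof (cases "\<exists>i\<in>V. \<exists>S\<in>set_pmf \<mu>. i \<in> S")
    case True
    then obtain i S where iS: "i \<in> V" "S \<in> set_pmf \<mu>" "i \<in> S"
      by blast
    have "0 < measure_pmf.prob \<mu> {S. i \<in> S}"
      using iS(3) by (intro measure_pmf_posI[OF iS(2)]) simp
    then have "\<epsilon>1 > 0"
      using assms(5)[of i] iS(1) by (simp add: V_def)
    moreover have "\<epsilon>2 \<ge> 0"
      using l(1,2)[OF iS(1)] by simp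
    ultimately have \<epsilon>: "\<epsilon> > 0"
      by (simp add: \<epsilon>_def)
    have "Re (mixed_charpoly V q (pmf \<mu>) (complex_of_real y)) > 0" if y: "y \<ge> 8 * \<epsilon>" for y
    proof (rule pair.mixed_charpoly_pos[of \<epsilon>1 \<epsilon>2])
      fix i assume i: "i \<in> V"
      have "(\<Sum>S | S \<subseteq> V \<and> i \<in> S. pmf \<mu> S) = measure_pmf.prob \<mu> {S. S \<subseteq> V \<and> i \<in> S}"
        using finV by (subst measure_measure_pmf_finite) auto
      also have "\<dots> \<le> measure_pmf.prob \<mu> {S. i \<in> S}"
        by (intro measure_pmf.finite_measure_mono) auto
      also have "\<dots> \<le> \<epsilon>1"
        using assms(5) i by (simp add: V_def)
      finally show "(\<Sum>S | S \<subseteq> V \<and> i \<in> S. pmf \<mu> S) \<le> \<epsilon>1" .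
      show "Re (pd i q (\<lambda>_. 1)) \<le> \<epsilon>2 * Re (q (\<lambda>_. 1))"
        using vecs.pd_q_one[OF i] l(2)[OF i] he by (simp add: q_def[symmetric] q_one)
    qed (use \<epsilon> y in \<open>simp_all add: \<epsilon>_def\<close>)
    then obtain S where S: "S \<subseteq> V" "pmf \<mu> S > 0"
      and pos: "\<And>y. y \<ge> 8 * \<epsilon> \<Longrightarrow> Re (subset_charpoly q S (complex_of_real y)) > 0"
      using pair.interlacing_selection[of "8 * \<epsilon>"] by blast
    have "hyp_norm d h e (\<Sum>i\<in>S. v i) \<le> 4 * \<epsilon>"
      using S \<epsilon> by (intro norm_le pos) auto
    then have "hyp_norm d h e (\<Sum>i\<in>S. v i) \<le> 4 * \<epsilon> + 2 * \<epsilon>\<^sup>2"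
      using zero_le_power2[of \<epsilon>] by linarith
    moreover have "S \<in> set_pmf \<mu>"
      using S(2) by (simp add: set_pmf_iff)
    ultimately show ?thesis
      by blast
  next
    case False
    have "V \<noteq> {}"
    proof
      assume "V = {}"
      then have "e = 0"
        using vecs.sum_v by simp
      then have "mpsubst complex_of_real (\<lambda>m. 0 * of_real (e $ m)) h = of_real he"
        using mpsubst_of_real[of "($) e" h] by (simp add: he_def)
      then show False
        using mpsubst_homogeneous[of d h complex_of_real 0 "\<lambda>m. of_real (e $ m)"] hyp d he
        by (simp add: hyperbolic_def power_0_left)
    qed
    then obtain i where i: "i \<in> V"
      by blast
    have "\<epsilon>1 \<ge> 0"
      using i by (intro order_trans[OF measure_nonneg assms(5)[of i]]) (simp add: V_def)
    moreover have "\<epsilon>2 \<ge> 0"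
      using l(1,2)[OF i] by simp
    ultimately have \<epsilon>: "\<epsilon> \<ge> 0"
      by (simp add: \<epsilon>_def)
    obtain S where S: "S \<in> set_pmf \<mu>"
      using set_pmf_not_empty[of \<mu>] by blast
    then have "S = {}"
      using False supp by blast
    moreover have "hyp_norm d h e (\<Sum>i\<in>{}. v i) \<le> 0"
    proof (rule norm_le)
      fix y :: real assume "y > 2 * 0"
      then show "Re (subset_charpoly q {} (complex_of_real y)) > 0"
        using stable_multiaffine_pos[OF q, of "\<lambda>_. y"] he by (simp add: subset_charpoly_def q_one)
    qed auto
    ultimately show ?thesis
      using S \<epsilon> by (intro bexI[of _ S]) (auto intro: order_trans)
  qed
  then show ?thesis
    unfolding \<epsilon>_def by (auto intro: measure_pmf_posI)
qed

end
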